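(* Let $p\geq 1$ be an integer and let $G$ be an outerplanar graph with maximum degree $\Delta\geq p+3$. Then $C_{p,1}^T(G)\leq \Delta+2p-1$.
   Context: All graphs are finite, simple and connected. An outerplanar graph is a planar graph that can be embedded in the plane so that all vertices lie on the boundary of a single face. For an integer $p$, a $(p,1)$-total labelling of a graph $G$ is a function $c$ from $V(G)\cup E(G)$ to the nonnegative integers such that $c(u)\neq c(v)$ whenever $uv\in E(G)$, $c(e)\neq c(e')$ whenever $e,e'$ are distinct edges sharing an endpoint, and $|c(u)-c(e)|\geq p$ whenever vertex $u$ is incident to edge $e$. A list assignment $L$ assigns to every $x\in V(G)\cup E(G)$ a set $L(x)$ of nonnegative integers; $G$ is $L$-$(p,1)$-total labelable if it has a $(p,1)$-total labelling $c$ with $c(x)\in L(x)$ for all $x$. The $(p,1)$-total labelling choosability $C_{p,1}^T(G)$ is the minimum $k$ such that $G$ is $L$-$(p,1)$-total labelable for every list assignment $L$ with $|L(x)|=k$ for all $x\in V(G)\cup E(G)$. *)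

theory Defs
  imports "HOL-Analysis.Analysis"
begin

definition simple_graph :: "'a set \<Rightarrow> 'a set set \<Rightarrow> bool" where
  "simple_graph V E \<longleftrightarrow> finite V \<and>
     (\<forall>e\<in>E. \<exists>u v. e = {u, v} \<and> u \<noteq> v \<and> u \<in> V \<and> v \<in> V)"

definition adj :: "'a set set \<Rightarrow> 'a \<Rightarrow> 'a \<Rightarrow> bool" where
  "adj E u v \<longleftrightarrow> {u, v} \<in> E"

definition connected_graph :: "'a set \<Rightarrow> 'a set set \<Rightarrow> bool" where
  "connected_graph V E \<longleftrightarrow> V \<noteq> {} \<and> (\<forall>u\<in>V. \<forall>v\<in>V. (adj E)\<^sup>*\<^sup>* u v)"

definition degree :: "'a set set \<Rightarrow> 'a \<Rightarrow> nat" where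
  "degree E v = card {e\<in>E. v \<in> e}"

definition max_degree :: "'a set \<Rightarrow> 'a set set \<Rightarrow> nat" where
  "max_degree V E = Max (degree E ` V)"

definition outerplanar :: "'a set \<Rightarrow> 'a set set \<Rightarrow> bool" where
  "outerplanar V E \<longleftrightarrow>
    (\<exists>(pos :: 'a \<Rightarrow> real \<times> real) (curve :: 'a set \<Rightarrow> real \<Rightarrow> real \<times> real).
       inj_on pos V \<and>
       (\<forall>e\<in>E. \<exists>u v. e = {u, v} \<and> arc (curve e) \<and>
                 pathstart (curve e) = pos u \<and> pathfinish (curve e) = pos v) \<and>
       (\<forall>e\<in>E. path_image (curve e) \<inter> pos ` V = pos ` e) \<and>
       (\<forall>e\<in>E. \<forall>e'\<in>E. e \<noteq> e' \<longrightarrow>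
                 path_image (curve e) \<inter> path_image (curve e') \<subseteq> pos ` (e \<inter> e')) \<and>
       (\<exists>F \<in> components (- (pos ` V \<union> (\<Union>e\<in>E. path_image (curve e)))).
          pos ` V \<subseteq> frontier F))"

definition total_elems :: "'a set \<Rightarrow> 'a set set \<Rightarrow> ('a + 'a set) set" where
  "total_elems V E = Inl ` V \<union> Inr ` E"

definition p1_total_labelling ::
  "nat \<Rightarrow> 'a set \<Rightarrow> 'a set set \<Rightarrow> ('a + 'a set \<Rightarrow> nat) \<Rightarrow> bool" where
  "p1_total_labelling p V E c \<longleftrightarrow>
     (\<forall>u v. {u, v} \<in> E \<longrightarrow> c (Inl u) \<noteq> c (Inl v)) \<and>
     (\<forall>e\<in>E. \<forall>e'\<in>E. e \<noteq> e' \<and> e \<inter> e' \<noteq> {} \<longrightarrow> c (Inr e) \<noteq> c (Inr e')) \<and>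
     (\<forall>u\<in>V. \<forall>e\<in>E. u \<in> e \<longrightarrow> \<bar>int (c (Inl u)) - int (c (Inr e))\<bar> \<ge> int p)"

definition L_p1_total_labelable ::
  "nat \<Rightarrow> 'a set \<Rightarrow> 'a set set \<Rightarrow> ('a + 'a set \<Rightarrow> nat set) \<Rightarrow> bool" where
  "L_p1_total_labelable p V E L \<longleftrightarrow>
     (\<exists>c. p1_total_labelling p V E c \<and> (\<forall>x\<in>total_elems V E. c x \<in> L x))"

definition p1_total_choosability :: "nat \<Rightarrow> 'a set \<Rightarrow> 'a set set \<Rightarrow> nat" where
  "p1_total_choosability p V E =
     (LEAST k. \<forall>L. (\<forall>x\<in>total_elems V E. finite (L x) \<and> card (L x) = k)
                    \<longrightarrow> L_p1_total_labelable p V E L)"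

end

theory Submission
  imports Defs
begin

text \<open>
  Write \<open>\<Delta>\<close> for the maximum degree and \<open>k = \<Delta> + 2p - 1\<close>. A minimal counterexample is searched for a small
  subgraph over which every labelling of the rest extends. The theta-curve theorem shows that in an outerplanar
  drawing no three internally disjoint paths with common ends all have inner vertices, and that no cycle has
  crossing chords; hence an end block is a Hamiltonian cycle with non-crossing chords. Looking at the
  innermost chords one finds a vertex of degree 1, or an edge joining a vertex of degree 2 to one of degree at
  most 3, or a \<^emph>\<open>sun\<close>: a vertex \<open>x\<close> with neighbours \<open>u, v, y, z\<close> such that \<open>u\<close> has neighbours \<open>x, y\<close> and
  \<open>v\<close> has neighbours \<open>x, z\<close>. The sun can moreover be chosen such that \<open>y\<close> has degree at most 4, or degree 5
  with a triangle \<open>y t w\<close> (\<open>t\<close> of degree 2) attached, or degree 6 with a second sun attached.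

  The first two configurations reduce by counting, where a vertex list of more than \<open>p\<close> colours lies within
  distance less than \<open>p\<close> of few edge colours only. For a sun, counting leaves exactly one colour for \<open>xu\<close> and
  one for \<open>xv\<close>, and the labelling extends unless these coincide. That coincidence forces all lists to have
  minimal size, which is possible only if \<open>\<Delta> = p + 3\<close>, and determines their structure so precisely that
  recolouring the sun or the neighbourhood of \<open>y\<close> escapes from it. A recolouring within the sun suffices if
  \<open>p = 1\<close> or \<open>y\<close> has degree less than \<open>\<Delta>\<close>; the remaining cases are \<open>p = 2\<close> with the triangle and \<open>p = 3\<close>
  with the second sun.
\<close>

section \<open>Curves in the plane\<close>

text \<open>Write D for the maximum degree. A coloured vertex takes 2p - 1 colours from the list of
  an incident edge and vice versa, so a list of D + 2p - 1 colours behaves like one of size D. In a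
  sun whose other elements are coloured, each of the edges \<open>xu\<close>, \<open>xv\<close>
  keeps at least D - 3 colours and each of the vertices \<open>u\<close>, \<open>v\<close> at least
  D - 2. With D \<ge> p + 3 these are p and p + 1, exactly the numbers for which a compatible pair
  must exist (\<open>far_pair\<close>). Each side of a sun can therefore be completed by itself; the
  obstacle is the extra condition that \<open>xu\<close> and \<open>xv\<close> differ.

  Failure makes every estimate an equality, so D = p + 3. The degrees 4, 5 and 6 of \<open>y\<close>
  in the three kinds of sun equal p + 3 only for p = 1, 2 and 3, which is where the special cases
  come from. If \<open>y\<close> has smaller degree, there is a third colour for \<open>uy\<close>,
  and a change of \<open>uy\<close> alone can fail twice only if p = 2.

  The induction deletes edges but keeps D and the lists: D bounds the degrees and need not be
  attained in a subgraph.\<close>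

definition arcset :: "'a::topological_space set \<Rightarrow> 'a \<Rightarrow> 'a \<Rightarrow> bool" where
  "arcset S a b \<longleftrightarrow> (\<exists>g. arc g \<and> path_image g = S \<and> pathstart g = a \<and> pathfinish g = b)"

lemma arcset_sym: "arcset S a b \<Longrightarrow> arcset S b a"
  unfolding arcset_def by (metis arc_reversepath path_image_reversepath pathfinish_reversepath pathstart_reversepath)

lemma arcset_ends: "arcset S a b \<Longrightarrow> a \<in> S \<and> b \<in> S \<and> a \<noteq> b"
  unfolding arcset_def using arc_distinct_ends by force

lemma arcset_join:
  assumes "arcset S a b" "arcset T b c" "S \<inter> T \<subseteq> {b}"
  shows "arcset (S \<union> T) a c"
proof -
  obtain g h where g: "arc g" "path_image g = S" "pathstart g = a" "pathfinish g = b"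
    and h: "arc h" "path_image h = T" "pathstart h = b" "pathfinish h = c"
    using assms unfolding arcset_def by auto
  have "arc (g +++ h)" using g h assms(3) by (intro arc_join) auto
  moreover have "path_image (g +++ h) = S \<union> T" using g h by (simp add: path_image_join)
  ultimately show ?thesis using g h unfolding arcset_def by (intro exI[of _ "g +++ h"]) auto
qed

lemma arcset_props:
  fixes S :: "'a::metric_space set"
  assumes "arcset S a b"
  shows "compact S" "connected S" "infinite S"
proof -
  obtain g where g: "arc g" "path_image g = S" using assms unfolding arcset_def by auto
  then show "compact S" "connected S"
    using compact_path_image[OF arc_imp_path] connected_path_image[OF arc_imp_path] by auto
  then show "infinite S" using arcset_ends[OF assms] connected_finite_iff_sing[of S] by auto
qed

text \<open>One arc followed by the reverse of the other is a simple closed curve, to which the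
  Jordan curve theorem on \<open>complex\<close> applies. For this reason all curve arguments take
  place in \<open>complex\<close>.\<close>

lemma jordan_arcs:
  fixes S T :: "complex set"
  assumes "arcset S a b" "arcset T a b" "S \<inter> T = {a, b}"
  shows "inside (S \<union> T) \<noteq> {}" "open (inside (S \<union> T))" "connected (inside (S \<union> T))"
    "open (outside (S \<union> T))" "connected (outside (S \<union> T))" "bounded (inside (S \<union> T))"
    "inside (S \<union> T) \<inter> outside (S \<union> T) = {}" "inside (S \<union> T) \<union> outside (S \<union> T) = - (S \<union> T)"
    "frontier (inside (S \<union> T)) = S \<union> T"
proof -
  obtain g h where g: "arc g" "path_image g = S" "pathstart g = a" "pathfinish g = b"
    and h: "arc h" "path_image h = T" "pathstart h = a" "pathfinish h = b"
    using assms unfolding arcset_def by auto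
  have "simple_path (g +++ reversepath h)"
    using g h assms(3) by (intro simple_path_join_loop) (auto simp: arc_reversepath)
  moreover have "path_image (g +++ reversepath h) = S \<union> T" using g h by (simp add: path_image_join)
  moreover have "pathfinish (g +++ reversepath h) = pathstart (g +++ reversepath h)" using g h by simp
  ultimately show "inside (S \<union> T) \<noteq> {}" "open (inside (S \<union> T))" "connected (inside (S \<union> T))"
    "open (outside (S \<union> T))" "connected (outside (S \<union> T))" "bounded (inside (S \<union> T))"
    "inside (S \<union> T) \<inter> outside (S \<union> T) = {}" "inside (S \<union> T) \<union> outside (S \<union> T) = - (S \<union> T)"
    "frontier (inside (S \<union> T)) = S \<union> T"
    using Jordan_inside_outside[of "g +++ reversepath h"] by simp_all
qed

lemma connected_in_or_out:
  fixes S T :: "complex set"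
  assumes "arcset S a b" "arcset T a b" "S \<inter> T = {a, b}" "connected F" "F \<inter> (S \<union> T) = {}"
  shows "F \<subseteq> inside (S \<union> T) \<or> F \<subseteq> outside (S \<union> T)"
proof -
  note J = jordan_arcs[OF assms(1-3)]
  have "F \<subseteq> inside (S \<union> T) \<union> outside (S \<union> T)" using J(8) assms(5) by blast
  moreover have "inside (S \<union> T) \<inter> F = {} \<or> outside (S \<union> T) \<inter> F = {}"
    using connectedD[OF assms(4) J(2,4)] J(7) calculation by blast
  ultimately show ?thesis by blast
qed

text \<open>The arc \<open>R\<close> cuts the inside of \<open>S \<union> T\<close> into two parts.
  A connected \<open>F\<close> outside stays away from the interior of \<open>R\<close>; in one of
  the two parts it stays away from the arc that bounds the other part only.\<close>

lemma theta_inside: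
  fixes S T R F :: "complex set"
  assumes arcs: "arcset S a b" "arcset T a b" "arcset R a b"
    and int: "S \<inter> T = {a, b}" "S \<inter> R = {a, b}" "T \<inter> R = {a, b}"
    and ins: "R \<inter> inside (S \<union> T) \<noteq> {}"
    and F: "connected F" "F \<inter> (S \<union> T \<union> R) = {}"
  shows "closure F \<inter> S \<subseteq> {a, b} \<or> closure F \<inter> T \<subseteq> {a, b} \<or> closure F \<inter> R \<subseteq> {a, b}"
proof -
  obtain c1 c2 c where c: "arc c1" "path_image c1 = S" "pathstart c1 = a" "pathfinish c1 = b"
      "arc c2" "path_image c2 = T" "pathstart c2 = a" "pathfinish c2 = b"
      "arc c" "path_image c = R" "pathstart c = a" "pathfinish c = b"
    using arcs unfolding arcset_def by metis
  have ab: "a \<noteq> b" using arcset_ends[OF arcs(1)] by simp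
  have split: "inside (S \<union> R) \<inter> inside (T \<union> R) = {}"
      "inside (S \<union> R) \<union> inside (T \<union> R) \<union> (R - {a, b}) = inside (S \<union> T)"
    using split_inside_simple_closed_curve[of c1 a b c2 c] c ab int ins by (auto simp: arc_imp_simple_path)
  note J = jordan_arcs[OF arcs(1,2) int(1)]
  \<comment> \<open>The closure of \<open>F\<close> adds to the inside of
    \<open>S \<union> R\<close> at most its frontier, and neither the inside of
    \<open>S \<union> T\<close> nor that frontier contains a point of \<open>T\<close> other than
    \<open>a\<close> and \<open>b\<close>.\<close>
  have cl: "closure F \<inter> T \<subseteq> {a, b}"
    if "F \<subseteq> inside (S \<union> R)" "inside (S \<union> R) \<subseteq> inside (S \<union> T)" "arcset S a b" "S \<inter> R = {a, b}" "S \<inter> T = {a, b}" "T \<inter> R = {a, b}"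
    for S T
  proof -
    have "frontier (inside (S \<union> R)) = S \<union> R" using jordan_arcs(9)[OF that(3) arcs(3) that(4)] .
    then have "closure (inside (S \<union> R)) \<subseteq> inside (S \<union> R) \<union> (S \<union> R)"
      using closure_Un_frontier[of "inside (S \<union> R)"] by blast
    then have "closure F \<subseteq> inside (S \<union> T) \<union> (S \<union> R)" using closure_mono[OF that(1)] that(2) by blast
    moreover have "inside (S \<union> T) \<inter> (S \<union> T) = {}" by (rule inside_no_overlap)
    ultimately show ?thesis using that(5,6) by blast
  qed
  consider "F \<subseteq> outside (S \<union> T)" | "F \<subseteq> inside (S \<union> T)"
    using connected_in_or_out[OF arcs(1,2) int(1) F(1)] F(2) by blast
  then show ?thesis
  proof cases
    case 1
    then have "inside (S \<union> T) \<inter> closure F = {}"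
      using open_Int_closure_eq_empty[OF J(2), of F] J(7) by blast
    then have "closure F \<inter> R \<subseteq> {a, b}" using split(2) by blast
    then show ?thesis by blast
  next
    case 2
    have "F \<inter> (R - {a, b}) = {}" using F(2) by blast
    then have "F \<subseteq> inside (S \<union> R) \<union> inside (T \<union> R)" using 2 split(2) by blast
    moreover have "inside (S \<union> R) \<inter> F = {} \<or> inside (T \<union> R) \<inter> F = {}"
      using connectedD[OF F(1) jordan_arcs(2)[OF arcs(1,3) int(2)] jordan_arcs(2)[OF arcs(2,3) int(3)]]
        split(1) calculation by blast
    ultimately consider "F \<subseteq> inside (S \<union> R)" | "F \<subseteq> inside (T \<union> R)" by blast
    then show ?thesis
    proof cases
      case 1
      have "closure F \<inter> T \<subseteq> {a, b}" by (rule cl[OF 1 _ arcs(1) int(2,1,3)]) (use split(2) in blast)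
      then show ?thesis by blast
    next
      case 2
      have "closure F \<inter> S \<subseteq> {a, b}"
        by (rule cl[OF 2 _ arcs(2) int(3)]) (use split(2) int in \<open>auto simp: Un_commute\<close>)
      then show ?thesis by blast
    qed
  qed
qed

text \<open>
  If each arc were outside the closed curve formed by the other two, the three insides would be distinct
  components of the complement of the theta graph; Janiszewski's theorem, applied to two of the closed curves,
  which share an arc, makes two of them meet.
\<close>

lemma theta_not_all_outside:
  fixes S T R :: "complex set"
  assumes arcs: "arcset S a b" "arcset T a b" "arcset R a b"
    and int: "S \<inter> T = {a, b}" "S \<inter> R = {a, b}" "T \<inter> R = {a, b}"
    and out: "R \<inter> inside (S \<union> T) = {}" "T \<inter> inside (S \<union> R) = {}" "S \<inter> inside (T \<union> R) = {}"
  shows False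
proof -
  note J12 = jordan_arcs[OF arcs(1,2) int(1)] and J13 = jordan_arcs[OF arcs(1,3) int(2)]
    and J23 = jordan_arcs[OF arcs(2,3) int(3)]
  note P = arcset_props[OF arcs(1)] arcset_props[OF arcs(2)] arcset_props[OF arcs(3)]
  have nov: "inside (S \<union> T) \<inter> (S \<union> T) = {}" "inside (S \<union> R) \<inter> (S \<union> R) = {}" "inside (T \<union> R) \<inter> (T \<union> R) = {}"
    by (rule inside_no_overlap)+
  obtain x where x: "x \<in> inside (T \<union> R)" using J23(1) by blast
  have "bounded (inside (S \<union> T) \<union> inside (S \<union> R) \<union> inside (T \<union> R) \<union> S \<union> T \<union> R)"
    using J12(6) J13(6) J23(6) P(1,4,7) by (simp add: compact_imp_bounded)
  then have "inside (S \<union> T) \<union> inside (S \<union> R) \<union> inside (T \<union> R) \<union> S \<union> T \<union> R \<noteq> UNIV"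
    using not_bounded_UNIV by metis
  then obtain y where y: "y \<notin> inside (S \<union> T) \<union> inside (S \<union> R) \<union> inside (T \<union> R) \<union> S \<union> T \<union> R" by blast
  have yo: "y \<in> outside (S \<union> T)" "y \<in> outside (S \<union> R)" "y \<in> outside (T \<union> R)"
    using y J12(8) J13(8) J23(8) by blast+
  \<comment> \<open>Two closed curves, neither of which enters the inside of the other, have equal
    insides as soon as these share a point. Their frontiers then agree, so the curves coincide,
    although \<open>C\<close> leaves the first curve.\<close>
  have same: False if a1: "arcset A a b" "arcset B a b" "A \<inter> B = {a, b}" "arcset C a b" "arcset D a b" "C \<inter> D = {a, b}"
      and d: "C \<inter> inside (A \<union> B) = {}" "D \<inter> inside (A \<union> B) = {}" "A \<inter> inside (C \<union> D) = {}" "B \<inter> inside (C \<union> D) = {}"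
      and z: "z \<in> inside (A \<union> B)" "z \<in> inside (C \<union> D)" and ne: "C \<inter> (A \<union> B) = {a, b}"
    for A B C D z
  proof -
    note JA = jordan_arcs[OF a1(1-3)] and JC = jordan_arcs[OF a1(4-6)]
    have "inside (A \<union> B) \<inter> (C \<union> D) = {}" "inside (C \<union> D) \<inter> (A \<union> B) = {}" using d by blast+
    note c = connected_in_or_out[OF a1(4-6) JA(3) this(1)] connected_in_or_out[OF a1(1-3) JC(3) this(2)]
    have "z \<notin> outside (C \<union> D)" "z \<notin> outside (A \<union> B)" using z JA(7) JC(7) by blast+
    then have "inside (A \<union> B) \<subseteq> inside (C \<union> D)" using c(1) z by blast
    moreover have "inside (C \<union> D) \<subseteq> inside (A \<union> B)" using c(2) z \<open>z \<notin> outside (A \<union> B)\<close> by blast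
    ultimately have eq: "inside (A \<union> B) = inside (C \<union> D)" by (rule equalityI)
    have "C \<union> D = frontier (inside (A \<union> B))" by (simp only: eq JC(9))
    also have "\<dots> = A \<union> B" by (rule JA(9))
    finally have "C \<subseteq> {a, b}" using ne by blast
    then show False using arcset_props(3)[OF a1(4)] finite_subset by blast
  qed
  have no: "T \<inter> inside (T \<union> R) = {}" "T \<inter> inside (S \<union> T) = {}" "R \<inter> inside (T \<union> R) = {}" "R \<inter> inside (S \<union> R) = {}"
    "S \<inter> (T \<union> R) = {a, b}"
    by (use nov(3) in blast, use nov(1) in blast, use nov(3) in blast, use nov(2) in blast, use int(1,2) in blast)
  have xn: "x \<notin> S \<union> T \<union> R" using x out nov by blast
  consider "x \<in> inside (S \<union> T)" | "x \<in> inside (S \<union> R)" | "x \<in> outside (S \<union> T)" "x \<in> outside (S \<union> R)"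
    using xn J12(8) J13(8) by blast
  then show False
  proof cases
    case 1
    show False
      by (rule same[OF arcs(2,3) int(3) arcs(1,2) int(1) _ _ _ _ x 1]) (fact out no int)+
  next
    case 2
    show False
      by (rule same[OF arcs(2,3) int(3) arcs(1,3) int(2) _ _ _ _ x 2]) (fact out no int)+
  next
    case 3
    have cc: "connected_component (- (S \<union> T)) x y" "connected_component (- (S \<union> R)) x y"
      unfolding connected_component_def
      using 3 yo J12(5,8) J13(5,8) by blast+
    have "(S \<union> T) \<inter> (S \<union> R) = S" using int by blast
    then have con: "connected ((S \<union> T) \<inter> (S \<union> R))" using P(2) by simp
    have "compact (S \<union> T)" "closed (S \<union> R)" using P by (auto intro: compact_imp_closed)
    from Janiszewski[OF this con cc] have "connected_component (- ((S \<union> T) \<union> (S \<union> R))) x y" .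
    then obtain C where C: "connected C" "C \<subseteq> - ((S \<union> T) \<union> (S \<union> R))" "x \<in> C" "y \<in> C"
      unfolding connected_component_def by blast
    have "C \<inter> (T \<union> R) = {}" using C(2) by blast
    then show False using connected_in_or_out[OF arcs(2,3) int(3) C(1)] C(3,4) x yo J23(7) by blast
  qed
qed

text \<open>By the preceding lemma some arc enters the inside of the closed curve of the other two,
  and \<open>theta_inside\<close> applies up to renaming. Used contrapositively: a face cannot have
  on its boundary a vertex from the interior of each of the three arcs.\<close>

lemma theta_curve:
  fixes S T R F :: "complex set"
  assumes arcs: "arcset S a b" "arcset T a b" "arcset R a b"
    and int: "S \<inter> T = {a, b}" "S \<inter> R = {a, b}" "T \<inter> R = {a, b}"
    and F: "connected F" "F \<inter> (S \<union> T \<union> R) = {}"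
  shows "closure F \<inter> S \<subseteq> {a, b} \<or> closure F \<inter> T \<subseteq> {a, b} \<or> closure F \<inter> R \<subseteq> {a, b}"
proof -
  have int': "T \<inter> S = {a, b}" "R \<inter> S = {a, b}" "R \<inter> T = {a, b}" using int by blast+
  consider "R \<inter> inside (S \<union> T) \<noteq> {}" | "T \<inter> inside (S \<union> R) \<noteq> {}" | "S \<inter> inside (T \<union> R) \<noteq> {}"
    using theta_not_all_outside[OF arcs int] by blast
  then show ?thesis
  proof cases
    case 1 from theta_inside[OF arcs int 1 F] show ?thesis .
  next
    case 2
    have "F \<inter> (S \<union> R \<union> T) = {}" using F(2) by blast
    from theta_inside[OF arcs(1,3,2) int(2,1) int'(3) 2 F(1) this] show ?thesis by blast
  next
    case 3
    have "F \<inter> (T \<union> R \<union> S) = {}" using F(2) by blast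
    from theta_inside[OF arcs(2,3,1) int(3) int'(1,2) 3 F(1) this] show ?thesis by blast
  qed
qed

text \<open>In the theta graph with arcs \<open>ab\<close>, \<open>ac \<union> bc\<close> and
  \<open>ad \<union> bd\<close> the last two contain \<open>c\<close> and \<open>d\<close>, which
  belong to the closure of \<open>F\<close>, so the arc that \<open>F\<close> avoids is
  \<open>ab\<close>.\<close>

lemma K4_edge_avoided:
  fixes F :: "complex set"
  assumes arcs: "arcset ab a b" "arcset ac a c" "arcset ad a d" "arcset bc b c" "arcset bd b d"
    and dist: "distinct [a, b, c, d]"
    and int: "ab \<inter> ac \<subseteq> {a}" "ab \<inter> ad \<subseteq> {a}" "ab \<inter> bc \<subseteq> {b}" "ab \<inter> bd \<subseteq> {b}"
      "ac \<inter> ad \<subseteq> {a}" "ac \<inter> bc \<subseteq> {c}" "ac \<inter> bd \<subseteq> {}" "ad \<inter> bc \<subseteq> {}" "ad \<inter> bd \<subseteq> {d}" "bc \<inter> bd \<subseteq> {b}"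
    and F: "connected F" "F \<inter> (ab \<union> ac \<union> ad \<union> bc \<union> bd) = {}" "{c, d} \<subseteq> closure F"
  shows "closure F \<inter> ab \<subseteq> {a, b}"
proof -
  note E = arcset_ends[OF arcs(1)] arcset_ends[OF arcs(2)] arcset_ends[OF arcs(3)] arcset_ends[OF arcs(4)] arcset_ends[OF arcs(5)]
  have "arcset (ac \<union> bc) a b" by (rule arcset_join[OF arcs(2) arcset_sym[OF arcs(4)] int(6)])
  moreover have "arcset (ad \<union> bd) a b" by (rule arcset_join[OF arcs(3) arcset_sym[OF arcs(5)] int(9)])
  moreover have "ab \<inter> (ac \<union> bc) = {a, b}"
  proof
    show "ab \<inter> (ac \<union> bc) \<subseteq> {a, b}" using int(1,3) by blast
  qed (use E in simp)
  moreover have "ab \<inter> (ad \<union> bd) = {a, b}"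
  proof
    show "ab \<inter> (ad \<union> bd) \<subseteq> {a, b}" using int(2,4) by blast
  qed (use E in simp)
  moreover have "(ac \<union> bc) \<inter> (ad \<union> bd) = {a, b}"
  proof
    show "(ac \<union> bc) \<inter> (ad \<union> bd) \<subseteq> {a, b}" using int(5,7,8,10) by blast
  qed (use E in simp)
  moreover have "F \<inter> (ab \<union> (ac \<union> bc) \<union> (ad \<union> bd)) = {}" using F(2) by blast
  ultimately have "closure F \<inter> ab \<subseteq> {a, b} \<or> closure F \<inter> (ac \<union> bc) \<subseteq> {a, b} \<or> closure F \<inter> (ad \<union> bd) \<subseteq> {a, b}"
    by (intro theta_curve[OF arcs(1)] F(1))
  moreover have "c \<in> closure F \<inter> (ac \<union> bc)" "d \<in> closure F \<inter> (ad \<union> bd)" using F(3) E by auto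
  ultimately show ?thesis using dist by auto
qed

text \<open>
  Every edge of the complete graph lies in a theta graph whose two other arcs pass through the remaining vertices.
  So the region would touch the graph in four points only, and no nonempty open set other than a
  cofinite one has a finite frontier.
\<close>

lemma no_K4_in_outer_face:
  fixes F :: "complex set"
  assumes arcs: "arcset ab a b" "arcset ac a c" "arcset ad a d" "arcset bc b c" "arcset bd b d" "arcset cd c d"
    and dist: "distinct [a, b, c, d]"
    and int: "ab \<inter> ac \<subseteq> {a}" "ab \<inter> ad \<subseteq> {a}" "ab \<inter> bc \<subseteq> {b}" "ab \<inter> bd \<subseteq> {b}" "ab \<inter> cd \<subseteq> {}"
      "ac \<inter> ad \<subseteq> {a}" "ac \<inter> bc \<subseteq> {c}" "ac \<inter> bd \<subseteq> {}" "ac \<inter> cd \<subseteq> {c}"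
      "ad \<inter> bc \<subseteq> {}" "ad \<inter> bd \<subseteq> {d}" "ad \<inter> cd \<subseteq> {d}"
      "bc \<inter> bd \<subseteq> {b}" "bc \<inter> cd \<subseteq> {c}" "bd \<inter> cd \<subseteq> {d}"
    and F: "connected F" "F \<noteq> {}" "F \<inter> (ab \<union> ac \<union> ad \<union> bc \<union> bd \<union> cd) = {}" "{a, b, c, d} \<subseteq> closure F"
  shows False
proof -
  let ?K = "ab \<union> ac \<union> ad \<union> bc \<union> bd \<union> cd"
  have cK: "compact ?K" using arcs by (intro compact_Un) (auto dest: arcset_props(1))
  then have clK: "closed ?K" by (rule compact_imp_closed)
  obtain O' where O: "O' \<in> components (- ?K)" "F \<subseteq> O'"
  proof -
    have "F \<subseteq> - ?K" "- ?K \<noteq> {}" using F(2,3) by blast+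
    then show ?thesis using exists_component_superset[of F "- ?K"] F(1) that by blast
  qed
  have Oc: "connected O'" "O' \<inter> ?K = {}" "O' \<noteq> {}"
    using in_components_connected[OF O(1)] in_components_subset[OF O(1)] in_components_nonempty[OF O(1)] by auto
  have cl: "{a, b, c, d} \<subseteq> closure O'" using F(4) closure_mono[OF O(2)] by blast
  have O6: "O' \<inter> ab = {}" "O' \<inter> ac = {}" "O' \<inter> ad = {}" "O' \<inter> bc = {}" "O' \<inter> bd = {}" "O' \<inter> cd = {}"
    using Oc(2) by (simp_all add: Int_Un_distrib)
  have cl': "a \<in> closure O'" "b \<in> closure O'" "c \<in> closure O'" "d \<in> closure O'" using cl by auto
  have dist': "distinct [a, c, b, d]" "distinct [a, d, b, c]" "distinct [b, c, a, d]" "distinct [b, d, a, c]" "distinct [c, d, a, b]"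
    using dist by auto
  note sym = arcs[THEN arcset_sym]
  have i: "X \<inter> Y \<subseteq> Z \<Longrightarrow> Y \<inter> X \<subseteq> Z" for X Y Z :: "complex set" by blast
  note int' = int[THEN i]
  have 1: "closure O' \<inter> ab \<subseteq> {a, b}"
    by (rule K4_edge_avoided[OF arcs(1-5) dist]) (fact int int' Oc(1) dist' | simp add: Int_Un_distrib O6 cl')+
  have 2: "closure O' \<inter> ac \<subseteq> {a, c}"
    by (rule K4_edge_avoided[OF arcs(2,1,3) sym(4) arcs(6)]) (fact int int' Oc(1) dist' | simp add: Int_Un_distrib O6 cl')+
  have 3: "closure O' \<inter> ad \<subseteq> {a, d}"
    by (rule K4_edge_avoided[OF arcs(3,1,2) sym(5,6)]) (fact int int' Oc(1) dist' | simp add: Int_Un_distrib O6 cl')+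
  have 4: "closure O' \<inter> bc \<subseteq> {b, c}"
    by (rule K4_edge_avoided[OF arcs(4) sym(1) arcs(5) sym(2) arcs(6)]) (fact int int' Oc(1) dist' | simp add: Int_Un_distrib O6 cl')+
  have 5: "closure O' \<inter> bd \<subseteq> {b, d}"
    by (rule K4_edge_avoided[OF arcs(5) sym(1) arcs(4) sym(3,6)]) (fact int int' Oc(1) dist' | simp add: Int_Un_distrib O6 cl')+
  have 6: "closure O' \<inter> cd \<subseteq> {c, d}"
    by (rule K4_edge_avoided[OF arcs(6) sym(2,4,3,5)]) (fact int int' Oc(1) dist' | simp add: Int_Un_distrib O6 cl')+
  have "frontier O' \<subseteq> ?K" using frontier_of_components_closed_complement[OF clK O(1)] .
  moreover have "frontier O' \<subseteq> closure O'" by (simp add: frontier_def)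
  ultimately have "frontier O' \<subseteq> (closure O' \<inter> ab) \<union> (closure O' \<inter> ac) \<union> (closure O' \<inter> ad) \<union> (closure O' \<inter> bc)
      \<union> (closure O' \<inter> bd) \<union> (closure O' \<inter> cd)" by blast
  also have "\<dots> \<subseteq> {a, b} \<union> {a, c} \<union> {a, d} \<union> {b, c} \<union> {b, d} \<union> {c, d}"
    by (intro Un_mono 1 2 3 4 5 6)
  finally have fr: "frontier O' \<subseteq> {a, b, c, d}" by auto
  \<comment> \<open>The plane without four points is connected. It meets \<open>O'\<close> and,
    through the infinite set \<open>ab\<close>, also the complement of \<open>O'\<close>, so
    \<open>O'\<close> has a frontier point besides the four.\<close>
  have con: "connected (- {a, b, c, d})"
    using connected_open_delete_finite[of UNIV "{a, b, c, d}"] by (simp add: Compl_eq_Diff_UNIV connected_UNIV)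
  have "{a, b, c, d} \<subseteq> ?K" using arcs by (auto dest: arcset_ends)
  then have "O' \<inter> {a, b, c, d} = {}" using Oc(2) by blast
  then have "- {a, b, c, d} \<inter> O' \<noteq> {}" using Oc(3) by blast
  moreover have "- {a, b, c, d} - O' \<noteq> {}"
  proof -
    have "\<not> ab \<subseteq> {a, b, c, d}" using arcset_props(3)[OF arcs(1)] finite_subset by blast
    then show ?thesis using O6(1) by blast
  qed
  ultimately have "- {a, b, c, d} \<inter> frontier O' \<noteq> {}" by (rule connected_Int_frontier[OF con])
  then show False using fr by blast
qed

section \<open>From drawings to forbidden configurations\<close>

definition gpath :: "'a set set \<Rightarrow> 'a list \<Rightarrow> bool" where
  "gpath E xs \<longleftrightarrow> xs \<noteq> [] \<and> distinct xs \<and> successively (adj E) xs"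

fun pedges :: "'a list \<Rightarrow> 'a set set" where
  "pedges (x # y # xs) = insert {x, y} (pedges (y # xs))"
| "pedges _ = {}"

text \<open>Three such paths form a subdivision of the complete bipartite graph K_{2,3}.\<close>

definition no_theta :: "'a set set \<Rightarrow> bool" where
  "no_theta E \<longleftrightarrow> \<not> (\<exists>a b xs ys zs. xs \<noteq> [] \<and> ys \<noteq> [] \<and> zs \<noteq> [] \<and>
     gpath E (a # xs @ [b]) \<and> gpath E (a # ys @ [b]) \<and> gpath E (a # zs @ [b]) \<and>
     set xs \<inter> set ys = {} \<and> set xs \<inter> set zs = {} \<and> set ys \<inter> set zs = {})"

text \<open>A cycle through \<open>a\<close>, \<open>b\<close>, \<open>c\<close>, \<open>d\<close>
  in this order with chords \<open>ac\<close> and \<open>bd\<close>: a subdivision of K_4 in which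
  two disjoint edges are not subdivided. \<open>last (d # v)\<close> is the vertex that closes the
  cycle.\<close>

definition no_cross :: "'a set set \<Rightarrow> bool" where
  "no_cross E \<longleftrightarrow> \<not> (\<exists>a b c d s t u v. gpath E (a # s @ b # t @ c # u @ d # v) \<and>
     adj E (last (d # v)) a \<and> adj E a c \<and> adj E b d)"

lemma adj_commute: "adj E u v \<longleftrightarrow> adj E v u"
  by (simp add: adj_def insert_commute)

lemma gpath_mono: "gpath E xs \<Longrightarrow> E \<subseteq> E' \<Longrightarrow> gpath E' xs"
  unfolding gpath_def using successively_mono[of "adj E" xs "adj E'"] by (auto simp: adj_def)

lemma no_theta_mono: "no_theta E' \<Longrightarrow> E \<subseteq> E' \<Longrightarrow> no_theta E"
  unfolding no_theta_def by (blast intro: gpath_mono)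

lemma no_cross_mono: "no_cross E' \<Longrightarrow> E \<subseteq> E' \<Longrightarrow> no_cross E"
  unfolding no_cross_def adj_def by (blast intro: gpath_mono)

lemma pedges_subset: "e \<in> pedges xs \<Longrightarrow> e \<subseteq> set xs"
  by (induction xs rule: pedges.induct) auto

lemma pedges_E: "successively (adj E) xs \<Longrightarrow> pedges xs \<subseteq> E"
  by (induction xs rule: pedges.induct) (auto simp: adj_def)

text \<open>Two paths that share only their ends could have only the edge between these ends in
  common; this excludes it.\<close>

lemma ends_not_pedge:
  assumes "distinct (a # xs @ [b])" "xs \<noteq> []"
  shows "{a, b} \<notin> pedges (a # xs @ [b])"
proof -
  obtain x ys where xs: "xs = x # ys" using assms(2) by (cases xs) auto
  have "{a, b} \<notin> pedges (x # ys @ [b])"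
    using pedges_subset[of "{a, b}" "x # ys @ [b]"] assms(1) xs by auto
  then show ?thesis using assms(1) xs by (auto simp: doubleton_eq_iff)
qed

text \<open>This keeps what the curve arguments need: edges as point sets, and in place of a face a
  connected set \<open>F\<close> off the edges whose closure contains all vertices.\<close>

locale drawing =
  fixes V :: "'a set" and E :: "'a set set" and pos :: "'a \<Rightarrow> complex" and curve :: "'a set \<Rightarrow> complex set" and F
  assumes inj: "inj_on pos V" and EV: "e \<in> E \<Longrightarrow> e \<subseteq> V"
    and arcs: "e \<in> E \<Longrightarrow> \<exists>u v. e = {u, v} \<and> arcset (curve e) (pos u) (pos v)"
    and vert: "e \<in> E \<Longrightarrow> curve e \<inter> pos ` V = pos ` e"
    and cross: "e \<in> E \<Longrightarrow> e' \<in> E \<Longrightarrow> e \<noteq> e' \<Longrightarrow> curve e \<inter> curve e' \<subseteq> pos ` (e \<inter> e')"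
    and F: "connected F" "F \<noteq> {}" "e \<in> E \<Longrightarrow> F \<inter> curve e = {}" "pos ` V \<subseteq> closure F"
begin

definition img :: "'a list \<Rightarrow> complex set" where "img xs = \<Union>(curve ` pedges xs)"

lemma arc_edge: "adj E u v \<Longrightarrow> arcset (curve {u, v}) (pos u) (pos v)"
  using arcs[of "{u, v}"] unfolding adj_def by (metis arcset_sym doubleton_eq_iff)

lemma img_edge: "img [u, v] = curve {u, v}" by (simp add: img_def)

lemma path_arc:
  assumes "gpath E (x # y # xs)"
  shows "arcset (img (x # y # xs)) (pos x) (pos (last (y # xs)))"
  using assms
proof (induction xs arbitrary: x y)
  case Nil
  then show ?case using arc_edge[of x y] by (simp add: gpath_def img_edge)
next
  case (Cons z zs)
  let ?ys = "y # z # zs"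
  have g: "gpath E ?ys" "adj E x y" "x \<notin> set ?ys" using Cons.prems by (auto simp: gpath_def)
  have "curve {x, y} \<inter> img ?ys \<subseteq> {pos y}"
  proof -
    have "curve {x, y} \<inter> curve e \<subseteq> {pos y}" if e: "e \<in> pedges ?ys" for e
    proof -
      have "e \<subseteq> set ?ys" using pedges_subset[OF e] .
      then have "{x, y} \<inter> e \<subseteq> {y}" "{x, y} \<noteq> e" using g(3) by auto
      moreover have "e \<in> E" using pedges_E[of E ?ys] g(1) e unfolding gpath_def by blast
      ultimately show ?thesis using cross[of "{x, y}" e] g(2) unfolding adj_def by blast
    qed
    then show ?thesis unfolding img_def by blast
  qed
  from arcset_join[OF arc_edge[OF g(2)] Cons.IH[OF g(1)] this]
  have "arcset (curve {x, y} \<union> img ?ys) (pos x) (pos (last (z # zs)))" .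
  moreover have "img (x # ?ys) = curve {x, y} \<union> img ?ys" by (simp add: img_def)
  ultimately show ?case by simp
qed

lemma img_Int:
  assumes "gpath E xs" "gpath E ys" "pedges xs \<inter> pedges ys = {}"
  shows "img xs \<inter> img ys \<subseteq> pos ` (set xs \<inter> set ys)"
proof
  fix z assume "z \<in> img xs \<inter> img ys"
  then obtain e e' where e: "e \<in> pedges xs" "e' \<in> pedges ys" "z \<in> curve e" "z \<in> curve e'"
    unfolding img_def by blast
  have "e \<in> E" "e' \<in> E" using e assms pedges_E unfolding gpath_def by blast+
  moreover have "e \<noteq> e'" using e assms(3) by blast
  ultimately have "z \<in> pos ` (e \<inter> e')" using cross e by blast
  moreover have "e \<subseteq> set xs" "e' \<subseteq> set ys" using e pedges_subset by blast+
  ultimately show "z \<in> pos ` (set xs \<inter> set ys)" by blast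
qed

lemma edge_two: "e \<in> E \<Longrightarrow> \<not> e \<subseteq> {v}"
  using arcs[of e] arcset_ends by blast

lemma img_Int1:
  assumes "gpath E xs" "gpath E ys" "set xs \<inter> set ys \<subseteq> {v}"
  shows "img xs \<inter> img ys \<subseteq> pos ` (set xs \<inter> set ys)"
proof (rule img_Int[OF assms(1,2)])
  have False if "e \<in> pedges xs" "e \<in> pedges ys" for e
  proof -
    have "e \<subseteq> {v}" using that[THEN pedges_subset] assms(3) by blast
    moreover have "e \<in> E" using that assms pedges_E unfolding gpath_def by blast
    ultimately show False using edge_two by blast
  qed
  then show "pedges xs \<inter> pedges ys = {}" by blast
qed

lemma img_F: "gpath E xs \<Longrightarrow> F \<inter> img xs = {}"
  using F(3) pedges_E unfolding img_def gpath_def by blast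

lemma pos_img:
  assumes "gpath E (x # y # xs)" "v \<in> set (x # y # xs)"
  shows "pos v \<in> img (x # y # xs)" "v \<in> V"
proof -
  have "\<exists>e\<in>pedges (x # y # xs). v \<in> e" using assms(2)
  proof (induction xs arbitrary: x y)
    case (Cons z zs) then show ?case by (cases "v = x") auto
  qed auto
  then obtain e where e: "e \<in> pedges (x # y # xs)" "v \<in> e" by blast
  then have "e \<in> E" using assms(1) pedges_E unfolding gpath_def by blast
  then show "pos v \<in> img (x # y # xs)" "v \<in> V" using e vert[of e] EV unfolding img_def by blast+
qed

lemma no_theta: "no_theta E"
  unfolding no_theta_def
proof (rule notI, elim exE conjE)
  fix a b xs ys zs
  assume ne: "xs \<noteq> []" "ys \<noteq> []" "zs \<noteq> []"
    and g: "gpath E (a # xs @ [b])" "gpath E (a # ys @ [b])" "gpath E (a # zs @ [b])"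
    and d: "set xs \<inter> set ys = {}" "set xs \<inter> set zs = {}" "set ys \<inter> set zs = {}"
  have arc: "arcset (img (a # xs @ [b])) (pos a) (pos b)" if "gpath E (a # xs @ [b])" "xs \<noteq> []" for xs
    using path_arc[of a "hd xs" "tl xs @ [b]"] that by (cases xs) auto
  have pi: "pos v \<in> img (a # xs @ [b]) \<and> v \<in> V" if "gpath E (a # xs @ [b])" "xs \<noteq> []" "v \<in> set (a # xs @ [b])" for v xs
    using pos_img[of a "hd xs" "tl xs @ [b]" v] that by (cases xs) auto
  have int: "img (a # xs @ [b]) \<inter> img (a # ys @ [b]) = {pos a, pos b}"
    if g: "gpath E (a # xs @ [b])" "gpath E (a # ys @ [b])" and ne: "xs \<noteq> []" "ys \<noteq> []" and d: "set xs \<inter> set ys = {}" for xs ys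
  proof
    have s: "set (a # xs @ [b]) \<inter> set (a # ys @ [b]) = {a, b}" using d g unfolding gpath_def by auto
    have "pedges (a # xs @ [b]) \<inter> pedges (a # ys @ [b]) = {}"
    proof -
      have False if e: "e \<in> pedges (a # xs @ [b])" "e \<in> pedges (a # ys @ [b])" for e
      proof -
        have "e \<subseteq> {a, b}" using e[THEN pedges_subset] s by blast
        moreover have "e \<in> E" using e g pedges_E unfolding gpath_def by blast
        ultimately have "e = {a, b}" using edge_two[of e a] edge_two[of e b] by blast
        then show False using ends_not_pedge e g ne unfolding gpath_def by metis
      qed
      then show ?thesis by blast
    qed
    from img_Int[OF g this]
    show "img (a # xs @ [b]) \<inter> img (a # ys @ [b]) \<subseteq> {pos a, pos b}" unfolding s by simp
    show "{pos a, pos b} \<subseteq> img (a # xs @ [b]) \<inter> img (a # ys @ [b])"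
      using pi[OF g(1) ne(1)] pi[OF g(2) ne(2)] by simp
  qed
  have "F \<inter> (img (a # xs @ [b]) \<union> img (a # ys @ [b]) \<union> img (a # zs @ [b])) = {}"
    using img_F[OF g(1)] img_F[OF g(2)] img_F[OF g(3)] by (simp add: Int_Un_distrib)
  then have *: "closure F \<inter> img (a # xs @ [b]) \<subseteq> {pos a, pos b} \<or> closure F \<inter> img (a # ys @ [b]) \<subseteq> {pos a, pos b}
    \<or> closure F \<inter> img (a # zs @ [b]) \<subseteq> {pos a, pos b}"
    by (intro theta_curve arc g ne int d F(1))
  have "\<not> closure F \<inter> img (a # xs @ [b]) \<subseteq> {pos a, pos b}" if g: "gpath E (a # xs @ [b])" and ne: "xs \<noteq> []" for xs
  proof -
    have v: "hd xs \<in> set xs" using ne by simp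
    have m: "pos (hd xs) \<in> closure F \<inter> img (a # xs @ [b])" using pi[OF g ne, of "hd xs"] v F(4) by auto
    have "hd xs \<noteq> a" "hd xs \<noteq> b" using v g unfolding gpath_def by auto
    moreover have "a \<in> V" "b \<in> V" "hd xs \<in> V" using pi[OF g ne] v by auto
    ultimately have "pos (hd xs) \<notin> {pos a, pos b}" using inj by (auto dest: inj_onD)
    then show ?thesis using m by blast
  qed
  then show False using * g ne by blast
qed

lemma no_cross: "no_cross E"
  unfolding no_cross_def
proof (rule notI, elim exE conjE)
  fix a b c d s t u v
  assume g: "gpath E (a # s @ b # t @ c # u @ d # v)"
    and l: "adj E (last (d # v)) a" and ac: "adj E a c" and bd: "adj E b d"
  have dist: "distinct (a # s @ b # t @ c # u @ d # v)" and suc: "successively (adj E) (a # s @ b # t @ c # u @ d # v)"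
    using g by (auto simp: gpath_def)
  \<comment> \<open>The cycle is cut at \<open>a\<close>, \<open>b\<close>, \<open>c\<close>,
    \<open>d\<close> into four paths; with the two chords they are the six edges of a drawn
    K_4.\<close>
  let ?ab = "a # s @ [b]" and ?bc = "b # t @ [c]" and ?cd = "c # u @ [d]" and ?ad = "d # v @ [a]"
  have sp: "successively (adj E) ?ab" "successively (adj E) ?bc" "successively (adj E) ?cd" "successively (adj E) (d # v)"
  proof -
    have ap: "successively (adj E) xs" "successively (adj E) ys" if "successively (adj E) (xs @ ys)" for xs ys
      using that by (auto simp: successively_append_iff)
    have 2: "successively (adj E) (b # t @ c # u @ d # v)" using ap(2)[of "a # s" "b # t @ c # u @ d # v"] suc by simp
    have 3: "successively (adj E) (c # u @ d # v)" using ap(2)[of "b # t" "c # u @ d # v"] 2 by simp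
    show "successively (adj E) ?ab" using ap(1)[of ?ab "t @ c # u @ d # v"] suc by simp
    show "successively (adj E) ?bc" using ap(1)[of ?bc "u @ d # v"] 2 by simp
    show "successively (adj E) ?cd" using ap(1)[of ?cd v] 3 by simp
    show "successively (adj E) (d # v)" using ap(2)[of "c # u" "d # v"] 3 by simp
  qed
  have p: "gpath E ?ab" "gpath E ?bc" "gpath E ?cd"
    using sp dist by (auto simp: gpath_def)
  have "successively (adj E) ((d # v) @ [a])" using sp(4) l by (subst successively_append_iff) auto
  then have pd: "gpath E ?ad" using dist by (auto simp: gpath_def)
  have pc: "gpath E [a, c]" "gpath E [b, d]" using dist ac bd by (auto simp: gpath_def)
  have arc: "arcset (img (x # xs @ [y])) (pos x) (pos y)" if "gpath E (x # xs @ [y])" for x xs y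
    using path_arc[of x "hd (xs @ [y])" "tl (xs @ [y])"] that by (cases xs) auto
  have "arcset (img [a, c]) (pos a) (pos c)" "arcset (img [b, d]) (pos b) (pos d)"
    using arc[of a "[]" c] arc[of b "[]" d] pc by auto
  note A = arc[OF p(1)] this(1) arcset_sym[OF arc[OF pd]] arc[OF p(2)] this(2) arc[OF p(3)]
  have abcd: "a \<in> V" "b \<in> V" "c \<in> V" "d \<in> V"
    using pos_img(2)[OF pc(1)] pos_img(2)[OF pc(2)] by auto
  then have dp: "distinct [pos a, pos b, pos c, pos d]" using dist inj by (auto dest: inj_onD)
  have I: "img xs \<inter> img ys \<subseteq> {pos z}" if "gpath E xs" "gpath E ys" "set xs \<inter> set ys \<subseteq> {z}" for xs ys z
    using img_Int1[OF that] that(3) by blast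
  have I0: "img xs \<inter> img ys \<subseteq> {}" if "gpath E xs" "gpath E ys" "set xs \<inter> set ys = {}" for xs ys
    using img_Int1[OF that(1,2), of a] that(3) by auto
  have i1: "img (?ab) \<inter> img ([a, c]) \<subseteq> {pos a}" by (rule I[OF p(1) pc(1)]) (use dist in auto)
  have i2: "img (?ab) \<inter> img (?ad) \<subseteq> {pos a}" by (rule I[OF p(1) pd]) (use dist in auto)
  have i3: "img (?ab) \<inter> img (?bc) \<subseteq> {pos b}" by (rule I[OF p(1) p(2)]) (use dist in auto)
  have i4: "img (?ab) \<inter> img ([b, d]) \<subseteq> {pos b}" by (rule I[OF p(1) pc(2)]) (use dist in auto)
  have i5: "img (?ab) \<inter> img (?cd) \<subseteq> {}" by (rule I0[OF p(1) p(3)]) (use dist in auto)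
  have i6: "img ([a, c]) \<inter> img (?ad) \<subseteq> {pos a}" by (rule I[OF pc(1) pd]) (use dist in auto)
  have i7: "img ([a, c]) \<inter> img (?bc) \<subseteq> {pos c}" by (rule I[OF pc(1) p(2)]) (use dist in auto)
  have i8: "img ([a, c]) \<inter> img ([b, d]) \<subseteq> {}" by (rule I0[OF pc(1) pc(2)]) (use dist in auto)
  have i9: "img ([a, c]) \<inter> img (?cd) \<subseteq> {pos c}" by (rule I[OF pc(1) p(3)]) (use dist in auto)
  have i10: "img (?ad) \<inter> img (?bc) \<subseteq> {}" by (rule I0[OF pd p(2)]) (use dist in auto)
  have i11: "img (?ad) \<inter> img ([b, d]) \<subseteq> {pos d}" by (rule I[OF pd pc(2)]) (use dist in auto)
  have i12: "img (?ad) \<inter> img (?cd) \<subseteq> {pos d}" by (rule I[OF pd p(3)]) (use dist in auto)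
  have i13: "img (?bc) \<inter> img ([b, d]) \<subseteq> {pos b}" by (rule I[OF p(2) pc(2)]) (use dist in auto)
  have i14: "img (?bc) \<inter> img (?cd) \<subseteq> {pos c}" by (rule I[OF p(2) p(3)]) (use dist in auto)
  have i15: "img ([b, d]) \<inter> img (?cd) \<subseteq> {pos d}" by (rule I[OF pc(2) p(3)]) (use dist in auto)
  have FK: "F \<inter> (img ?ab \<union> img [a, c] \<union> img ?ad \<union> img ?bc \<union> img [b, d] \<union> img ?cd) = {}"
    using img_F[OF p(1)] img_F[OF p(2)] img_F[OF p(3)] img_F[OF pd] img_F[OF pc(1)] img_F[OF pc(2)]
    unfolding Int_Un_distrib by simp
  have cl: "{pos a, pos b, pos c, pos d} \<subseteq> closure F" using abcd F(4) by blast
  show False by (rule no_K4_in_outer_face[OF A dp i1 i2 i3 i4 i5 i6 i7 i8 i9 i10 i11 i12 i13 i14 i15 F(1,2) FK cl])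
qed

end

lemma drawing_of_planar:
  fixes V :: "'a set" and pos :: "'a \<Rightarrow> real \<times> real"
  assumes "simple_graph V E" and D: "inj_on pos V"
      "\<forall>e\<in>E. \<exists>u v. e = {u, v} \<and> arc (curve e) \<and> pathstart (curve e) = pos u \<and> pathfinish (curve e) = pos v"
      "\<forall>e\<in>E. path_image (curve e) \<inter> pos ` V = pos ` e"
      "\<forall>e\<in>E. \<forall>e'\<in>E. e \<noteq> e' \<longrightarrow> path_image (curve e) \<inter> path_image (curve e') \<subseteq> pos ` (e \<inter> e')"
      "F \<in> components (- (pos ` V \<union> (\<Union>e\<in>E. path_image (curve e))))" "pos ` V \<subseteq> frontier F"
  shows "no_theta E \<and> no_cross E"
proof -
  \<comment> \<open>The identification of the real plane with \<open>complex\<close>, where the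
    Jordan curve theorem is available.\<close>
  define \<phi> where "\<phi> = (\<lambda>z::real \<times> real. Complex (fst z) (snd z))"
  have \<phi>: "continuous_on A \<phi>" "inj_on \<phi> A" for A
    unfolding \<phi>_def Complex_eq by (auto intro!: continuous_intros inj_onI simp: complex_eq_iff prod_eq_iff)
  have Fp: "connected F" "F \<noteq> {}" "F \<subseteq> - (pos ` V \<union> (\<Union>e\<in>E. path_image (curve e)))"
    using D(5) in_components_connected in_components_nonempty in_components_subset by blast+
  have inj: "\<phi> x = \<phi> y \<longleftrightarrow> x = y" for x y using \<phi>(2)[of UNIV] by (auto dest: injD)
  interpret drawing V E "\<phi> \<circ> pos" "\<lambda>e. \<phi> ` path_image (curve e)" "\<phi> ` F"
  proof
    show "inj_on (\<phi> \<circ> pos) V" using D(1) by (auto intro!: inj_onI simp: inj dest: inj_onD)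
    show "e \<subseteq> V" if e: "e \<in> E" for e
    proof -
      obtain u v where "e = {u, v}" "u \<in> V" "v \<in> V"
        using bspec[OF conjunct2[OF assms(1)[unfolded simple_graph_def]] e] by auto
      then show ?thesis by simp
    qed
    show "\<exists>u v. e = {u, v} \<and> arcset (\<phi> ` path_image (curve e)) ((\<phi> \<circ> pos) u) ((\<phi> \<circ> pos) v)" if e: "e \<in> E" for e
    proof -
      obtain u v where uv: "e = {u, v}" "arc (curve e)" "pathstart (curve e) = pos u" "pathfinish (curve e) = pos v"
        using bspec[OF D(2) e] by auto
      have "arc (\<phi> \<circ> curve e)" using uv(2) unfolding arc_def path_def by (intro conjI continuous_on_compose comp_inj_on \<phi>) auto
      then show ?thesis unfolding arcset_def using uv
        by (intro exI[of _ u] exI[of _ v] conjI exI[of _ "\<phi> \<circ> curve e"])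
           (auto simp: path_image_compose pathstart_compose pathfinish_compose)
    qed
    show "\<phi> ` path_image (curve e) \<inter> (\<phi> \<circ> pos) ` V = (\<phi> \<circ> pos) ` e" if "e \<in> E" for e
    proof -
      have "\<phi> ` (path_image (curve e) \<inter> pos ` V) = \<phi> ` pos ` e" using D(3) that by simp
      then show ?thesis unfolding image_Int[OF \<phi>(2)] image_comp .
    qed
    show "\<phi> ` path_image (curve e) \<inter> \<phi> ` path_image (curve e') \<subseteq> (\<phi> \<circ> pos) ` (e \<inter> e')"
      if "e \<in> E" "e' \<in> E" "e \<noteq> e'" for e e'
    proof -
      have "\<phi> ` (path_image (curve e) \<inter> path_image (curve e')) \<subseteq> \<phi> ` pos ` (e \<inter> e')"
        using D(4) that by (intro image_mono) simp
      then show ?thesis unfolding image_Int[OF \<phi>(2)] image_comp .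
    qed
    show "connected (\<phi> ` F)" "\<phi> ` F \<noteq> {}" using Fp \<phi> by (auto intro: connected_continuous_image)
    show "\<phi> ` F \<inter> \<phi> ` path_image (curve e) = {}" if "e \<in> E" for e
    proof -
      have "path_image (curve e) \<subseteq> (\<Union>e\<in>E. path_image (curve e))" using that by (rule UN_upper)
      then have "F \<inter> path_image (curve e) = {}" using Fp(3) by blast
      then show ?thesis by (auto simp: inj)
    qed
    have "pos ` V \<subseteq> closure F" using D(6) by (auto simp: frontier_def)
    moreover have "\<phi> ` closure F \<subseteq> closure (\<phi> ` F)"
      by (rule image_closure_subset[OF \<phi>(1)]) (auto simp: closure_subset)
    ultimately show "(\<phi> \<circ> pos) ` V \<subseteq> closure (\<phi> ` F)" by (auto simp: image_comp[symmetric])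
  qed
  show ?thesis using no_theta no_cross by blast
qed


lemma outerplanar_no_theta_no_cross:
  assumes "simple_graph V E" "outerplanar V E"
  shows "no_theta E \<and> no_cross E"
  using assms(2) unfolding outerplanar_def
  by (elim exE conjE bexE) (rule drawing_of_planar[OF assms(1)])

section \<open>Non-crossing chords on an interval\<close>

text \<open>Offsets such as \<open>a + 4\<close> are compared after rewriting to \<open>Suc\<close>;
  the rule is withdrawn at the end of the section.\<close>

declare numeral_eq_Suc [simp]

text \<open>
  The vertices of the Hamiltonian cycle are numbered \<open>0..m\<close>. The number 0 is given to the cut vertex, so
  that \<open>nb i\<close> is the full neighbourhood only for \<open>i \<in> {1..m}\<close>.
\<close>

locale interval =
  fixes R :: "nat \<Rightarrow> nat \<Rightarrow> bool" and m :: nat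
  assumes sym: "R i j \<Longrightarrow> R j i" and irrefl: "\<not> R i i"
    and step: "i < m \<Longrightarrow> R i (Suc i)" and base: "R 0 m" and m2: "m \<ge> 2"
    and noncross: "i < j \<Longrightarrow> j < k \<Longrightarrow> k < l \<Longrightarrow> l \<le> m \<Longrightarrow> R i k \<Longrightarrow> R j l \<Longrightarrow> False"
begin

definition nb :: "nat \<Rightarrow> nat set" where "nb i = {j. j \<le> m \<and> R i j}"

text \<open>The edge that closes the cycle counts as a chord, so that \<open>chord 0 m\<close> is
  always present as an outermost one.\<close>

definition chord :: "nat \<Rightarrow> nat \<Rightarrow> bool" where "chord i j \<longleftrightarrow> i + 2 \<le> j \<and> j \<le> m \<and> R i j"

definition leaf :: "nat \<Rightarrow> nat \<Rightarrow> bool" where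
  "leaf i j \<longleftrightarrow> chord i j \<and> (\<forall>i' j'. chord i' j' \<and> i \<le> i' \<and> j' \<le> j \<longrightarrow> i' = i \<and> j' = j)"

text \<open>The vertices \<open>x\<close>, \<open>u\<close>, \<open>v\<close> must avoid the number
  0 because their full neighbourhoods are prescribed; \<open>y\<close> and \<open>z\<close> may be
  the cut vertex.\<close>

definition sunI :: "nat \<Rightarrow> nat \<Rightarrow> nat \<Rightarrow> nat \<Rightarrow> nat \<Rightarrow> bool" where
  "sunI x u v y z \<longleftrightarrow> distinct [x, u, v, y, z] \<and> nb x = {u, v, y, z} \<and> nb u = {x, y} \<and> nb v = {x, z} \<and>
     {x, u, v} \<subseteq> {1..m}"

definition conf_light :: bool where
  "conf_light \<longleftrightarrow> (\<exists>u v. u \<in> {1..m} \<and> v \<in> {1..m} \<and> v \<in> nb u \<and> card (nb u) = 2 \<and> card (nb v) \<le> 3)"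

definition conf_sun4 :: bool where
  "conf_sun4 \<longleftrightarrow> (\<exists>x u v y z. sunI x u v y z \<and> y \<in> {1..m} \<and> card (nb y) \<le> 4)"

definition conf_sun5 :: bool where
  "conf_sun5 \<longleftrightarrow> (\<exists>x u v y z t w. sunI x u v y z \<and> y \<in> {1..m} \<and> t \<in> {1..m} \<and>
     distinct [x, u, v, y, z, t, w] \<and> nb y = {z, x, u, t, w} \<and> nb t = {y, w})"

definition conf_sun6 :: bool where
  "conf_sun6 \<longleftrightarrow> (\<exists>x u v y z x' u' v' w. sunI x u v y z \<and> sunI x' u' v' y w \<and> y \<in> {1..m} \<and>
     distinct [x, u, v, y, z, x', u', v', w] \<and> nb y = {z, x, u, w, x', u'})"

lemma card_nb_le: "nb i \<subseteq> A \<Longrightarrow> finite A \<Longrightarrow> card A \<le> n \<Longrightarrow> card (nb i) \<le> n"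
  using card_mono le_trans by blast

lemma card_le3: "card {a, b, c :: nat} \<le> 3" and card_le4: "card {a, b, c, d :: nat} \<le> 4"
  by (simp_all add: card_insert_if)

text \<open>An edge from \<open>b\<close> to a vertex beyond \<open>i\<close> or \<open>j\<close>
  would cross the chord.\<close>

lemma nb_inside:
  assumes "chord i j" "i < b" "b < j" "c \<in> nb b"
  shows "i \<le> c" "c \<le> j" "c \<noteq> b"
proof -
  have c: "c \<le> m" "R b c" and ij: "j \<le> m" "R i j" using assms by (auto simp: nb_def chord_def)
  show "i \<le> c" using noncross[of c i b j] c ij assms sym by force
  show "c \<le> j" using noncross[of i b j c] c ij assms by force
  show "c \<noteq> b" using c irrefl by auto
qed

lemma nb_step: "i < m \<Longrightarrow> Suc i \<in> nb i" "i < m \<Longrightarrow> i \<in> nb (Suc i)"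
  using step sym by (auto simp: nb_def)

lemma chord_nb: "chord i j \<Longrightarrow> j \<in> nb i \<and> i \<in> nb j"
  using sym by (auto simp: nb_def chord_def)

lemma nb_cases:
  assumes "c \<in> nb b" "b \<le> m"
  shows "Suc c = b \<or> c = Suc b \<or> chord c b \<or> chord b c"
  using assms irrefl[of b] sym[of b c] by (cases "c = b") (auto simp: nb_def chord_def)

lemma nb_middle:
  assumes "chord i (i + 2)"
  shows "nb (i + 1) = {i, i + 2}"
proof -
  have "c \<in> {i, i + 2}" if "c \<in> nb (i + 1)" for c
    using nb_inside[OF assms, of "i + 1" c] that by auto
  moreover have "i + 2 \<le> m" using assms by (simp add: chord_def)
  ultimately show ?thesis using nb_step[of i] nb_step[of "i + 1"] by auto
qed

text \<open>Under a longer innermost chord the vertices \<open>i + 1\<close> and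
  \<open>i + 2\<close> both have degree 2 and are adjacent.\<close>

lemma leaf_length:
  assumes "leaf i j" "\<not> conf_light"
  shows "j = i + 2"
proof (rule ccontr)
  assume ne: "j \<noteq> i + 2"
  have ch: "chord i j" and l: "\<And>i' j'. chord i' j' \<Longrightarrow> i \<le> i' \<Longrightarrow> j' \<le> j \<Longrightarrow> i' = i \<and> j' = j"
    using assms by (auto simp: leaf_def)
  then have j: "i + 3 \<le> j" "j \<le> m" using ne by (auto simp: chord_def)
  have mid: "nb b = {b - 1, b + 1}" if "i < b" "b < j" for b
  proof -
    have "c \<in> {b - 1, b + 1}" if c: "c \<in> nb b" for c
    proof -
      note I = nb_inside[OF ch \<open>i < b\<close> \<open>b < j\<close> c]
      have "b \<le> m" using \<open>b < j\<close> j by simp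
      then show ?thesis using nb_cases[OF c] l[of c b] l[of b c] I \<open>i < b\<close> \<open>b < j\<close> by auto
    qed
    then show ?thesis using nb_step[of "b - 1"] nb_step[of b] that j by auto
  qed
  have "conf_light" unfolding conf_light_def
    using mid[of "i + 1"] mid[of "i + 2"] j by (intro exI[of _ "i + 1"] exI[of _ "i + 2"]) auto
  then show False using assms by simp
qed

text \<open>Both orientations are recorded, since the role of \<open>y\<close> is later given to
  whichever outer end lies strictly under a larger chord.\<close>

lemma sun_of_chords:
  assumes "chord a (a + 2)" "chord (a + 2) (a + 4)" "nb (a + 2) = {a, a + 1, a + 3, a + 4}"
  shows "sunI (a + 2) (a + 3) (a + 1) (a + 4) a" "sunI (a + 2) (a + 1) (a + 3) a (a + 4)"
proof -
  have "a + 2 + 2 = a + 4" "a + 2 + 1 = a + 3" by simp_all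
  then have n: "nb (a + 1) = {a, a + 2}" "nb (a + 3) = {a + 2, a + 4}"
    using nb_middle[OF assms(1)] nb_middle[of "a + 2"] assms(2) by metis+
  have m: "a + 4 \<le> m" using assms by (simp add: chord_def)
  show "sunI (a + 2) (a + 3) (a + 1) (a + 4) a" "sunI (a + 2) (a + 1) (a + 3) a (a + 4)"
    unfolding sunI_def n assms(3) using m by auto
qed

text \<open>Under such a chord every vertex has neighbours at distance at most 2 only. A short chord
  that is not continued by another one ends in a vertex of degree at most 3 next to one of degree 2,
  so short chords come in chains; and a sun with an end strictly under the chord has degree at most
  4 there. What remains is one sun filling the chord.\<close>

lemma minimal_inner_chord:
  assumes ch: "chord i j" and nl: "\<not> leaf i j"
    and sub: "\<And>i' j'. chord i' j' \<Longrightarrow> i \<le> i' \<Longrightarrow> j' \<le> j \<Longrightarrow> (i', j') \<noteq> (i, j) \<Longrightarrow> j' = i' + 2"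
    and nB: "\<not> conf_light" and nC: "\<not> conf_sun4"
  shows "j = i + 4 \<and> chord i (i + 2) \<and> chord (i + 2) (i + 4) \<and> nb (i + 2) = {i, i + 1, i + 3, i + 4}"
proof -
  have jm: "j \<le> m" using ch by (simp add: chord_def)
  have inner: "nb b \<subseteq> {b - 2, b - 1, b + 1, b + 2}" if b: "i < b" "b < j" for b
  proof
    fix c assume c: "c \<in> nb b"
    note I = nb_inside[OF ch b c]
    show "c \<in> {b - 2, b - 1, b + 1, b + 2}"
      using nb_cases[OF c] sub[of c b] sub[of b c] I b jm by auto
  qed
  obtain a0 b0 where a0: "chord a0 b0" "i \<le> a0" "b0 \<le> j" "(a0, b0) \<noteq> (i, j)"
    using ch nl by (auto simp: leaf_def)
  then have b0: "b0 = a0 + 2" using sub by blast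
  \<comment> \<open>Otherwise the only short chord is the one ending at \<open>j\<close>, and its
    left end has no chord to the left, hence degree at most 3.\<close>
  have "\<exists>a. chord a (a + 2) \<and> i \<le> a \<and> a + 2 < j"
  proof (rule ccontr)
    assume no: "\<not> ?thesis"
    have "\<not> a0 + 2 < j" using no a0 b0 by blast
    then have aj: "a0 + 2 = j" using a0 b0 by auto
    then have a: "i < a0" "a0 < j" using a0 b0 by auto
    have "nb a0 \<subseteq> {a0 - 1, a0 + 1, a0 + 2}"
    proof
      fix c assume c: "c \<in> nb a0"
      show "c \<in> {a0 - 1, a0 + 1, a0 + 2}"
      proof (rule ccontr)
        assume n: "c \<notin> {a0 - 1, a0 + 1, a0 + 2}"
        then have c2: "c = a0 - 2" using inner[OF a] c by auto
        then have "chord c a0" using nb_cases[OF c] n a jm by (auto simp: chord_def)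
        moreover have "i \<le> c" using nb_inside[OF ch a c] by simp
        moreover have "a0 = c + 2" using \<open>chord c a0\<close> c2 by (auto simp: chord_def)
        ultimately show False using no a by auto
      qed
    qed
    then have "card (nb a0) \<le> 3" by (rule card_nb_le[OF _ _ card_le3]) simp
    moreover have "nb (a0 + 1) = {a0, a0 + 2}" using nb_middle a0 b0 by simp
    ultimately have conf_light unfolding conf_light_def using a aj jm
      by (intro exI[of _ "a0 + 1"] exI[of _ a0]) auto
    then show False using nB by simp
  qed
  then obtain a where a: "chord a (a + 2)" "i \<le> a" "a + 2 < j" by blast
  let ?b = "a + 2"
  have "chord ?b (?b + 2) \<and> ?b + 2 \<le> j"
  proof (rule ccontr)
    assume n: "\<not> ?thesis"
    have "nb ?b \<subseteq> {a, a + 1, a + 3}"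
    proof
      fix c assume c: "c \<in> nb ?b"
      have "c \<le> j" using nb_inside(2)[OF ch _ a(3) c] a by simp
      moreover have "chord ?b (?b + 2)" if "c = a + 4" using c that by (auto simp: nb_def chord_def)
      moreover have "c \<in> {a, a + 1, a + 3, a + 4}" using inner[of ?b] a c by auto
      ultimately show "c \<in> {a, a + 1, a + 3}" using n by auto
    qed
    then have "card (nb ?b) \<le> 3" by (rule card_nb_le[OF _ _ card_le3]) simp
    then have conf_light unfolding conf_light_def using a jm nb_middle[OF a(1)]
      by (intro exI[of _ "a + 1"] exI[of _ ?b]) auto
    then show False using nB by simp
  qed
  then have b: "chord (a + 2) (a + 4)" "a + 4 \<le> j" by auto
  have nbx: "nb (a + 2) = {a, a + 1, a + 3, a + 4}"
  proof
    show "nb (a + 2) \<subseteq> {a, a + 1, a + 3, a + 4}" using inner[of "a + 2"] a by auto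
    show "{a, a + 1, a + 3, a + 4} \<subseteq> nb (a + 2)"
      using chord_nb[OF a(1)] chord_nb[OF b(1)] nb_step[of "a + 1"] nb_step[of "a + 2"] a jm by auto
  qed
  note sun = sun_of_chords[OF a(1) b(1) nbx]
  \<comment> \<open>If an end of the sun were strictly under the chord, it would have at most four
    neighbours. The same argument gives \<open>a = i\<close> below.\<close>
  have "a + 4 = j"
  proof (rule ccontr)
    assume "a + 4 \<noteq> j"
    then have "a + 4 < j" using b by simp
    then have "nb (a + 4) \<subseteq> {a + 4 - 2, a + 4 - 1, a + 4 + 1, a + 4 + 2}" using inner[of "a + 4"] a by linarith
    then have "card (nb (a + 4)) \<le> 4" by (rule card_nb_le[OF _ _ card_le4]) simp
    moreover have "a + 4 \<in> {1..m}" using b jm by simp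
    ultimately show False using nC sun(1) unfolding conf_sun4_def by blast
  qed
  moreover have "a = i"
  proof (rule ccontr)
    assume "a \<noteq> i"
    then have "i < a" using a by simp
    then have "nb a \<subseteq> {a - 2, a - 1, a + 1, a + 2}" using inner[of a] a by linarith
    then have "card (nb a) \<le> 4" by (rule card_nb_le[OF _ _ card_le4]) simp
    moreover have "a \<in> {1..m}" using \<open>i < a\<close> b jm by simp
    ultimately show False using nC sun(2) unfolding conf_sun4_def by blast
  qed
  ultimately show ?thesis using a(1) b nbx by auto
qed

theorem configuration: "conf_light \<or> conf_sun4 \<or> conf_sun5 \<or> conf_sun6"
proof (rule ccontr)
  assume "\<not> ?thesis"
  then have nB: "\<not> conf_light" and nC: "\<not> conf_sun4" and nD: "\<not> conf_sun5" and nE: "\<not> conf_sun6" by auto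
  have top: "chord 0 m" using base m2 by (simp add: chord_def)
  \<comment> \<open>\<open>T\<close> marks the chords with a second level of nesting: some chord
    strictly below is not innermost.\<close>
  define T where "T i j \<longleftrightarrow> chord i j \<and> (\<exists>i' j'. chord i' j' \<and> \<not> leaf i' j' \<and> i \<le> i' \<and> j' \<le> j \<and> (i', j') \<noteq> (i, j))" for i j
  have len: "leaf i j \<Longrightarrow> j = i + 2" for i j using leaf_length nB by blast
  have S: "j = i + 4 \<and> chord i (i + 2) \<and> chord (i + 2) (i + 4) \<and> nb (i + 2) = {i, i + 1, i + 3, i + 4}"
    if "chord i j" "\<not> leaf i j" "\<not> T i j" for i j
  proof (rule minimal_inner_chord[OF that(1,2) _ nB nC])
    fix i' j' assume "chord i' j'" "i \<le> i'" "j' \<le> j" "(i', j') \<noteq> (i, j)"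
    then show "j' = i' + 2" using that len unfolding T_def by blast
  qed
  show False
  proof (cases "\<exists>i j. T i j")
    \<comment> \<open>Without nesting, \<open>chord 0 m\<close> is either innermost, so the cycle is
      a triangle, or it spans a single sun. In that sun the end \<open>m = 4\<close> is taken as
      \<open>y\<close>, as the other end is the cut vertex.\<close>
    case False
    show False
    proof (cases "leaf 0 m")
      case True
      then have "m = 2" using len by fastforce
      then have "chord 0 2" using top by simp
      then have "nb 1 = {0, 2}" using nb_middle[of 0] by simp
      moreover have "nb 2 \<subseteq> {0, 1}" using irrefl[of 2] \<open>m = 2\<close> unfolding nb_def by (auto simp: le_Suc_eq)
      then have "card (nb 2) \<le> 3" by (rule card_nb_le) auto
      moreover have "1 \<in> {1..m}" "2 \<in> {1..m}" using m2 by simp_all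
      moreover have "card {0, 2 :: nat} = 2" by simp
      ultimately show False using nB unfolding conf_light_def by (metis insertI1 insertI2)
    next
      case nl: False
      note s = S[OF top nl]
      have s: "m = 4" "chord 0 2" "chord 2 4" "nb 2 = {0, 1, 3, 4}" using s False unfolding add_0 by metis+
      have "nb 4 \<subseteq> {0, 1, 2, 3}" using irrefl[of 4] s(1) unfolding nb_def by (auto simp: le_Suc_eq)
      then have "card (nb 4) \<le> 4" by (rule card_nb_le[OF _ _ card_le4]) simp
      moreover have "sunI 2 3 1 4 0" using sun_of_chords(1)[of 0] s(2-4) unfolding add_0 by metis
      moreover have "4 \<in> {1..m}" using s by simp
      ultimately show False using nC unfolding conf_sun4_def by blast
    qed
  next
    case True
    \<comment> \<open>A \<open>T\<close> chord of least length is chosen, so that no chord strictly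
      below it satisfies \<open>T\<close>.\<close>
    define P where "P n \<longleftrightarrow> (\<exists>i j. T i j \<and> j - i = n)" for n
    have "\<exists>n. P n" using True by (auto simp: P_def)
    then have least: "P (LEAST n. P n)" "\<And>n. P n \<Longrightarrow> (LEAST n. P n) \<le> n"
      using LeastI_ex Least_le by blast+
    then obtain i j where ij: "T i j" "j - i = (LEAST n. P n)" unfolding P_def by blast
    have ch: "chord i j" and jm: "j \<le> m" using ij by (auto simp: T_def chord_def)
    have min: "\<not> T i' j'" if "chord i' j'" "i \<le> i'" "j' \<le> j" "(i', j') \<noteq> (i, j)" for i' j'
    proof
      assume "T i' j'"
      then have "j - i \<le> j' - i'" using least(2) ij(2) unfolding P_def by metis
      then show False using that ch by (auto simp: chord_def)
    qed
    \<comment> \<open>By minimality every chord strictly below spans 2 vertices or is filled by a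
      sun. This is why only the distances 1, 2 and 4 occur in \<open>inner\<close>.\<close>
    have sub: "j' = i' + 2 \<or> (j' = i' + 4 \<and> chord i' (i' + 2) \<and> chord (i' + 2) (i' + 4) \<and> nb (i' + 2) = {i', i' + 1, i' + 3, i' + 4})"
      if "chord i' j'" "i \<le> i'" "j' \<le> j" "(i', j') \<noteq> (i, j)" for i' j'
      using S[OF that(1) _ min[OF that]] len by blast
    have inner: "nb b \<subseteq> {b - 4, b - 2, b - 1, b + 1, b + 2, b + 4}" if b: "i < b" "b < j" for b
    proof
      fix c assume c: "c \<in> nb b"
      note I = nb_inside[OF ch b c]
      show "c \<in> {b - 4, b - 2, b - 1, b + 1, b + 2, b + 4}"
        using nb_cases[OF c] sub[of c b] sub[of b c] I b jm by auto
    qed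
    obtain a b where a: "chord a b" "\<not> leaf a b" "i \<le> a" "b \<le> j" "(a, b) \<noteq> (i, j)"
      using ij(1) unfolding T_def by blast
    have s: "b = a + 4" "chord a (a + 2)" "chord (a + 2) (a + 4)" "nb (a + 2) = {a, a + 1, a + 3, a + 4}"
      using S[OF a(1,2) min[OF a(1,3-5)]] by auto
    note sun = sun_of_chords[OF s(2-4)]
    have mid: "nb (a + 1) = {a, a + 2}" "nb (a + 3) = {a + 2, a + 4}" using sun by (auto simp: sunI_def)
    have ce: "a + 4 \<in> nb a" "a \<in> nb (a + 4)" using chord_nb[OF a(1)] s(1) by auto
    show False
    \<comment> \<open>One of the ends of the sun from \<open>a\<close> to \<open>a + 4\<close> is
      strictly under the chord and becomes \<open>y\<close>. On its other side there is a neighbour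
      at distance 1 and perhaps at distance 2 or 4: distance 4 means a second sun, distance 2 alone
      a triangle, and neither means degree at most 4.\<close>
    proof (cases "b < j")
      case True
      let ?y = "a + 4"
      have y: "i < ?y" "?y < j" "?y \<le> m" "1 \<le> ?y" using True s a jm by auto
      have left: "{a, a + 2, a + 3} \<subseteq> nb ?y"
        using ce chord_nb[OF s(3)] nb_step[of "a + 3"] y by auto
      have right: "a + 5 \<in> nb ?y" using nb_step(1)[of ?y] y jm by auto
      have up: "nb ?y \<subseteq> {a, a + 2, a + 3, a + 5, a + 6, a + 8}" using inner[OF y(1,2)] by auto
      consider "a + 8 \<in> nb ?y" | "a + 8 \<notin> nb ?y" "a + 6 \<in> nb ?y" | "a + 8 \<notin> nb ?y" "a + 6 \<notin> nb ?y" by blast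
      then show False
      proof cases
        case 1
        have c8: "chord ?y (?y + 4)" using 1 by (auto simp: chord_def nb_def)
        have "?y + 4 \<le> j" using nb_inside(2)[OF ch y(1,2)] 1 by auto
        then have s': "chord ?y (?y + 2)" "chord (?y + 2) (?y + 4)" "nb (?y + 2) = {?y, ?y + 1, ?y + 3, ?y + 4}"
          using sub[OF c8] y by auto
        note sun' = sun_of_chords(2)[OF this]
        have "a + 6 \<in> nb ?y" using chord_nb[OF s'(1)] by auto
        then have "nb ?y = {a, a + 2, a + 3, a + 8, a + 6, a + 5}" using left right up 1 by auto
        moreover have "distinct [a + 2, a + 3, a + 1, ?y, a, a + 6, a + 5, a + 7, a + 8]" by simp
        moreover have "?y \<in> {1..m}" using y by simp
        moreover have "sunI (a + 6) (a + 5) (a + 7) ?y (a + 8)" using sun' by simp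
        ultimately show False using nE sun(1) unfolding conf_sun6_def by blast
      next
        case 2
        have c6: "chord ?y (?y + 2)" using 2 by (auto simp: chord_def nb_def)
        have "nb (a + 5) = {?y, a + 6}" using nb_middle[OF c6] by auto
        moreover have "nb ?y = {a, a + 2, a + 3, a + 5, a + 6}" using left right up 2 by auto
        moreover have "distinct [a + 2, a + 3, a + 1, ?y, a, a + 5, a + 6]" by simp
        moreover have "?y \<in> {1..m}" "a + 5 \<in> {1..m}" using y jm by simp_all
        ultimately show False using nD sun(1) unfolding conf_sun5_def by blast
      next
        case 3
        then have "nb ?y \<subseteq> {a, a + 2, a + 3, a + 5}" using up by auto
        then have "card (nb ?y) \<le> 4" by (rule card_nb_le[OF _ _ card_le4]) simp
        moreover have "?y \<in> {1..m}" using y by simp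
        ultimately show False using nC sun(1) unfolding conf_sun4_def by blast
      qed
    next
      case False
      then have aj: "a + 4 = j" "i < a" using a s by auto
      have y: "i < a" "a < j" "a \<le> m" "1 \<le> a" using aj jm by auto
      have right: "{a + 1, a + 2, a + 4} \<subseteq> nb a"
        using ce chord_nb[OF s(2)] nb_step[of a] y jm aj by auto
      have left: "a - 1 \<in> nb a" using nb_step(2)[of "a - 1"] y jm by auto
      have up: "nb a \<subseteq> {a - 4, a - 2, a - 1, a + 1, a + 2, a + 4}" using inner[OF y(1,2)] .
      have ge: "i \<le> c" if "c \<in> nb a" for c using nb_inside(1)[OF ch y(1,2) that] .
      \<comment> \<open>The guards \<open>4 \<le> a\<close> and \<open>2 \<le> a\<close> matter:
        truncated subtraction would otherwise turn \<open>a - 4\<close> or \<open>a - 2\<close> into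
        the vertex 0.\<close>
      consider "4 \<le> a" "a - 4 \<in> nb a" | "\<not> (4 \<le> a \<and> a - 4 \<in> nb a)" "2 \<le> a" "a - 2 \<in> nb a"
        | "\<not> (4 \<le> a \<and> a - 4 \<in> nb a)" "\<not> (2 \<le> a \<and> a - 2 \<in> nb a)" by blast
      then show False
      proof cases
        case 1
        define w where "w = a - 4"
        have aw: "a = w + 4" using 1 by (simp add: w_def)
        have c8: "chord w (w + 4)" using nb_cases[OF 1(2) y(3)] 1 aw by (auto simp: chord_def)
        have "i \<le> w" using ge 1 by (simp add: w_def)
        then have s': "chord w (w + 2)" "chord (w + 2) (w + 4)" "nb (w + 2) = {w, w + 1, w + 3, w + 4}"
          using sub[OF c8] y aj aw by auto
        note sun' = sun_of_chords(1)[OF this]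
        have "w + 2 \<in> nb a" using chord_nb[OF s'(2)] aw by auto
        then have "nb a = {a + 4, a + 2, a + 1, w, w + 2, w + 3}" using left right up 1 aw by auto
        moreover have "distinct [a + 2, a + 1, a + 3, a, a + 4, w + 2, w + 3, w + 1, w]" using aw by simp
        moreover have "a \<in> {1..m}" using y by simp
        moreover have "sunI (w + 2) (w + 3) (w + 1) a w" using sun' unfolding aw .
        ultimately show False using nE sun(2) unfolding conf_sun6_def by blast
      next
        case 2
        define w where "w = a - 2"
        have aw: "a = w + 2" using 2 by (simp add: w_def)
        have c6: "chord w (w + 2)" using nb_cases[OF 2(3) y(3)] aw by (auto simp: chord_def)
        have n4: "c \<in> nb a \<Longrightarrow> c + 4 \<noteq> a" for c using 2(1) by auto
        have "c \<in> {a + 4, a + 2, a + 1, w + 1, w}" if "c \<in> nb a" for c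
        proof -
          have "chord c a \<longrightarrow> a = c + 2 \<or> a = c + 4" using sub[of c a] ge[OF that] y by auto
          then show ?thesis using nb_cases[OF that y(3)] n4[OF that] up that aw by (auto simp: chord_def)
        qed
        then have "nb a = {a + 4, a + 2, a + 1, w + 1, w}" using left right 2 aw by auto
        moreover have "nb (w + 1) = {a, w}" using nb_middle[OF c6] aw by auto
        moreover have "distinct [a + 2, a + 1, a + 3, a, a + 4, w + 1, w]" using aw by simp
        moreover have "a \<in> {1..m}" "w + 1 \<in> {1..m}" using y aw by simp_all
        ultimately show False using nD sun(2) unfolding conf_sun5_def by blast
      next
        case 3
        have "nb a \<subseteq> {a - 1, a + 1, a + 2, a + 4}"
        proof
          fix c assume c: "c \<in> nb a"
          have "c \<noteq> a" using nb_inside(3)[OF ch y(1,2) c] .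
          moreover have "c + 4 \<noteq> a" "c + 2 \<noteq> a" using 3 c by auto
          moreover have "chord c a \<longrightarrow> a = c + 2 \<or> a = c + 4" using sub[of c a] ge[OF c] y by auto
          ultimately show "c \<in> {a - 1, a + 1, a + 2, a + 4}" using nb_cases[OF c y(3)] up c y by (auto simp: chord_def)
        qed
        then have "card (nb a) \<le> 4" by (rule card_nb_le[OF _ _ card_le4]) simp
        moreover have "a \<in> {1..m}" using y by simp
        ultimately show False using nC sun(2) unfolding conf_sun4_def by blast
      qed
    qed
  qed
qed

end

declare numeral_eq_Suc [simp del]

section \<open>Reducible configurations\<close>

lemma gpath_append:
  "gpath E (xs @ ys) \<Longrightarrow> xs \<noteq> [] \<Longrightarrow> gpath E xs" "gpath E (xs @ ys) \<Longrightarrow> ys \<noteq> [] \<Longrightarrow> gpath E ys"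
  by (auto simp: gpath_def successively_append_iff)

lemma gpath_join:
  assumes "gpath E xs" "gpath E ys" "set xs \<inter> set ys = {}" "adj E (last xs) (hd ys)"
  shows "gpath E (xs @ ys)"
  using assms by (auto simp: gpath_def successively_append_iff)

lemma gpath_rev: "gpath E (rev xs) \<longleftrightarrow> gpath E xs"
proof -
  have "(\<lambda>x y. adj E y x) = adj E" by (auto simp: adj_commute intro!: ext)
  then have "successively (\<lambda>x y. adj E y x) xs = successively (adj E) xs"
    by (rule arg_cong[where f = "\<lambda>P. successively P xs"])
  then show ?thesis by (simp add: gpath_def)
qed

lemma gpath_single: "gpath E [x]" by (simp add: gpath_def)

definition adj_in :: "'a set set \<Rightarrow> 'a set \<Rightarrow> 'a \<Rightarrow> 'a \<Rightarrow> bool" where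
  "adj_in E S x y \<longleftrightarrow> adj E x y \<and> x \<in> S \<and> y \<in> S"

lemma adj_in_path:
  assumes "(adj_in E S)\<^sup>*\<^sup>* a b" "b \<in> S"
  shows "\<exists>xs. gpath E xs \<and> hd xs = a \<and> last xs = b \<and> set xs \<subseteq> S"
  using assms
proof (induction rule: converse_rtranclp_induct)
  case base
  then show ?case by (intro exI[of _ "[b]"]) (auto simp: gpath_def)
next
  case (step a a')
  then obtain xs where xs: "gpath E xs" "hd xs = a'" "last xs = b" "set xs \<subseteq> S" by blast
  show ?case
  proof (cases "a \<in> set xs")
    case True
    then obtain ys zs where "xs = ys @ a # zs" by (auto dest: split_list)
    then show ?thesis using xs gpath_append(2)[of E ys "a # zs"] by (intro exI[of _ "a # zs"]) auto
  next
    case False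
    have "gpath E ([a] @ xs)" using xs step False by (intro gpath_join) (auto simp: gpath_def adj_in_def)
    then show ?thesis using xs step by (intro exI[of _ "a # xs"]) (auto simp: gpath_def adj_in_def)
  qed
qed

lemma adj_in_sym: "(adj_in E S)\<^sup>*\<^sup>* a b \<Longrightarrow> (adj_in E S)\<^sup>*\<^sup>* b a"
proof (induction rule: rtranclp_induct)
  case (step y z)
  then have "adj_in E S z y" by (auto simp: adj_in_def adj_commute)
  then show ?case using step by (meson converse_rtranclp_into_rtranclp)
qed simp

lemma adj_in_subset: "(adj_in E S)\<^sup>*\<^sup>* a b \<Longrightarrow> a \<in> S \<Longrightarrow> b \<in> S"
  by (induction rule: rtranclp_induct) (auto simp: adj_in_def)

section \<open>Cycles and Hamiltonian end blocks\<close>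

definition cyc :: "'a set set \<Rightarrow> 'a list \<Rightarrow> bool" where
  "cyc E xs \<longleftrightarrow> gpath E xs \<and> 3 \<le> length xs \<and> adj E (last xs) (hd xs)"

lemma cyc_rotate:
  assumes "cyc E (us @ z # vs)"
  shows "cyc E (z # vs @ us)"
proof (cases "us = []")
  case False
  have g: "gpath E (us @ z # vs)" "adj E (last (z # vs)) (hd us)" using assms False by (auto simp: cyc_def)
  have "gpath E ((z # vs) @ us)"
    by (rule gpath_join) (use gpath_append[OF g(1)] g False in \<open>auto simp: gpath_def\<close>)
  moreover have "adj E (last us) z" using g(1) False by (auto simp: gpath_def successively_append_iff)
  ultimately show ?thesis using assms False by (auto simp: cyc_def)
qed (use assms in simp)

lemma cyc_rotate_to:
  assumes "cyc E xs" "z \<in> set xs"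
  obtains ys where "cyc E (z # ys)" "set (z # ys) = set xs" "length (z # ys) = length xs"
proof -
  obtain us vs where "xs = us @ z # vs" using assms(2) by (auto dest: split_list)
  then show ?thesis using cyc_rotate[of E us z vs] assms(1) that[of "vs @ us"] by auto
qed

text \<open>
  Choosing \<open>K\<close> of minimal size among all vertex sets that are separated from the rest by one vertex makes
  \<open>insert c K\<close> 2-connected without any theory of blocks.
\<close>

lemma end_block:
  fixes E :: "'a set set"
  assumes fin: "finite (\<Union>E)" and ne: "E \<noteq> {}" and two: "\<And>e. e \<in> E \<Longrightarrow> \<exists>u v. e = {u, v} \<and> u \<noteq> v"
  obtains c K where "K \<noteq> {}" "K \<subseteq> \<Union>E" "c \<in> \<Union>E" "c \<notin> K" "\<And>a b. a \<in> K \<Longrightarrow> adj E a b \<Longrightarrow> b \<in> insert c K"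
    "\<And>a b d. a \<in> insert c K \<Longrightarrow> b \<in> insert c K - {a} \<Longrightarrow> d \<in> insert c K - {a} \<Longrightarrow>
       \<exists>xs. gpath E xs \<and> hd xs = b \<and> last xs = d \<and> set xs \<subseteq> insert c K - {a}"
proof -
  \<comment> \<open>\<open>c\<close> separates \<open>K\<close> from the rest. All vertices but one
    form such a set, so a smallest one exists.\<close>
  define P where "P c K \<longleftrightarrow> K \<noteq> {} \<and> K \<subseteq> \<Union>E \<and> c \<in> \<Union>E \<and> c \<notin> K \<and> (\<forall>a\<in>K. \<forall>b. adj E a b \<longrightarrow> b \<in> insert c K)" for c K
  have adjE: "adj E a b \<Longrightarrow> a \<in> \<Union>E \<and> b \<in> \<Union>E" for a b by (auto simp: adj_def)
  obtain e where "e \<in> E" using ne by blast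
  then obtain u v where "{u, v} \<in> E" "u \<noteq> v" using two by metis
  then have "P u (\<Union>E - {u})" unfolding P_def using adjE by auto
  then have "\<exists>n c K. P c K \<and> card K = n" by blast
  then obtain n where n: "\<exists>c K. P c K \<and> card K = n" "\<And>m. m < n \<Longrightarrow> \<not> (\<exists>c K. P c K \<and> card K = m)"
    using exists_least_iff[of "\<lambda>n. \<exists>c K. P c K \<and> card K = n"] by blast
  then obtain c K where cK: "P c K" "card K = n" by blast
  have min: "card K \<le> card K'" if "P c' K'" for c' K' 
  proof (rule ccontr)
    assume "\<not> ?thesis"
    then have "card K' < n" using cK(2) by simp
    from n(2)[OF this] that show False by blast
  qed
  have finK: "finite K" using cK fin by (auto simp: P_def intro: finite_subset)
  let ?B = "insert c K"
  \<comment> \<open>Deleting \<open>a\<close> from \<open>insert c K\<close>, a component that does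
    not contain \<open>c\<close> is again separated from the rest, now by \<open>a\<close>, and so
    competes with \<open>K\<close> for minimality.\<close>
  have closed: "P a {x. (adj_in E (?B - {a}))\<^sup>*\<^sup>* b x}"
    if a: "a \<in> ?B" and b: "b \<in> ?B - {a}" and c: "a = c \<or> \<not> (adj_in E (?B - {a}))\<^sup>*\<^sup>* b c" for a b
  proof -
    let ?Q = "{x. (adj_in E (?B - {a}))\<^sup>*\<^sup>* b x}"
    have sub: "?Q \<subseteq> ?B - {a}" using adj_in_subset b by fastforce
    then have subK: "?Q \<subseteq> K" using c by auto
    have "y \<in> insert a ?Q" if "x \<in> ?Q" "adj E x y" for x y
    proof (cases "y = a")
      case False
      have "y \<in> ?B" using that subK cK by (auto simp: P_def)
      then have "adj_in E (?B - {a}) x y" using that sub False by (auto simp: adj_in_def)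
      then show ?thesis using that(1) by (simp add: rtranclp.rtrancl_into_rtrancl)
    qed simp
    moreover have "a \<in> \<Union>E" using a cK by (auto simp: P_def)
    moreover have "?Q \<subseteq> \<Union>E" using subK cK by (auto simp: P_def)
    moreover have "b \<in> ?Q" by simp
    moreover have "a \<notin> ?Q" using sub by blast
    ultimately show ?thesis unfolding P_def by blast
  qed
  have conn: "(adj_in E (?B - {a}))\<^sup>*\<^sup>* b d" if a: "a \<in> ?B" and b: "b \<in> ?B - {a}" and d: "d \<in> ?B - {a}" for a b d
  proof (cases "a = c")
    case True
    let ?Q = "{x. (adj_in E (?B - {a}))\<^sup>*\<^sup>* b x}"
    have "?Q \<subseteq> ?B - {a}" using adj_in_subset[of E "?B - {a}" b] b by blast
    then have "?Q \<subseteq> K" using True by blast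
    moreover have "card K \<le> card ?Q" using min closed[OF a b] True by blast
    ultimately have "?Q = K" using finK by (intro card_seteq) auto
    then show ?thesis using d True by auto
  next
    case False
    \<comment> \<open>A component missing \<open>c\<close> would lie in \<open>K - {a}\<close> and
      be smaller than \<open>K\<close>.\<close>
    have reach: "(adj_in E (?B - {a}))\<^sup>*\<^sup>* x c" if x: "x \<in> ?B - {a}" for x
    proof (rule ccontr)
      assume no: "\<not> ?thesis"
      let ?Q = "{y. (adj_in E (?B - {a}))\<^sup>*\<^sup>* x y}"
      have "card K \<le> card ?Q" using min closed[OF a x] no by blast
      moreover have "?Q \<subseteq> ?B - {a}" using adj_in_subset[of E "?B - {a}" x] x by blast
      then have "?Q \<subseteq> K - {a}" using no by blast
      then have "card ?Q \<le> card (K - {a})" using finK by (intro card_mono) auto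
      moreover have "a \<in> K" using a False by simp
      ultimately show False using card_Diff1_less[OF finK, of a] by linarith
    qed
    show ?thesis using reach[OF b] adj_in_sym[OF reach[OF d]] by (rule rtranclp_trans)
  qed
  show ?thesis
  proof (rule that[of K c])
    show "\<exists>xs. gpath E xs \<and> hd xs = b \<and> last xs = d \<and> set xs \<subseteq> ?B - {a}"
      if "a \<in> ?B" "b \<in> ?B - {a}" "d \<in> ?B - {a}" for a b d
      using adj_in_path[OF conn[OF that]] that by blast
  qed (use cK in \<open>auto simp: P_def\<close>)
qed

text \<open>If \<open>a\<close> and \<open>b\<close> are consecutive on the cycle, the ear replaces
  the edge between them; the case of an empty \<open>t\<close> traverses \<open>s\<close> backwards.
  Otherwise the ear and the two halves of the cycle form a theta.\<close>

lemma ear_extends: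
  assumes cy: "cyc E (a # s @ b # t)" and q: "gpath E (qs @ [b])" "qs \<noteq> []" "adj E a (hd qs)"
    and dis: "set qs \<inter> set (a # s @ b # t) = {}" and nth: "no_theta E"
  shows "\<exists>zs. cyc E zs \<and> length (a # s @ b # t) < length zs \<and> set zs \<subseteq> set (a # s @ b # t) \<union> set qs"
proof -
  have g: "gpath E (a # s @ b # t)" using cy by (simp add: cyc_def)
  have gbt: "gpath E (b # t)" using gpath_append(2)[of E "a # s" "b # t"] g by simp
  have gasb: "gpath E (a # s @ [b])" using gpath_append(1)[of E "a # s @ [b]" t] g by simp
  have gq: "gpath E qs" using gpath_append(1)[OF q(1)] q(2) by simp
  have qb: "adj E (last qs) b" using q by (auto simp: gpath_def successively_append_iff)
  have aq: "gpath E (a # qs)" using gpath_join[of E "[a]" qs] gq q dis by (auto simp: gpath_single)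
  have aqb: "gpath E (a # qs @ [b])"
    using gpath_join[of E "a # qs" "[b]"] aq q qb dis g by (auto simp: gpath_single gpath_def)
  consider "s = []" | "s \<noteq> []" "t = []" | "s \<noteq> []" "t \<noteq> []" by blast
  then show ?thesis
  proof cases
    case 1
    have "gpath E ((a # qs) @ (b # t))"
      by (rule gpath_join[OF aq gbt]) (use dis g q qb in \<open>auto simp: gpath_def\<close>)
    then have "cyc E (a # qs @ b # t)" using cy q(2) by (cases qs) (auto simp: cyc_def)
    then show ?thesis using 1 q(2) by (intro exI[of _ "a # qs @ b # t"]) auto
  next
    case 2
    have gs: "gpath E (s @ [b])" using gpath_append(2)[of E "[a]" "s @ [b]"] gasb by simp
    then have gr: "gpath E (b # rev s)" using gpath_rev[of E "s @ [b]"] by simp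
    have "gpath E ((a # qs) @ (b # rev s))"
      by (rule gpath_join[OF aq gr]) (use dis g q qb in \<open>auto simp: gpath_def\<close>)
    moreover have "adj E (hd s) a" using g 2 by (cases s) (auto simp: gpath_def adj_commute)
    ultimately have "cyc E (a # qs @ b # rev s)" using q(2) 2 by (cases qs) (auto simp: cyc_def last_rev)
    then show ?thesis using 2 q(2) by (intro exI[of _ "a # qs @ b # rev s"]) auto
  next
    case 3
    have "adj E (last (b # t)) a" using cy by (simp add: cyc_def)
    then have "gpath E ((b # t) @ [a])" using gbt g by (intro gpath_join) (auto simp: gpath_single gpath_def)
    then have gt: "gpath E (a # rev t @ [b])" using gpath_rev[of E "b # t @ [a]"] by simp
    have "set s \<inter> set (rev t) = {}" "set s \<inter> set qs = {}" "set (rev t) \<inter> set qs = {}"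
      using g dis by (auto simp: gpath_def)
    then have False using nth gasb gt aqb 3 q(2) unfolding no_theta_def
      by (metis rev_is_Nil_conv)
    then show ?thesis ..
  qed
qed

lemma hamiltonian_end_block:
  fixes E :: "'a set set"
  assumes fin: "finite (\<Union>E)" and ne: "E \<noteq> {}" and two: "\<And>e. e \<in> E \<Longrightarrow> \<exists>u v. e = {u, v} \<and> u \<noteq> v"
    and deg: "\<And>a. a \<in> \<Union>E \<Longrightarrow> \<exists>b b'. b \<noteq> b' \<and> adj E a b \<and> adj E a b'" and nth: "no_theta E"
  obtains c xs where "cyc E (c # xs)" "\<And>a b. a \<in> set xs \<Longrightarrow> adj E a b \<Longrightarrow> b \<in> set (c # xs)"
proof -
  obtain c K where K: "K \<noteq> {}" "K \<subseteq> \<Union>E" "c \<in> \<Union>E" "c \<notin> K" "\<And>a b. a \<in> K \<Longrightarrow> adj E a b \<Longrightarrow> b \<in> insert c K"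
    "\<And>a b d. a \<in> insert c K \<Longrightarrow> b \<in> insert c K - {a} \<Longrightarrow> d \<in> insert c K - {a} \<Longrightarrow>
       \<exists>xs. gpath E xs \<and> hd xs = b \<and> last xs = d \<and> set xs \<subseteq> insert c K - {a}"
    using end_block[OF fin ne two] by metis
  let ?B = "insert c K"
  have finB: "finite ?B" using K fin by (auto intro: finite_subset)
  have irr: "\<not> adj E x x" for x
  proof
    assume "adj E x x"
    then obtain u v where "{x, x} = {u, v}" "u \<noteq> v" using two unfolding adj_def by metis
    then show False by (auto simp: doubleton_eq_iff)
  qed
  obtain a where a: "a \<in> K" using K(1) by blast
  then have "a \<in> \<Union>E" using K(2) by (rule rev_subsetD)
  from deg[OF this] obtain b b' where b: "b \<noteq> b'" "adj E a b" "adj E a b'" by blast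
  have "b \<in> ?B - {a}" "b' \<in> ?B - {a}" using K(5)[OF a b(2)] K(5)[OF a b(3)] irr[of a] b by auto
  from K(6)[OF _ this] a obtain ys where ys: "gpath E ys" "hd ys = b" "last ys = b'" "set ys \<subseteq> ?B - {a}" by auto
  \<comment> \<open>A path between two neighbours of \<open>a\<close> that avoids \<open>a\<close>
    closes up to a first cycle within the block.\<close>
  have "gpath E ([a] @ ys)" using ys b by (intro gpath_join) (auto simp: gpath_single)
  moreover have "2 \<le> length ys" using ys b(1) by (cases ys; cases "tl ys") (auto simp: gpath_def)
  ultimately have c0: "cyc E (a # ys) \<and> set (a # ys) \<subseteq> ?B"
    using ys b a by (auto simp: cyc_def adj_commute gpath_def)
  have bound: "\<forall>xs. cyc E xs \<and> set xs \<subseteq> ?B \<longrightarrow> length xs < Suc (card ?B)"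
  proof (intro allI impI)
    fix xs assume "cyc E xs \<and> set xs \<subseteq> ?B"
    then have "card (set xs) = length xs" "card (set xs) \<le> card ?B"
      using card_mono[OF finB, of "set xs"] distinct_card[of xs] by (auto simp: cyc_def gpath_def)
    then show "length xs < Suc (card ?B)" by simp
  qed
  obtain C where C: "cyc E C" "set C \<subseteq> ?B" and max: "\<And>xs. cyc E xs \<Longrightarrow> set xs \<subseteq> ?B \<Longrightarrow> length xs \<le> length C"
    using ex_has_greatest_nat[of "\<lambda>xs. cyc E xs \<and> set xs \<subseteq> ?B" "a # ys" length "Suc (card ?B)"] c0 bound by blast
  have "set C = ?B"
  proof (rule ccontr)
    assume "set C \<noteq> ?B"
    then obtain w0 where w0: "w0 \<in> ?B" "w0 \<notin> set C" using C by blast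
    have len: "3 \<le> length C" and dC: "distinct C" using C by (auto simp: cyc_def gpath_def)
    then obtain x y C' where xy: "C = x # y # C'" by (metis Suc_le_length_iff numeral_3_eq_3)
    have "x \<in> ?B" "w0 \<in> ?B - {x}" "y \<in> ?B - {x}" using w0 xy C dC by auto
    then obtain ps where ps: "gpath E ps" "hd ps = w0" "last ps = y" "set ps \<subseteq> ?B - {x}" using K(6) by blast
    then have "\<exists>z\<in>set ps. z \<in> set C" using xy by (metis gpath_def last_in_set list.set_intros)
    then obtain us a vs where ua: "ps = us @ a # vs" "a \<in> set C" "\<forall>z\<in>set us. z \<notin> set C"
      using split_list_first_prop[of ps "\<lambda>z. z \<in> set C"] by blast
    have "us \<noteq> []" using ua ps w0 by auto
    \<comment> \<open>\<open>w\<close> is the last vertex before the path first meets the longest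
      cycle \<open>C\<close>, which happens at \<open>a\<close>. A second path from
      \<open>w\<close>, avoiding \<open>a\<close>, first meets \<open>C\<close> in some
      \<open>b\<close> other than \<open>a\<close>; together they give an ear from \<open>a\<close>
      to \<open>b\<close>.\<close>
    define w where "w = last us"
    have w: "w \<notin> set C" "adj E w a"
      using ua \<open>us \<noteq> []\<close> ps(1) by (auto simp: w_def gpath_def successively_append_iff)
    have "w \<in> set ps" using ua \<open>us \<noteq> []\<close> by (simp add: w_def)
    then have wB: "w \<in> ?B - {a}" using ps(4) w ua by auto
    have aB: "a \<in> ?B" using ua C by auto
    obtain y' where y': "y' \<in> set C" "y' \<noteq> a" using xy dC by (cases "x = a") auto
    then have "y' \<in> ?B - {a}" using C by auto
    then obtain rs where rs: "gpath E rs" "hd rs = w" "last rs = y'" "set rs \<subseteq> ?B - {a}" using K(6)[OF aB wB] by blast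
    then have "\<exists>z\<in>set rs. z \<in> set C" using y' by (metis gpath_def last_in_set)
    then obtain qs b vs' where qb: "rs = qs @ b # vs'" "b \<in> set C" "\<forall>z\<in>set qs. z \<notin> set C"
      using split_list_first_prop[of rs "\<lambda>z. z \<in> set C"] by blast
    have qs: "qs \<noteq> []" using qb rs w by auto
    have gq: "gpath E (qs @ [b])" using gpath_append(1)[of E "qs @ [b]" vs'] rs(1) qb(1) by simp
    have hq: "hd qs = w" using qb rs qs by simp
    obtain Z where Z: "cyc E (a # Z)" "set (a # Z) = set C" "length (a # Z) = length C"
      using cyc_rotate_to[OF C(1) ua(2)] .
    have "b \<noteq> a" using rs(4) qb by auto
    then have "b \<in> set Z" using Z qb by auto
    then obtain s t where st: "Z = s @ b # t" by (auto dest: split_list)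
    have "set qs \<inter> set (a # s @ b # t) = {}" using qb(3) Z(2) st by auto
    from ear_extends[OF Z(1)[unfolded st] gq qs _ this nth] hq w
    obtain zs where zs: "cyc E zs" "length (a # s @ b # t) < length zs" "set zs \<subseteq> set (a # s @ b # t) \<union> set qs"
      by (auto simp: adj_commute)
    have "set qs \<subseteq> ?B" using rs(4) qb(1) by auto
    then have "set zs \<subseteq> ?B" using zs(3) Z(2) st C(2) by blast
    then show False using max[OF zs(1)] zs(2) Z(3) st by simp
  qed
  then have "c \<in> set C" by simp
  then obtain xs where xs: "cyc E (c # xs)" "set (c # xs) = set C" using cyc_rotate_to[OF C(1)] by metis
  have "set xs = K" using xs K(4) \<open>set C = ?B\<close> by (auto simp: cyc_def gpath_def)
  then show ?thesis using that[OF xs(1)] K(5) by auto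
qed

section \<open>Numbering the Hamiltonian cycle\<close>

lemma split_at:
  assumes "i < length xs"
  shows "xs = take i xs @ xs ! i # drop (Suc i) xs"
  using id_take_nth_drop[OF assms] .

lemma cyc_noncross:
  assumes cy: "cyc E xs" and ncr: "no_cross E"
    and l: "i < j" "j < k" "k < l" "l < length xs" and ik: "adj E (xs ! i) (xs ! k)" and jl: "adj E (xs ! j) (xs ! l)"
  shows False
proof -
  define a b c d where "a = xs ! i" and "b = xs ! j" and "c = xs ! k" and "d = xs ! l"
  define ys where "ys = drop (Suc i) xs"
  have ys: "xs = take i xs @ a # ys" unfolding a_def ys_def using split_at[of i xs] l by simp
  define j' where "j' = j - Suc i"
  have j': "j' < length ys" "ys ! j' = b" unfolding ys_def j'_def b_def using l by auto
  define zs where "zs = drop (Suc j') ys"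
  have zs: "ys = take j' ys @ b # zs" unfolding zs_def using split_at[OF j'(1)] j'(2) by simp
  define k' where "k' = k - Suc j"
  have k': "k' < length zs" "zs ! k' = c" unfolding zs_def ys_def k'_def j'_def c_def using l by auto
  define ws where "ws = drop (Suc k') zs"
  have ws: "zs = take k' zs @ c # ws" unfolding ws_def using split_at[OF k'(1)] k'(2) by simp
  define l' where "l' = l - Suc k"
  have l': "l' < length ws" "ws ! l' = d" unfolding ws_def zs_def ys_def k'_def j'_def l'_def d_def using l by auto
  have vs: "ws = take l' ws @ d # drop (Suc l') ws" using split_at[OF l'(1)] l'(2) by simp
  obtain s t u v r where "xs = r @ a # s @ b # t @ c # u @ d # v"
    using ys zs ws vs by metis
  then have "cyc E (a # (s @ b # t @ c # u @ d # v) @ r)" using cyc_rotate[of E r a "s @ b # t @ c # u @ d # v"] cy by simp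
  then have "gpath E (a # s @ b # t @ c # u @ d # (v @ r))" "adj E (last (d # (v @ r))) a"
    by (auto simp: cyc_def)
  moreover have "adj E a c" "adj E b d" using ik jl by (simp_all add: a_def b_def c_def d_def)
  ultimately show False using ncr unfolding no_cross_def by blast
qed

definition inc :: "'a set set \<Rightarrow> 'a \<Rightarrow> 'a set set" where "inc E v = {e \<in> E. v \<in> e}"

definition nbr :: "'a set set \<Rightarrow> 'a \<Rightarrow> 'a set" where "nbr E v = {w. adj E v w}"

definition sun :: "'a set set \<Rightarrow> 'a \<Rightarrow> 'a \<Rightarrow> 'a \<Rightarrow> 'a \<Rightarrow> 'a \<Rightarrow> bool" where
  "sun E x u v y z \<longleftrightarrow> distinct [x, u, v, y, z] \<and> nbr E x = {u, v, y, z} \<and> nbr E u = {x, y} \<and> nbr E v = {x, z}"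

theorem outerplanar_configuration:
  fixes E :: "'a set set"
  assumes fin: "finite (\<Union>E)" and ne: "E \<noteq> {}" and two: "\<And>e. e \<in> E \<Longrightarrow> \<exists>u v. e = {u, v} \<and> u \<noteq> v"
    and nth: "no_theta E" and ncr: "no_cross E"
  obtains (pendant) u v where "nbr E u = {v}"
  | (light) u v where "adj E u v" "card (nbr E u) = 2" "card (nbr E v) \<le> 3"
  | (sun4) x u v y z where "sun E x u v y z" "card (nbr E y) \<le> 4"
  | (sun5) x u v y z t w where "sun E x u v y z" "distinct [x, u, v, y, z, t, w]" "nbr E y = {z, x, u, t, w}" "nbr E t = {y, w}"
  | (sun6) x u v y z x' u' v' w where "sun E x u v y z" "sun E x' u' v' y w" "distinct [x, u, v, y, z, x', u', v', w]"
      "nbr E y = {z, x, u, w, x', u'}"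
proof (cases "\<exists>u v. nbr E u = {v}")
  case True
  then show ?thesis using pendant by blast
next
  case False
  have deg: "\<exists>b b'. b \<noteq> b' \<and> adj E a b \<and> adj E a b'" if aE: "a \<in> \<Union>E" for a
  proof -
    obtain e where "e \<in> E" "a \<in> e" using aE by blast
    then obtain b where "adj E a b" using two[of e] unfolding adj_def by (metis insert_commute insertE singletonD)
    moreover have "nbr E a \<noteq> {b}" using False by blast
    ultimately show ?thesis unfolding nbr_def by blast
  qed
  obtain c xs0 where cy0: "cyc E (c # xs0)" and cl0: "\<And>a b. a \<in> set xs0 \<Longrightarrow> adj E a b \<Longrightarrow> b \<in> set (c # xs0)"
    using hamiltonian_end_block[OF fin ne two deg nth] by metis
  \<comment> \<open>The cut vertex gets the number 0; by \<open>cl0\<close> the neighbours of every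
    other vertex lie on the cycle, which yields \<open>real\<close>.\<close>
  define xs where "xs = c # xs0"
  define m where "m = length xs0"
  have cy: "cyc E xs" and lx: "length xs = Suc m" using cy0 by (simp_all add: xs_def m_def)
  have dist: "distinct xs" and len: "3 \<le> length xs" and suc: "successively (adj E) xs" using cy by (auto simp: cyc_def gpath_def)
  have inj: "xs ! i = xs ! j \<longleftrightarrow> i = j" if "i \<le> m" "j \<le> m" for i j
    using nth_eq_iff_index_eq[OF dist] that lx by simp
  define R where "R i j \<longleftrightarrow> i \<le> m \<and> j \<le> m \<and> adj E (xs ! i) (xs ! j)" for i j
  have irr: "\<not> adj E x x" for x
  proof
    assume "adj E x x"
    then obtain u v where "{x, x} = {u, v}" "u \<noteq> v" using two unfolding adj_def by metis
    then show False by (auto simp: doubleton_eq_iff)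
  qed
  interpret interval R m
  proof
    show "R j i" if "R i j" for i j using that by (auto simp: R_def adj_commute)
    show "\<not> R i i" for i using irr by (auto simp: R_def)
    show "R i (Suc i)" if "i < m" for i
      using suc that lx unfolding R_def by (auto simp: successively_conv_nth)
    have "last xs = xs ! m" "hd xs = xs ! 0" using lx by (auto simp: last_conv_nth xs_def)
    then show "R 0 m" using cy by (auto simp: R_def cyc_def adj_commute)
    show "2 \<le> m" using len lx by simp
    show False if "i < j" "j < k" "k < l" "l \<le> m" "R i k" "R j l" for i j k l
      using cyc_noncross[OF cy ncr that(1-3)] that lx by (auto simp: R_def)
  qed
  let ?g = "(!) xs"
  have real: "nbr E (?g i) = ?g ` nb i" if "i \<in> {1..m}" for i
  proof -
    have "?g i \<in> set xs0" using that by (auto simp: xs_def m_def nth_Cons split: nat.split)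
    then have sub: "nbr E (?g i) \<subseteq> set xs" using cl0 by (auto simp: nbr_def xs_def)
    show ?thesis
    proof
      show "nbr E (?g i) \<subseteq> ?g ` nb i"
      proof
        fix w assume w: "w \<in> nbr E (?g i)"
        then obtain j where "j < length xs" "w = ?g j" using sub by (metis in_set_conv_nth subsetD)
        then show "w \<in> ?g ` nb i" using w that lx by (auto simp: nb_def R_def nbr_def)
      qed
    qed (auto simp: nb_def R_def nbr_def)
  qed
  have nbm: "nb i \<subseteq> {0..m}" for i by (auto simp: nb_def)
  have injg: "inj_on ?g {0..m}" using inj by (auto intro!: inj_onI)
  have card_real: "card (nbr E (?g i)) = card (nb i)" if "i \<in> {1..m}" for i
    using real[OF that] card_image[OF inj_on_subset[OF injg nbm]] by simp
  have dist_map: "distinct (map ?g is)" if "distinct is" "set is \<subseteq> {0..m}" for "is"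
    using that inj_on_subset[OF injg] by (simp add: distinct_map)
  have sun_real: "sun E (?g x) (?g u) (?g v) (?g y) (?g z)" if s: "sunI x u v y z" for x u v y z
  proof -
    have "nb x \<subseteq> {0..m}" by (rule nbm)
    then have "set [x, u, v, y, z] \<subseteq> {0..m}" using s by (auto simp: sunI_def)
    then have "distinct (map ?g [x, u, v, y, z])" using s by (intro dist_map) (auto simp: sunI_def)
    then show ?thesis using s real[of x] real[of u] real[of v] by (simp add: sun_def sunI_def)
  qed
  from configuration show ?thesis
  proof (elim disjE)
    assume conf_light
    then obtain u v where uv: "u \<in> {1..m}" "v \<in> {1..m}" "v \<in> nb u" "card (nb u) = 2" "card (nb v) \<le> 3" unfolding conf_light_def by blast
    then have "adj E (?g u) (?g v)" by (auto simp: nb_def R_def)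
    then show ?thesis using light uv card_real by metis
  next
    assume conf_sun4
    then obtain x u v y z where "sunI x u v y z" "y \<in> {1..m}" "card (nb y) \<le> 4" unfolding conf_sun4_def by blast
    then show ?thesis using sun4 sun_real card_real by metis
  next
    assume conf_sun5
    then obtain x u v y z t w where s: "sunI x u v y z" "y \<in> {1..m}" "t \<in> {1..m}" "distinct [x, u, v, y, z, t, w]"
      "nb y = {z, x, u, t, w}" "nb t = {y, w}" unfolding conf_sun5_def by blast
    have "nb y \<subseteq> {0..m}" "nb x \<subseteq> {0..m}" by (rule nbm)+
    then have "set [x, u, v, y, z, t, w] \<subseteq> {0..m}" using s by (auto simp: sunI_def)
    from dist_map[OF s(4) this] show ?thesis
      using sun5[OF sun_real[OF s(1)], of "?g t" "?g w"] real[OF s(2)] real[OF s(3)] s(5,6) by simp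
  next
    assume conf_sun6
    then obtain x u v y z x' u' v' w where s: "sunI x u v y z" "sunI x' u' v' y w" "y \<in> {1..m}"
      "distinct [x, u, v, y, z, x', u', v', w]" "nb y = {z, x, u, w, x', u'}" unfolding conf_sun6_def by blast
    have "nb y \<subseteq> {0..m}" "nb x \<subseteq> {0..m}" "nb x' \<subseteq> {0..m}" by (rule nbm)+
    then have "set [x, u, v, y, z, x', u', v', w] \<subseteq> {0..m}" using s by (auto simp: sunI_def)
    from dist_map[OF s(4) this] show ?thesis
      using sun6[OF sun_real[OF s(1)] sun_real[OF s(2)]] real[OF s(3)] s(5) by simp
  qed
qed

section \<open>Lists around a sun\<close>

text \<open>The 2p - 1 colours in conflict with \<open>a\<close>. Integers are used so that the
  interval is never truncated at 0.\<close>

definition near :: "nat \<Rightarrow> int \<Rightarrow> int set" where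
  "near p a = {a - int p <..< a + int p}"

text \<open>The edge colours that leave no colour of \<open>U\<close> for an end of the
  edge.\<close>

definition bad :: "nat \<Rightarrow> int set \<Rightarrow> int set" where
  "bad p U = {e. U \<subseteq> near p e}"

lemma near_commute: "a \<in> near p b \<longleftrightarrow> b \<in> near p a"
  by (auto simp: near_def)

lemma finite_near [simp]: "finite (near p a)"
  by (simp add: near_def)

lemma card_near: "card (near p a) = 2 * p - 1"
  by (simp add: near_def)

lemma near_eqD: "p \<ge> 1 \<Longrightarrow> near p a \<subseteq> near p b \<Longrightarrow> a = b"
proof -
  assume p: "p \<ge> 1" and sub: "near p a \<subseteq> near p b"
  have "a - int p + 1 \<in> near p a" "a + int p - 1 \<in> near p a"
    using p by (auto simp: near_def)
  then have "a - int p + 1 \<in> near p b" "a + int p - 1 \<in> near p b"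
    using sub by auto
  then show "a = b" by (auto simp: near_def)
qed

text \<open>A bad colour is within distance less than p of both the minimum and the maximum of
  \<open>U\<close>, which are at least \<open>card U - 1\<close> apart.\<close>

lemma bad_card:
  assumes "finite U" "U \<noteq> {}"
  shows "finite (bad p U) \<and> card (bad p U) \<le> 2 * p - card U"
proof -
  have sub: "bad p U \<subseteq> {Max U - int p <..< Min U + int p}"
  proof
    fix e assume "e \<in> bad p U"
    then have "Max U \<in> near p e" "Min U \<in> near p e"
      using Max_in[OF assms] Min_in[OF assms] by (auto simp: bad_def)
    then show "e \<in> {Max U - int p <..< Min U + int p}" by (auto simp: near_def)
  qed
  have "U \<subseteq> {Min U..Max U}" using assms by auto
  then have "card U \<le> card {Min U..Max U}" by (intro card_mono) auto
  then have U: "int (card U) \<le> Max U - Min U + 1"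
    using Min_le[OF assms(1) Max_in[OF assms]] by simp
  have "card (bad p U) \<le> card {Max U - int p <..< Min U + int p}"
    using sub by (intro card_mono) auto
  then have "card (bad p U) \<le> nat (Min U + int p - (Max U - int p) - 1)" by (simp add: algebra_simps)
  then show ?thesis using sub U finite_subset[OF sub] by auto
qed

lemma card_Diff_ge:
  assumes "finite B" "card B \<le> n" "m + n \<le> card A"
  shows "m \<le> card (A - B)"
  using diff_card_le_card_Diff[OF assms(1), of A] assms by linarith

text \<open>The equality case of the counting: if removing \<open>B\<close> costs as much as its
  bound \<open>n\<close> allows, then nothing of \<open>B\<close> was missing in
  \<open>A\<close>.\<close>

lemma card_Diff_tight:
  assumes "finite A" "finite B" "card B \<le> n" "card (A - B) + n \<le> card A"
  shows "B \<subseteq> A" "card B = n" "card A = card (A - B) + n"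
proof -
  have eq: "card (A - B) + card (A \<inter> B) = card A"
    using card_Int_Diff[OF assms(1), of B] by simp
  have le: "card (A \<inter> B) \<le> card B" using assms by (intro card_mono) auto
  then have "card (A \<inter> B) = card B" "card B = n" using eq assms by linarith+
  then show "B \<subseteq> A" "card B = n" "card A = card (A - B) + n"
    using card_subset_eq[of B "A \<inter> B"] assms eq by auto
qed

text \<open>By \<open>bad_card\<close> at most p - 1 colours are bad for \<open>A\<close>, fewer
  than \<open>C\<close> has.\<close>

lemma far_pair:
  assumes "finite A" "p + 1 \<le> card A" "finite C" "p \<le> card C" "p \<ge> 1"
  obtains a c where "a \<in> A" "c \<in> C" "a \<notin> near p c"
proof -
  have "A \<noteq> {}" using assms by auto
  note B = bad_card[OF assms(1) this, of p]
  have "\<not> C \<subseteq> bad p A"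
  proof
    assume "C \<subseteq> bad p A"
    then have "card C \<le> card (bad p A)" using B by (intro card_mono) auto
    then show False using B assms by linarith
  qed
  then show ?thesis using that by (auto simp: bad_def)
qed

text \<open>
  In the following, \<open>x\<close> is the colour of the centre of a sun and \<open>a, b, c, d\<close> are the colours of the edges
  \<open>xy, uy, xz, vz\<close>. The on_lists \<open>Lu\<close> and \<open>Lv\<close> of the vertices \<open>u\<close> and \<open>v\<close> are those without the colours of
  \<open>y\<close> and \<open>z\<close>, and \<open>Le\<close> and \<open>Lf\<close> are the on_lists of the edges \<open>xu\<close> and \<open>xv\<close>. The colour \<open>g\<close> is the only
  one that is left for both of these edges.
\<close>

definition sun_u :: "nat \<Rightarrow> int set \<Rightarrow> int \<Rightarrow> int \<Rightarrow> int set" where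
  "sun_u p Lu x b = Lu - {x} - near p b"

definition sun_e :: "nat \<Rightarrow> int set \<Rightarrow> int \<Rightarrow> int \<Rightarrow> int \<Rightarrow> int \<Rightarrow> int set" where
  "sun_e p Le x a b c = Le - near p x - {a, b, c}"

text \<open>All estimates hold with equality: 3p + 2 = (2p - 1) + 3 + p splits \<open>Le\<close>
  into the colours near \<open>x\<close>, the colours \<open>a\<close>, \<open>b\<close>,
  \<open>c\<close>, and p further ones, namely \<open>g\<close> and p - 1 bad ones; similarly 3p + 1
  = 1 + (2p - 1) + (p + 1) for \<open>Lu\<close>. For p = 1 there are no bad colours, so the size of
  \<open>Lu\<close> is not forced.\<close>

definition tight :: "nat \<Rightarrow> int set \<Rightarrow> int set \<Rightarrow> int \<Rightarrow> int \<Rightarrow> int \<Rightarrow> int \<Rightarrow> int \<Rightarrow> bool" where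
  "tight p Lu Le g x a b c \<longleftrightarrow>
     near p x \<subseteq> Le \<and> {a, b, c} \<subseteq> Le \<and> {a, b, c} \<inter> near p x = {} \<and>
     a \<noteq> b \<and> a \<noteq> c \<and> b \<noteq> c \<and> card Le = 3 * p + 2 \<and>
     g \<in> sun_e p Le x a b c \<and> sun_e p Le x a b c - {g} = bad p (sun_u p Lu x b) \<and>
     card (bad p (sun_u p Lu x b)) = p - 1 \<and> finite (sun_u p Lu x b) \<and>
     p + 1 \<le> card (sun_u p Lu x b) \<and>
     (p \<ge> 2 \<longrightarrow> x \<in> Lu \<and> near p b \<subseteq> Lu \<and> x \<notin> near p b \<and>
        card (sun_u p Lu x b) = p + 1 \<and> card Lu = 3 * p + 1)"

lemma card3_le: "card {a, b, c} \<le> 3"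
  by (simp add: card_insert_if)

lemma sun_u_card:
  assumes "p \<ge> 1" "finite Lu" "3 * p + 1 \<le> card Lu"
  shows "p + 1 \<le> card (sun_u p Lu x b)" "finite (sun_u p Lu x b)"
proof -
  have "card ({x} \<union> near p b) \<le> 2 * p"
    using card_Un_le[of "{x}" "near p b"] assms(1) by (simp add: card_near)
  then have "p + 1 \<le> card (Lu - ({x} \<union> near p b))"
    using assms by (intro card_Diff_ge[of _ "2 * p"]) auto
  moreover have "sun_u p Lu x b = Lu - ({x} \<union> near p b)" by (auto simp: sun_u_def)
  ultimately show "p + 1 \<le> card (sun_u p Lu x b)" by simp
qed (use assms in \<open>simp add: sun_u_def\<close>)

lemma sun_e_card:
  assumes "p \<ge> 1" "finite Le" "3 * p + 2 \<le> card Le"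
  shows "p \<le> card (sun_e p Le x a b c)" "finite (sun_e p Le x a b c)"
proof -
  have "card (near p x \<union> {a, b, c}) \<le> 2 * p + 2"
    using card_Un_le[of "near p x" "{a, b, c}"] card3_le[of a b c] assms(1) by (simp add: card_near)
  then have "p \<le> card (Le - (near p x \<union> {a, b, c}))"
    using assms by (intro card_Diff_ge[of _ "2 * p + 2"]) auto
  moreover have "sun_e p Le x a b c = Le - (near p x \<union> {a, b, c})" by (auto simp: sun_e_def)
  ultimately show "p \<le> card (sun_e p Le x a b c)" by simp
qed (use assms in \<open>simp add: sun_e_def\<close>)

text \<open>The chain \<open>card ?C - 1\<close> \<le> \<open>card (bad p ?U)\<close> \<le>
  \<open>2 * p - card ?U\<close> \<le> \<open>p - 1\<close> meets \<open>card ?C\<close> \<ge> p, so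
  it collapses; \<open>card_Diff_tight\<close> then carries the equalities back to the
  lists.\<close>

lemma tightI:
  assumes p: "p \<ge> 1" and Lu: "finite Lu" "3 * p + 1 \<le> card Lu"
    and Le: "finite Le" "3 * p + 2 \<le> card Le"
    and g: "g \<in> sun_e p Le x a b c"
    and sub: "sun_e p Le x a b c - {g} \<subseteq> bad p (sun_u p Lu x b)"
  shows "tight p Lu Le g x a b c"
proof -
  let ?U = "sun_u p Lu x b" and ?C = "sun_e p Le x a b c"
  note U = sun_u_card[OF p Lu, of x b] and C = sun_e_card[OF p Le, of x a b c]
  have "?U \<noteq> {}" using U(1) by auto
  note B = bad_card[OF U(2) this, of p]
  have cC: "card (?C - {g}) = card ?C - 1" using g by simp
  have "card (?C - {g}) \<le> card (bad p ?U)" using sub B by (intro card_mono) auto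
  then have "card ?C - 1 \<le> 2 * p - card ?U" "card ?C - 1 \<le> card (bad p ?U)" "card (bad p ?U) \<le> 2 * p - card ?U"
    using B cC by linarith+
  then have c: "card ?C = p" "card (bad p ?U) = p - 1" "p \<ge> 2 \<longrightarrow> card ?U = p + 1"
    using U(1) C(1) p by auto
  have eq: "?C - {g} = bad p ?U"
    using sub B c cC by (intro card_subset_eq) auto
  let ?B = "near p x \<union> {a, b, c}"
  have cB: "card ?B \<le> 2 * p + 2"
    using card_Un_le[of "near p x" "{a, b, c}"] card3_le[of a b c] p by (simp add: card_near)
  have "?C = Le - ?B" by (auto simp: sun_e_def)
  with c Le have "card (Le - ?B) + (2 * p + 2) \<le> card Le" by simp
  note T = card_Diff_tight[OF Le(1) _ cB this, simplified]
  have cLe: "card Le = 3 * p + 2" using T(3) c \<open>?C = Le - ?B\<close> by simp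
  have "card (near p x \<union> {a, b, c}) = card (near p x) + card ({a, b, c} - near p x)"
    by (subst card_Un_disjoint[symmetric]) (auto intro!: arg_cong[where f = card])
  then have "card ({a, b, c} - near p x) = 3" using T(2) p by (simp add: card_near)
  moreover have "card ({a, b, c} - near p x) \<le> card {a, b, c}" by (intro card_mono) auto
  ultimately have c3: "card {a, b, c} = 3" "card ({a, b, c} - near p x) = card {a, b, c}" using card3_le[of a b c] by linarith+
  have "{a, b, c} - near p x = {a, b, c}" using c3(2) by (intro card_subset_eq) auto
  then have d1: "{a, b, c} \<inter> near p x = {}" by blast
  have d2: "a \<noteq> b \<and> a \<noteq> c \<and> b \<noteq> c" using c3(1) by (auto simp: card_insert_if split: if_splits)
  have "p \<ge> 2 \<longrightarrow> x \<in> Lu \<and> near p b \<subseteq> Lu \<and> x \<notin> near p b \<and> card Lu = 3 * p + 1"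
  proof
    assume "p \<ge> 2"
    let ?D = "{x} \<union> near p b"
    have cD: "card ?D \<le> 2 * p" using card_Un_le[of "{x}" "near p b"] p by (simp add: card_near)
    have "?U = Lu - ?D" by (auto simp: sun_u_def)
    then have "card (Lu - ?D) + 2 * p \<le> card Lu" using c \<open>p \<ge> 2\<close> Lu by simp
    note S = card_Diff_tight[OF Lu(1) _ cD this, simplified]
    have "x \<notin> near p b" using S(2) p by (auto simp: card_insert_if card_near split: if_splits)
    then show "x \<in> Lu \<and> near p b \<subseteq> Lu \<and> x \<notin> near p b \<and> card Lu = 3 * p + 1"
      using S c \<open>p \<ge> 2\<close> \<open>?U = Lu - ?D\<close> by simp
  qed
  then show ?thesis
    using T(1) d1 d2 cLe g eq c U by (auto simp: tight_def)
qed

lemma tightD: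
  assumes "tight p Lu Le g x a b c"
  shows "near p x \<subseteq> Le" "a \<in> Le" "b \<in> Le" "c \<in> Le"
    "a \<notin> near p x" "b \<notin> near p x" "c \<notin> near p x" "a \<noteq> b" "a \<noteq> c" "b \<noteq> c"
    "card Le = 3 * p + 2" "g \<in> Le" "g \<notin> near p x" "g \<noteq> a" "g \<noteq> b" "g \<noteq> c"
    "\<And>e. e \<in> bad p (sun_u p Lu x b) \<longleftrightarrow> e \<in> Le \<and> e \<notin> near p x \<and> e \<noteq> a \<and> e \<noteq> b \<and> e \<noteq> c \<and> e \<noteq> g"
    "card (bad p (sun_u p Lu x b)) = p - 1" "finite (sun_u p Lu x b)" "p + 1 \<le> card (sun_u p Lu x b)"
proof -
  have "sun_e p Le x a b c - {g} = bad p (sun_u p Lu x b)" using assms by (simp add: tight_def)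
  then show "\<And>e. e \<in> bad p (sun_u p Lu x b) \<longleftrightarrow> e \<in> Le \<and> e \<notin> near p x \<and> e \<noteq> a \<and> e \<noteq> b \<and> e \<noteq> c \<and> e \<noteq> g"
    unfolding sun_e_def by auto
qed (use assms in \<open>auto simp: tight_def sun_e_def\<close>)

lemma tightD2:
  assumes "tight p Lu Le g x a b c" "p \<ge> 2"
  shows "x \<in> Lu" "near p b \<subseteq> Lu" "x \<notin> near p b" "card (sun_u p Lu x b) = p + 1" "card Lu = 3 * p + 1"
  using assms by (auto simp: tight_def)

text \<open>What is left to colour are the edges \<open>xu\<close>, \<open>xv\<close> and the
  vertices \<open>u\<close>, \<open>v\<close>; the two sides interact only through
  \<open>e \<noteq> f\<close>.\<close>

definition solvable :: "nat \<Rightarrow> int set \<Rightarrow> int set \<Rightarrow> int set \<Rightarrow> int set \<Rightarrow> int \<Rightarrow> int \<Rightarrow> int \<Rightarrow> int \<Rightarrow> int \<Rightarrow> bool" where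
  "solvable p Lu Lv Le Lf x a b c d \<longleftrightarrow>
     (\<exists>e f u v. e \<in> sun_e p Le x a b c \<and> f \<in> sun_e p Lf x c d a \<and> e \<noteq> f \<and>
        u \<in> sun_u p Lu x b \<and> v \<in> sun_u p Lv x d \<and> u \<notin> near p e \<and> v \<notin> near p f)"

lemma solvable_mirror: "solvable p Lu Lv Le Lf x a b c d \<longleftrightarrow> solvable p Lv Lu Lf Le x c d a b"
  unfolding solvable_def by blast

section \<open>Unsolvable states of a sun\<close>

locale sun_lists =
  fixes p :: nat and Lu Lv Le Lf :: "int set"
  assumes p: "p \<ge> 1"
    and Lu: "finite Lu" "3 * p + 1 \<le> card Lu" and Lv: "finite Lv" "3 * p + 1 \<le> card Lv"
    and Le: "finite Le" "3 * p + 2 \<le> card Le" and Lf: "finite Lf" "3 * p + 2 \<le> card Lf"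
begin

abbreviation "unsolvable x a b c d \<equiv> \<not> solvable p Lu Lv Le Lf x a b c d"

lemma mirror: "sun_lists p Lv Lu Lf Le"
  using p Lu Lv Le Lf by unfold_locales

text \<open>\<open>far_pair\<close> gives a good colour on each side. If no two good colours differ,
  both sides have a single one, and it is the same colour \<open>g\<close>.\<close>

lemma unsolvable_tight:
  assumes "unsolvable x a b c d"
  obtains g where "tight p Lu Le g x a b c" "tight p Lv Lf g x c d a"
proof -
  let ?C = "sun_e p Le x a b c" and ?U = "sun_u p Lu x b"
  let ?D = "sun_e p Lf x c d a" and ?V = "sun_u p Lv x d"
  note U = sun_u_card[OF p Lu, of x b] and C = sun_e_card[OF p Le, of x a b c]
  note V = sun_u_card[OF p Lv, of x d] and D = sun_e_card[OF p Lf, of x c d a]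
  obtain e u where e: "e \<in> ?C" "u \<in> ?U" "u \<notin> near p e" using far_pair[OF U(2,1) C(2,1) p] by blast
  obtain f v where f: "f \<in> ?D" "v \<in> ?V" "v \<notin> near p f" using far_pair[OF V(2,1) D(2,1) p] by blast
  have *: "e' = f'" if "e' \<in> ?C" "e' \<notin> bad p ?U" "f' \<in> ?D" "f' \<notin> bad p ?V" for e' f'
    using assms that unfolding solvable_def bad_def by blast
  have "e \<notin> bad p ?U" "f \<notin> bad p ?V" using e f by (auto simp: bad_def)
  with * e f have ef: "e = f" "?C - {e} \<subseteq> bad p ?U" "?D - {e} \<subseteq> bad p ?V" by blast+
  show ?thesis
    by (rule that[of e]; rule tightI) (use p Lu Lv Le Lf e f ef in auto)
qed

text \<open>\<open>g\<close> is the only colour of \<open>sun_e p Lf x c d a\<close> that is not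
  bad. As \<open>b\<close> does not occur on this side, recolouring \<open>uy\<close> preserves
  \<open>g\<close>.\<close>

lemma tight_g_unique:
  assumes "tight p Lv Lf g x c d a" "tight p Lv Lf g' x c d a"
  shows "g = g'"
  using tightD[OF assms(1)] tightD[OF assms(2)] by metis

text \<open>Both states have the same \<open>g\<close>. Hence \<open>b'\<close> is bad for
  \<open>?U\<close>, so \<open>?U\<close> lies in \<open>near p b'\<close>, which \<open>?U'\<close>
  avoids. A further bad colour would be bad for \<open>?U'\<close> too, and its 2p - 1 near colours
  would contain two disjoint sets of size p + 1. So p - 1 = 1.\<close>

lemma two_unsolvable_uy:
  assumes s: "unsolvable x a b c d" and s': "unsolvable x a b' c d" and ne: "b \<noteq> b'"
  shows "p = 2" "Lu = {x} \<union> near p b \<union> near p b'"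
    "\<exists>g. tight p Lu Le g x a b c \<and> tight p Lv Lf g x c d a \<and> g \<noteq> b' \<and> Le = near p x \<union> {a, c, g, b, b'}"
proof -
  obtain g where g: "tight p Lu Le g x a b c" "tight p Lv Lf g x c d a" using unsolvable_tight[OF s] .
  obtain g' where g': "tight p Lu Le g' x a b' c" "tight p Lv Lf g' x c d a" using unsolvable_tight[OF s'] .
  have "g' = g" using tight_g_unique[OF g'(2) g(2)] .
  note g' = g'[unfolded this]
  let ?U = "sun_u p Lu x b" and ?U' = "sun_u p Lu x b'"
  note G = tightD[OF g(1)] and G' = tightD[OF g'(1)]
  have b': "b' \<in> bad p ?U" and b: "b \<in> bad p ?U'"
    using G(17)[of b'] G'(17)[of b] G(1-16) G'(1-16) ne by simp_all
  have disj: "?U \<inter> ?U' = {}"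
    using b' by (auto simp: bad_def sun_u_def)
  have single: "n = b'" if "n \<in> bad p ?U" for n
  proof (rule ccontr)
    assume "n \<noteq> b'"
    then have "n \<in> bad p ?U'" using G(17)[of n] G'(17)[of n] that by simp
    then have "?U \<union> ?U' \<subseteq> near p n" using that by (auto simp: bad_def)
    then have "card (?U \<union> ?U') \<le> 2 * p - 1"
      using card_mono[OF finite_near, of "?U \<union> ?U'" p n] by (simp only: card_near)
    then show False using G(19,20) G'(19,20) disj by (simp add: card_Un_disjoint)
  qed
  then have B: "bad p ?U = {b'}" using b' by blast
  then show p2: "p = 2" using G(18) by simp
  have sub: "Lu \<subseteq> {x} \<union> near p b \<union> near p b'"
    using b' by (auto simp: bad_def sun_u_def)
  show "Lu = {x} \<union> near p b \<union> near p b'"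
  proof
    show "{x} \<union> near p b \<union> near p b' \<subseteq> Lu"
      using tightD2[OF g(1)] tightD2[OF g'(1)] p2 by simp
  qed (rule sub)
  have "e \<in> Le \<longleftrightarrow> e \<in> near p x \<union> {a, c, g, b, b'}" for e
    using G(17)[of e] B G(1-16) G'(1-16) by blast
  then have "Le = near p x \<union> {a, c, g, b, b'}" by blast
  then show "\<exists>g. tight p Lu Le g x a b c \<and> tight p Lv Lf g x c d a \<and> g \<noteq> b' \<and> Le = near p x \<union> {a, c, g, b, b'}"
    using g G'(15) by blast
qed

lemma unsolvable_basic:
  assumes "unsolvable x a b c d"
  shows "a \<noteq> b" "a \<noteq> c" "b \<noteq> c" "a \<noteq> d" "c \<noteq> d"
    "a \<notin> near p x" "b \<notin> near p x" "c \<notin> near p x" "d \<notin> near p x"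
    "card Le = 3 * p + 2" "p \<ge> 2 \<Longrightarrow> x \<in> Lu" "p \<ge> 2 \<Longrightarrow> x \<notin> near p b"
    "p \<ge> 2 \<Longrightarrow> card Lu = 3 * p + 1"
proof -
  obtain g where g: "tight p Lu Le g x a b c" "tight p Lv Lf g x c d a" using unsolvable_tight[OF assms] .
  show "a \<noteq> b" "a \<noteq> c" "b \<noteq> c" "a \<noteq> d" "c \<noteq> d"
    "a \<notin> near p x" "b \<notin> near p x" "c \<notin> near p x" "d \<notin> near p x"
    "card Le = 3 * p + 2" "p \<ge> 2 \<Longrightarrow> x \<in> Lu" "p \<ge> 2 \<Longrightarrow> x \<notin> near p b"
    "p \<ge> 2 \<Longrightarrow> card Lu = 3 * p + 1"
    using tightD(1-16)[OF g(1)] tightD(1-16)[OF g(2)] tightD2[OF g(1)] by simp_all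
qed

text \<open>On the side of \<open>v\<close> the bad set does not change, so the pair formed by
  \<open>g\<close> and the colour of \<open>xy\<close> is the same in both states. A change from
  \<open>a\<close> to \<open>a'\<close> therefore means \<open>g = a'\<close>, whereas
  \<open>g \<noteq> b\<close>.\<close>

lemma unsolvable_xy_not_uy:
  assumes s: "unsolvable x a b c d" and s': "unsolvable x a' b' c d" and ne: "a \<noteq> a'"
  shows "a' \<noteq> b"
proof
  assume eq: "a' = b"
  obtain g where g: "tight p Lu Le g x a b c" "tight p Lv Lf g x c d a" using unsolvable_tight[OF s] .
  obtain g' where g': "tight p Lu Le g' x a' b' c" "tight p Lv Lf g' x c d a'" using unsolvable_tight[OF s'] .
  note G = tightD[OF g(1)] and H = tightD[OF g(2)] and H' = tightD[OF g'(2)]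
  have "g = g'" using H(17)[of g] H'(17)[of g] H(1-16) G(15) eq by metis
  moreover have "a = g'" using H(17)[of a] H'(17)[of a] H(1-16) ne by metis
  ultimately show False using G(14) by simp
qed

end

text \<open>\<open>X\<close>, \<open>P\<close>, \<open>Q\<close>, \<open>R\<close>, \<open>S\<close>
  are the colours available for \<open>x\<close>, \<open>xy\<close>, \<open>uy\<close>,
  \<open>xz\<close>, \<open>vz\<close>; the inequalities are the conflicts among these five
  elements.\<close>

definition valid_state where
  "valid_state p X P Q R S x a b c d \<longleftrightarrow> x \<in> X \<and> a \<in> P \<and> b \<in> Q \<and> c \<in> R \<and> d \<in> S \<and>
     a \<noteq> b \<and> a \<noteq> c \<and> c \<noteq> d \<and> a \<notin> near p x \<and> c \<notin> near p x"

lemma valid_state_mirror: "valid_state p X P Q R S x a b c d \<longleftrightarrow> valid_state p X R S P Q x c d a b"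
  by (auto simp: valid_state_def)

section \<open>Covering by intervals of three colours\<close>

lemma near2: "near 2 a = {a - 1, a, a + 1}"
  by (auto simp: near_def)

lemma card_ge_2_ex_other: "2 \<le> card A \<Longrightarrow> \<exists>z\<in>A. z \<noteq> w"
  by (metis (full_types) One_nat_def Suc_1 card.empty card.insert card_mono empty_iff finite.emptyI finite.insertI insertCI not_less_eq_eq subsetI)

lemma card_near2_Int: 
  assumes "(a::int) \<noteq> b" shows "card (near 2 a \<inter> near 2 b) \<le> 2"
proof -
  have "near 2 a \<inter> near 2 b \<subseteq> {min a b, min a b + 1}" using assms by (auto simp: near2)
  then have "card (near 2 a \<inter> near 2 b) \<le> card {min a b, min a b + 1}" by (intro card_mono) auto
  also have "\<dots> \<le> 2" by (simp add: card_insert_if)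
  finally show ?thesis .
qed

lemma card_near2_Int2: 
  assumes "(a::int) \<noteq> b" "c \<noteq> d" "X \<subseteq> (near 2 a \<inter> near 2 b) \<union> (near 2 c \<inter> near 2 d)"
  shows "card X \<le> 4"
proof -
  have "card X \<le> card ((near 2 a \<inter> near 2 b) \<union> (near 2 c \<inter> near 2 d))" by (intro card_mono assms) auto
  also have "\<dots> \<le> card (near 2 a \<inter> near 2 b) + card (near 2 c \<inter> near 2 d)" by (rule card_Un_le)
  also have "\<dots> \<le> 4" using card_near2_Int[OF assms(1)] card_near2_Int[OF assms(2)] by linarith
  finally show ?thesis .
qed

text \<open>A point covered by every pair is near at least two of the three centres, and being near
  both outer ones makes it near the middle one. So it is near the middle centre and an outer one,
  and each of these two intersections has at most two points.\<close>

lemma card_le_4_of_pairwise_cover: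
  fixes a b c :: int
  assumes "a \<noteq> b" "b \<noteq> c" "a \<noteq> c"
    and "X \<subseteq> near 2 a \<union> near 2 b" "X \<subseteq> near 2 b \<union> near 2 c" "X \<subseteq> near 2 a \<union> near 2 c"
  shows "card X \<le> 4"
proof -
  have *: "card X \<le> 4" if "l < m" "m < h" "X \<subseteq> near 2 l \<union> near 2 m" "X \<subseteq> near 2 m \<union> near 2 h" "X \<subseteq> near 2 l \<union> near 2 h"
    for l m h :: int
  proof (rule card_near2_Int2)
    show "X \<subseteq> (near 2 l \<inter> near 2 m) \<union> (near 2 m \<inter> near 2 h)"
    proof
      fix z assume "z \<in> X"
      then have "z \<in> near 2 l \<union> near 2 m" "z \<in> near 2 m \<union> near 2 h" "z \<in> near 2 l \<union> near 2 h" using that by auto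
      then show "z \<in> (near 2 l \<inter> near 2 m) \<union> (near 2 m \<inter> near 2 h)"
        using \<open>l < m\<close> \<open>m < h\<close> by (auto simp: near_def)
    qed
  qed (use that in auto)
  consider "a < b \<and> b < c" | "a < c \<and> c < b" | "b < a \<and> a < c" | "b < c \<and> c < a" | "c < a \<and> a < b" | "c < b \<and> b < a"
    using assms by linarith
  then show ?thesis
    by cases (use assms *[of a b c] *[of a c b] *[of b a c] *[of b c a] *[of c a b] *[of c b a] in \<open>simp_all add: Un_commute\<close>)
qed

text \<open>If every admissible pair covered \<open>X\<close> and the two pairs were disjoint, each
  point would be near both of \<open>a\<close>, \<open>b\<close> or near both of \<open>c\<close>,
  \<open>d\<close>, so \<open>X\<close> would have at most 4 points. If they share a colour, three
  centres cover \<open>X\<close> pairwise.\<close>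

lemma uncovered_by_some_pair:
  fixes a b c d :: int
  assumes "a \<noteq> b" "c \<noteq> d" "{a, b} \<noteq> {c, d}" "5 \<le> card X"
  obtains s t z where "s \<in> {a, b}" "t \<in> {c, d}" "s \<noteq> t" "z \<in> X" "z \<notin> near 2 s" "z \<notin> near 2 t"
proof -
  have "\<not> (\<forall>s\<in>{a, b}. \<forall>t\<in>{c, d}. s \<noteq> t \<longrightarrow> X \<subseteq> near 2 s \<union> near 2 t)"
  proof
    assume A: "\<forall>s\<in>{a, b}. \<forall>t\<in>{c, d}. s \<noteq> t \<longrightarrow> X \<subseteq> near 2 s \<union> near 2 t"
    have "card X \<le> 4"
    proof (cases "{a, b} \<inter> {c, d} = {}")
      case True
      then have "X \<subseteq> near 2 a \<union> near 2 c" "X \<subseteq> near 2 a \<union> near 2 d"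
        "X \<subseteq> near 2 b \<union> near 2 c" "X \<subseteq> near 2 b \<union> near 2 d" using A by auto
      then show ?thesis by (intro card_near2_Int2[OF assms(1,2)]) blast
    next
      case False
      then consider "a = c" "b \<noteq> d" | "a = d" "b \<noteq> c" | "b = c" "a \<noteq> d" | "b = d" "a \<noteq> c"
        using assms(1-3) by blast
      then show ?thesis
      proof cases
        case 1 then show ?thesis using A assms by (intro card_le_4_of_pairwise_cover[of a b d]) auto
      next
        case 2 then show ?thesis using A assms by (intro card_le_4_of_pairwise_cover[of a b c]) auto
      next
        case 3 then show ?thesis using A assms by (intro card_le_4_of_pairwise_cover[of a b d]) auto
      next
        case 4 then show ?thesis using A assms by (intro card_le_4_of_pairwise_cover[of a b c]) auto
      qed
    qed
    then show False using assms by simp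
  qed
  then show ?thesis using that by blast
qed

section \<open>Recolouring a whole sun\<close>

lemma (in sun_lists) unsolvable_x_not_less:
  assumes s: "unsolvable x a b c d" and s': "unsolvable x' a b c d" and p: "p = 2 \<or> p = 3"
  shows "\<not> x < x'"
proof
  assume less: "x < x'"
  obtain g where g: "tight p Lu Le g x a b c" using unsolvable_tight[OF s] .
  obtain g' where g': "tight p Lu Le g' x' a b c" using unsolvable_tight[OF s'] .
  let ?W = "Lu - near p b"
  have p2: "p \<ge> 2" using p by auto
  note G = tightD[OF g(1)] and G' = tightD[OF g'(1)]
  note K = tightD2[OF g(1) p2] and K' = tightD2[OF g'(1) p2]
  have U: "sun_u p Lu x b = ?W - {x}" "sun_u p Lu x' b = ?W - {x'}" by (auto simp: sun_u_def)
  have xx: "x \<in> ?W" "x' \<in> ?W" using K K' by auto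
  from p show False
  proof
    \<comment> \<open>Removing \<open>x\<close> or \<open>x'\<close> from \<open>?W\<close> leaves
      an interval of three colours, so \<open>?W\<close> is an interval of four with ends
      \<open>x = n - 2\<close> and \<open>x' = n + 1\<close>. Then \<open>n + 1\<close> and
      \<open>n + 2\<close> are both near \<open>x'\<close>, hence in \<open>Le\<close>, but neither
      near \<open>x\<close> nor bad, and both would have to be \<open>g\<close>.\<close>
    assume p: "p = 2"
    obtain n where n: "bad p (?W - {x}) = {n}" using G(18) p U by (auto simp: card_1_singleton_iff)
    obtain m where m: "bad p (?W - {x'}) = {m}" using G'(18) p U by (auto simp: card_1_singleton_iff)
    have "?W - {x} \<subseteq> near 2 n" "?W - {x'} \<subseteq> near 2 m" using n m p by (auto simp: bad_def)
    moreover have "card (?W - {x}) = 3" "card (?W - {x'}) = 3" using K K' U p by auto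
    ultimately have W: "?W - {x} = near 2 n" "?W - {x'} = near 2 m"
      by (intro card_subset_eq[OF finite_near]; simp add: card_near)+
    have "z \<in> near 2 n \<and> z \<noteq> x' \<longleftrightarrow> z \<in> near 2 m \<and> z \<noteq> x" for z
      using W xx less by blast
    note E = this
    have I: "z \<in> near 2 y \<longleftrightarrow> y - 2 < z \<and> z < y + 2" for z y :: int by (auto simp: near_def)
    have "x' \<in> near 2 n" "x \<in> near 2 m" "x \<notin> near 2 n" "x' \<notin> near 2 m" using W xx less by blast+
    then have "m < n" using less unfolding I by linarith
    then have "n + 1 \<notin> near 2 m" "m - 1 \<notin> near 2 n" by (auto simp: I)
    then have "x' = n + 1" "x = m - 1" using E[of "n + 1"] E[of "m - 1"] by (auto simp: I)
    moreover have "m = n - 1"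
    proof (rule ccontr)
      assume "m \<noteq> n - 1"
      then have "n \<notin> near 2 m" using \<open>m < n\<close> by (auto simp: I)
      then show False using E[of n] \<open>x' = n + 1\<close> by (auto simp: I)
    qed
    ultimately have x: "x' = n + 1" "x = n - 2" by auto
    have "e = g" if "e \<in> near 2 x'" "e \<noteq> n" "e \<notin> near 2 x" for e
    proof -
      have "e \<in> Le" using G'(1) that p by auto
      moreover have "e \<notin> bad p (sun_u p Lu x b)" using n U that by simp
      moreover have "e \<noteq> a" "e \<noteq> b" "e \<noteq> c" using that G'(5-7) p by auto
      ultimately show "e = g" using G(17)[of e] that p by auto
    qed
    from this[of "n + 1"] this[of "n + 2"] show False unfolding near2 x by simp
  next
    \<comment> \<open>The two bad colours for \<open>x\<close> lie at or above \<open>x + 3\<close>,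
      those for \<open>x'\<close> at or below \<open>x' - 3\<close>. The three remaining colours of
      \<open>?W\<close> are near all four, which confines them to \<open>x' - 3\<close> and
      \<open>x' - 2\<close>.\<close>
    assume p: "p = 3"
    have "card (bad p (?W - {x})) = 2" "card (bad p (?W - {x'})) = 2" using G(18) G'(18) U p by auto
    then obtain n1 n2 m1 m2 where nm: "bad p (?W - {x}) = {n1, n2}" "n1 \<noteq> n2" "bad p (?W - {x'}) = {m1, m2}" "m1 \<noteq> m2"
      unfolding card_2_iff by metis
    have "?W - {x} - {x'} = ?W - {x'} - {x}" by auto
    moreover have "card (?W - {x} - {x'}) = 3" using K(4) U xx less p by simp
    ultimately obtain w1 w2 w3 where w: "?W - {x} - {x'} = {w1, w2, w3}" "w1 \<noteq> w2" "w1 \<noteq> w3" "w2 \<noteq> w3"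
      unfolding card_3_iff by metis
    have "{w1, w2, w3} \<subseteq> ?W - {x} - {x'}" using w(1) by simp
    then have w4: "{x', w1, w2, w3} \<subseteq> ?W - {x}" "{x, w1, w2, w3} \<subseteq> ?W - {x'}"
      using xx less by auto
    have N: "n \<notin> near p x \<and> x' \<in> near p n \<and> w1 \<in> near p n \<and> w2 \<in> near p n \<and> w3 \<in> near p n" if "n \<in> {n1, n2}" for n
    proof -
      have n: "n \<in> bad p (?W - {x})" using that nm(1) by simp
      then have "n \<notin> near p x" using G(17)[of n] U(1) by simp
      moreover have "?W - {x} \<subseteq> near p n" using n by (simp add: bad_def)
      ultimately show ?thesis using w4 by blast
    qed
    have M: "n \<notin> near p x' \<and> x \<in> near p n \<and> w1 \<in> near p n \<and> w2 \<in> near p n \<and> w3 \<in> near p n" if "n \<in> {m1, m2}" for n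
    proof -
      have n: "n \<in> bad p (?W - {x'})" using that nm(3) by simp
      then have "n \<notin> near p x'" using G'(17)[of n] U(2) by simp
      moreover have "?W - {x'} \<subseteq> near p n" using n by (simp add: bad_def)
      ultimately show ?thesis using w4 by blast
    qed
    have I: "z \<in> near p y \<longleftrightarrow> y - 3 < z \<and> z < y + 3" for z y by (auto simp: near_def p)
    have N1: "n \<ge> x + 3 \<and> x' < n + 3 \<and> (\<forall>w\<in>{w1,w2,w3}. n - 3 < w)" if "n \<in> {n1,n2}" for n
      using N[OF that] less unfolding I by auto
    have M1: "n \<le> x' - 3 \<and> (\<forall>w\<in>{w1,w2,w3}. w < n + 3)" if "n \<in> {m1,m2}" for n
      using M[OF that] less unfolding I by auto
    define N where "N = max n1 n2" define N' where "N' = min n1 n2"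
    define M where "M = min m1 m2"
    have "N \<ge> N' + 1" "x' < N' + 3" "M \<le> x' - 4" using N1[of n1] N1[of n2] M1[of m1] M1[of m2] nm(2,4)
      by (simp_all add: N_def N'_def M_def) linarith+
    moreover have "\<forall>w\<in>{w1,w2,w3}. N - 3 < w \<and> w < M + 3"
      using N1 M1 by (auto simp: N_def M_def max_def min_def)
    ultimately show False using w by auto
  qed
qed

lemma (in sun_lists) unsolvable_x_unique:
  assumes "unsolvable x a b c d" "unsolvable x' a b c d" "p = 2 \<or> p = 3"
  shows "x = x'"
  using unsolvable_x_not_less[OF assms] unsolvable_x_not_less[OF assms(2,1,3)] by simp

text \<open>For p = 1 no two unsolvable states differ in the colour of \<open>uy\<close> alone, so
  \<open>Q = {a0, b0}\<close>. Recolouring \<open>xy\<close> by some \<open>a1\<close>, which is not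
  \<open>b0\<close> by \<open>unsolvable_xy_not_uy\<close>, makes both colours usable on
  \<open>uy\<close>. Three colours for \<open>x\<close> suffice, as \<open>near\<close> is a
  singleton.\<close>

lemma (in sun_lists) solvable_p1:
  assumes p1: "p = 1" and X: "3 \<le> card X" and cards: "2 \<le> card P" "2 \<le> card Q" "2 \<le> card R" "2 \<le> card S"
    and s0: "valid_state p X P Q R S x0 a0 b0 c0 d0"
  shows "\<exists>x a b c d. valid_state p X P Q R S x a b c d \<and> solvable p Lu Lv Le Lf x a b c d"
proof (rule ccontr)
  assume "\<not> ?thesis"
  then have unsolvable: "unsolvable x a b c d" if "valid_state p X P Q R S x a b c d" for x a b c d using that by blast
  note B = unsolvable_basic[OF unsolvable[OF s0]]
  have c1: "b = b'" if "unsolvable x a b c d" "unsolvable x a b' c d" for x a b b' c d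
    using two_unsolvable_uy(1)[OF that] p1 by auto
  have Qonly: "b \<in> {a0, b0}" if "b \<in> Q" for b
  proof (rule ccontr)
    assume "b \<notin> {a0, b0}"
    then have "valid_state p X P Q R S x0 a0 b c0 d0" using s0 that by (auto simp: valid_state_def)
    then show False using c1[OF unsolvable unsolvable[OF s0]] \<open>b \<notin> {a0, b0}\<close> by blast
  qed
  obtain b1 where "b1 \<in> Q" "b1 \<noteq> b0" using card_ge_2_ex_other[OF cards(2)] by metis
  then have Q: "a0 \<in> Q" "b0 \<in> Q" using Qonly s0 by (auto simp: valid_state_def)
  obtain a1 where a1: "a1 \<in> P" "a1 \<noteq> a0" using card_ge_2_ex_other[OF cards(1)] by metis
  have "a1 \<noteq> b0"
  proof
    assume "a1 = b0"
    then have "valid_state p X P Q R S x0 a1 a0 c0 d0" using s0 a1 Q B by (auto simp: valid_state_def)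
    from unsolvable_xy_not_uy[OF unsolvable[OF s0] unsolvable[OF this]] a1 \<open>a1 = b0\<close> show False by simp
  qed
  obtain c where c: "c \<in> R" "c \<noteq> a1" using card_ge_2_ex_other[OF cards(3)] by metis
  obtain d where d: "d \<in> S" "d \<noteq> c" using card_ge_2_ex_other[OF cards(4)] by metis
  have "near p a1 \<union> near p c \<subseteq> {a1, c}" using p1 by (auto simp: near_def)
  then have "card (near p a1 \<union> near p c) \<le> card {a1, c}" by (intro card_mono) auto
  also have "\<dots> \<le> 2" by (simp add: card_insert_if)
  finally have "\<not> X \<subseteq> near p a1 \<union> near p c" using X card_mono[of "near p a1 \<union> near p c" X] by fastforce
  then obtain x where "x \<in> X" "a1 \<notin> near p x" "c \<notin> near p x" by (auto simp: near_commute)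
  then have "valid_state p X P Q R S x a1 a0 c d" "valid_state p X P Q R S x a1 b0 c d"
    using a1 c d Q \<open>a1 \<noteq> b0\<close> by (auto simp: valid_state_def)
  then show False using c1 unsolvable s0 unfolding valid_state_def by metis
qed

text \<open>The core is \<open>key\<close>. If it failed, there would be room for another colour of
  \<open>x\<close>; this turns out to be possible only with \<open>xy\<close> and \<open>xz\<close>
  unchanged, and then two unsolvable states differ only at \<open>x\<close>, against
  \<open>unsolvable_x_unique\<close>.\<close>

lemma (in sun_lists) stuck_p2_from_state:
  assumes p2: "p = 2" and X: "6 \<le> card X" and cards: "2 \<le> card P" "2 \<le> card Q" "2 \<le> card R" "2 \<le> card S"
    and s0: "valid_state p X P Q R S x0 a0 b0 c0 d0"
    and all: "\<forall>x a b c d. valid_state p X P Q R S x a b c d \<longrightarrow> unsolvable x a b c d"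
  shows "P = {a0, c0}" "R = {a0, c0}"
    "\<And>b. b \<in> Q \<Longrightarrow> b \<noteq> a0 \<and> b \<noteq> c0"
    "\<And>x. x \<in> X \<Longrightarrow> x \<noteq> x0 \<Longrightarrow> x \<in> near p a0 \<union> near p c0"
proof -
  have unsolvable: "unsolvable x a b c d" if "valid_state p X P Q R S x a b c d" for x a b c d using all that by blast
  interpret M: sun_lists p Lv Lu Lf Le by (rule mirror)
  have m: "M.unsolvable x c d a b \<longleftrightarrow> unsolvable x a b c d" for x a b c d by (simp add: solvable_mirror)
  note B = unsolvable_basic[OF unsolvable[OF s0]]
  have c2: "x = x'" if "unsolvable x a b c d" "unsolvable x' a b c d" for x x' a b c d using unsolvable_x_unique[OF that] p2 by simp
  have key: "{a0, a1} = {c0, c1}" if a1: "a1 \<in> P" "a1 \<noteq> a0" and c1: "c1 \<in> R" "c1 \<noteq> c0" for a1 c1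
  proof (rule ccontr)
    assume ne: "{a0, a1} \<noteq> {c0, c1}"
    have "5 \<le> card (X - {x0})" using X by (intro card_Diff_ge[of _ 1]) auto
    then obtain a c x where s: "a \<in> {a0, a1}" "c \<in> {c0, c1}" "a \<noteq> c" "x \<in> X" "x \<noteq> x0" "a \<notin> near p x" "c \<notin> near p x"
      using uncovered_by_some_pair[OF _ _ ne] a1 c1 p2 by (metis near_commute Diff_iff singletonI)
    have aP: "a \<in> P" "c \<in> R" using s a1 c1 s0 by (auto simp: valid_state_def)
    obtain b1 where b1: "b1 \<in> Q" "b1 \<noteq> b0" using card_ge_2_ex_other[OF cards(2)] by metis
    obtain d1 where d1: "d1 \<in> S" "d1 \<noteq> d0" using card_ge_2_ex_other[OF cards(4)] by metis
    obtain b where b: "b \<in> Q" "b \<noteq> a" using card_ge_2_ex_other[OF cards(2)] by metis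
    obtain d where d: "d \<in> S" "d \<noteq> c" using card_ge_2_ex_other[OF cards(4)] by metis
    have QS: "b0 \<in> Q" "d0 \<in> S" using s0 by (auto simp: valid_state_def)
    have b1x: "x0 \<notin> near p b1"
    proof (cases "b1 = a0")
      case False
      then have "valid_state p X P Q R S x0 a0 b1 c0 d0" using s0 b1 by (auto simp: valid_state_def)
      from unsolvable_basic(7)[OF unsolvable[OF this]] show ?thesis by (simp add: near_commute)
    qed (use B in \<open>simp add: near_commute\<close>)
    have d1x: "x0 \<notin> near p d1"
    proof (cases "d1 = c0")
      case False
      then have "valid_state p X P Q R S x0 a0 b0 c0 d1" using s0 d1 by (auto simp: valid_state_def)
      from unsolvable_basic(9)[OF unsolvable[OF this]] show ?thesis by (simp add: near_commute)
    qed (use B in \<open>simp add: near_commute\<close>)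
    \<comment> \<open>If both \<open>b0\<close> and \<open>b1\<close> were allowed on
      \<open>uy\<close>, \<open>two_unsolvable_uy\<close> would give \<open>Lu\<close> as the new
      \<open>x\<close> together with the colours near \<open>b0\<close> or \<open>b1\<close>. That
      set misses \<open>x0\<close>, which belongs to \<open>Lu\<close>.\<close>
    have "a = b0 \<or> a = b1"
    proof (rule ccontr)
      assume "\<not> ?thesis"
      then have "valid_state p X P Q R S x a b0 c d" "valid_state p X P Q R S x a b1 c d"
        using s aP b1 d QS by (auto simp: valid_state_def)
      from two_unsolvable_uy(2)[OF unsolvable[OF this(1)] unsolvable[OF this(2)]] have "x0 \<in> {x} \<union> near p b0 \<union> near p b1"
        using b1 B(11) p2 by simp
      then show False using b1x B(7) s by (auto simp: near_commute)
    qed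
    moreover have "a \<noteq> b0"
    proof
      assume ab: "a = b0"
      then have "a1 = b0" "a1 = a" using s B by auto
      then have "valid_state p X P Q R S x0 a1 b1 c0 d0" using s0 b1 a1 B by (auto simp: valid_state_def)
      from unsolvable_xy_not_uy[OF unsolvable[OF s0] unsolvable[OF this]] a1 \<open>a1 = b0\<close> show False by simp
    qed
    ultimately have ab1: "a = b1" by simp
    have a0: "a = a0"
    proof (rule ccontr)
      assume "a \<noteq> a0"
      then have a1b: "a1 = b1" "a1 = a" using s ab1 by auto
      have v: "valid_state p X P Q R S x0 a0 b1 c0 d0" using s0 b1 \<open>a \<noteq> a0\<close> ab1 by (auto simp: valid_state_def)
      note B1 = unsolvable_basic[OF unsolvable[OF v]]
      have "valid_state p X P Q R S x0 a1 b0 c0 d0" using s0 b1 a1 B1 a1b by (auto simp: valid_state_def)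
      from unsolvable_xy_not_uy[OF unsolvable[OF v] unsolvable[OF this]] a1 a1b show False by simp
    qed
    have "c = d0 \<or> c = d1"
    proof (rule ccontr)
      assume "\<not> ?thesis"
      then have "valid_state p X P Q R S x a b c d0" "valid_state p X P Q R S x a b c d1"
        using s aP b d1 QS by (auto simp: valid_state_def)
      from M.two_unsolvable_uy(2)[unfolded m, OF unsolvable[OF this(1)] unsolvable[OF this(2)]] have "x0 \<in> {x} \<union> near p d0 \<union> near p d1"
        using d1 M.unsolvable_basic(11)[unfolded m, OF unsolvable[OF s0]] p2 by simp
      then show False using d1x B(9) s by (auto simp: near_commute)
    qed
    moreover have "c \<noteq> d0"
    proof
      assume ab: "c = d0"
      then have "c1 = d0" "c1 = c" using s B by auto
      then have "valid_state p X P Q R S x0 a0 b0 c1 d1" using s0 d1 c1 B by (auto simp: valid_state_def)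
      from M.unsolvable_xy_not_uy[unfolded m, OF unsolvable[OF s0] unsolvable[OF this]] c1 \<open>c1 = d0\<close> show False by simp
    qed
    ultimately have cd1: "c = d1" by simp
    have c0: "c = c0"
    proof (rule ccontr)
      assume "c \<noteq> c0"
      then have a1b: "c1 = d1" "c1 = c" using s cd1 by auto
      have v: "valid_state p X P Q R S x0 a0 b0 c0 d1" using s0 d1 \<open>c \<noteq> c0\<close> cd1 by (auto simp: valid_state_def)
      note B1 = unsolvable_basic[OF unsolvable[OF v]]
      have "valid_state p X P Q R S x0 a0 b0 c1 d0" using s0 d1 c1 B1 a1b by (auto simp: valid_state_def)
      from M.unsolvable_xy_not_uy[unfolded m, OF unsolvable[OF v] unsolvable[OF this]] c1 a1b show False by simp
    qed
    have "valid_state p X P Q R S x a0 b0 c0 d0" using s0 s a0 c0 by (auto simp: valid_state_def)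
    from c2[OF unsolvable[OF this] unsolvable[OF s0]] s show False by simp
  qed
  obtain a1 where a1: "a1 \<in> P" "a1 \<noteq> a0" using card_ge_2_ex_other[OF cards(1)] by metis
  obtain c1 where c1: "c1 \<in> R" "c1 \<noteq> c0" using card_ge_2_ex_other[OF cards(3)] by metis
  have "a \<in> {a0, c0}" if "a \<in> P" for a using key[OF that _ c1] B by blast
  moreover have "a1 = c0" using key[OF a1 c1] a1 B by blast
  ultimately show P: "P = {a0, c0}" using a1 s0 by (auto simp: valid_state_def)
  have "c \<in> {a0, c0}" if "c \<in> R" for c using key[OF a1 that] B by blast
  moreover have "c1 = a0" using key[OF a1 c1] c1 B by blast
  ultimately show R: "R = {a0, c0}" using c1 s0 by (auto simp: valid_state_def)
  show "b \<noteq> a0 \<and> b \<noteq> c0" if "b \<in> Q" for b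
  proof
    show "b \<noteq> a0"
    proof
      assume "b = a0"
      then have "valid_state p X P Q R S x0 c0 b a0 d0" using s0 that P R B by (auto simp: valid_state_def)
      from unsolvable_basic(3)[OF unsolvable[OF this]] \<open>b = a0\<close> show False by simp
    qed
    show "b \<noteq> c0"
    proof
      assume "b = c0"
      then have "valid_state p X P Q R S x0 a0 b c0 d0" using s0 that P R B by (auto simp: valid_state_def)
      from unsolvable_basic(3)[OF unsolvable[OF this]] \<open>b = c0\<close> show False by simp
    qed
  qed
  show "x \<in> near p a0 \<union> near p c0" if "x \<in> X" "x \<noteq> x0" for x
  proof (rule ccontr)
    assume "\<not> ?thesis"
    then have "valid_state p X P Q R S x a0 b0 c0 d0" using s0 that by (auto simp: valid_state_def near_commute)
    from c2[OF unsolvable[OF this] unsolvable[OF s0]] that show False by simp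
  qed
qed

text \<open>The first outcome arises when there is no valid state: \<open>X\<close> is covered by
  two intervals of three colours, and its size makes them disjoint. In the second, tightness
  expresses all four lists through \<open>x0\<close>, \<open>g\<close>, \<open>Q\<close> and
  \<open>S\<close>; as the lists do not depend on the labelling, these data can later be recovered
  from them.\<close>

lemma (in sun_lists) stuck_p2:
  assumes p2: "p = 2" and X: "finite X" "6 \<le> card X" and cards: "2 \<le> card P" "2 \<le> card Q" "2 \<le> card R" "2 \<le> card S"
    and all: "\<forall>x a b c d. valid_state p X P Q R S x a b c d \<longrightarrow> unsolvable x a b c d"
  obtains a c where "a \<noteq> c" "P = {a, c}" "R = {a, c}" "card X = 6" "X = near 2 a \<union> near 2 c" "near 2 a \<inter> near 2 c = {}"
  | a c x0 g where "a \<noteq> c" "P = {a, c}" "R = {a, c}" "x0 \<in> X" "a \<notin> near 2 x0" "c \<notin> near 2 x0"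
     "X - {x0} \<subseteq> near 2 a \<union> near 2 c" "card Q = 2" "card S = 2" "Q \<inter> {a, c} = {}" "S \<inter> {a, c} = {}"
     "Lu = {x0} \<union> \<Union>(near 2 ` Q)" "x0 \<notin> \<Union>(near 2 ` Q)"
     "Lv = {x0} \<union> \<Union>(near 2 ` S)" "x0 \<notin> \<Union>(near 2 ` S)"
     "Le = near 2 x0 \<union> {a, c, g} \<union> Q" "(near 2 x0 \<union> {a, c, g}) \<inter> Q = {}"
     "Lf = near 2 x0 \<union> {a, c, g} \<union> S" "(near 2 x0 \<union> {a, c, g}) \<inter> S = {}" "g \<notin> near 2 x0 \<union> {a, c}"
     "card Lu = 7"
proof (cases "\<exists>x a b c d. valid_state p X P Q R S x a b c d")
  case True
  have unsolvable: "unsolvable x a b c d" if "valid_state p X P Q R S x a b c d" for x a b c d using all that by blast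
  from True obtain x0 a0 b0 c0 d0 where s0: "valid_state p X P Q R S x0 a0 b0 c0 d0" by blast
  interpret M: sun_lists p Lv Lu Lf Le by (rule mirror)
  have m: "M.unsolvable x c d a b \<longleftrightarrow> unsolvable x a b c d" for x a b c d by (simp add: solvable_mirror)
  note K = stuck_p2_from_state[OF p2 X(2) cards s0 all]
  have "\<forall>x a b c d. valid_state p X R S P Q x a b c d \<longrightarrow> M.unsolvable x a b c d"
    using unsolvable m valid_state_mirror by metis
  note K' = M.stuck_p2_from_state[OF p2 X(2) cards(3,4,1,2) s0[unfolded valid_state_mirror[of p X P]] this]
  note B = unsolvable_basic[OF unsolvable[OF s0]]
  have vb: "valid_state p X P Q R S x0 a0 b c0 d0" if "b \<in> Q" for b
    using K(3)[OF that] s0 that by (auto simp: valid_state_def)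
  have vd: "valid_state p X P Q R S x0 a0 b0 c0 d" if "d \<in> S" for d
    using K'(3)[OF that] s0 that by (auto simp: valid_state_def)
  have QS0: "b0 \<in> Q" "d0 \<in> S" using s0 by (auto simp: valid_state_def)
  obtain b1 where b1: "b1 \<in> Q" "b1 \<noteq> b0" using card_ge_2_ex_other[OF cards(2)] by metis
  obtain d1 where d1: "d1 \<in> S" "d1 \<noteq> d0" using card_ge_2_ex_other[OF cards(4)] by metis
  have b0b: "b0 \<noteq> b1" and d0d: "d0 \<noteq> d1" using b1 d1 by auto
  note C = two_unsolvable_uy[OF unsolvable[OF s0] unsolvable[OF vb[OF b1(1)]] b0b]
  note D = M.two_unsolvable_uy[unfolded m, OF unsolvable[OF s0] unsolvable[OF vd[OF d1(1)]] d0d]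
  obtain g where g: "tight p Lu Le g x0 a0 b0 c0" "tight p Lv Lf g x0 c0 d0 a0" "g \<noteq> b1" "Le = near p x0 \<union> {a0, c0, g, b0, b1}"
    using C(3) by blast
  obtain g' where g': "tight p Lv Lf g' x0 c0 d0 a0" "g' \<noteq> d1" "Lf = near p x0 \<union> {c0, a0, g', d0, d1}"
    using D(3) by blast
  have gg: "g' = g" using tight_g_unique[OF g'(1) g(2)] .
  note G = tightD[OF g(1)] and H = tightD[OF g(2)]
  have nb: "x0 \<notin> near p b" "b \<notin> near p x0" if "b \<in> Q" for b
    using unsolvable_basic(7)[OF unsolvable[OF vb[OF that]]] by (simp_all add: near_commute)
  have nd: "x0 \<notin> near p d" "d \<notin> near p x0" if "d \<in> S" for d
    using unsolvable_basic(9)[OF unsolvable[OF vd[OF that]]] by (simp_all add: near_commute)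
  have "b \<in> {b0, b1}" if bQ: "b \<in> Q" for b
  proof (rule ccontr)
    assume "b \<notin> {b0, b1}"
    then have ne: "b0 \<noteq> b" "b1 \<noteq> b" by auto
    obtain gb where gb: "tight p Lu Le gb x0 a0 b0 c0" "tight p Lv Lf gb x0 c0 d0 a0" "Le = near p x0 \<union> {a0, c0, gb, b0, b}"
      using two_unsolvable_uy(3)[OF unsolvable[OF s0] unsolvable[OF vb[OF bQ]] ne(1)] by blast
    have "gb = g" using tight_g_unique[OF gb(2) g(2)] .
    then have "b1 \<in> near p x0 \<union> {a0, c0, g, b0, b}" using g(4) gb(3) by auto
    then show False using nb[OF b1(1)] K(3)[OF b1(1)] b1 ne g(3) by auto
  qed
  then have Q: "Q = {b0, b1}" using QS0 b1 by auto
  have "d \<in> {d0, d1}" if dS: "d \<in> S" for d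
  proof (rule ccontr)
    assume "d \<notin> {d0, d1}"
    then have ne: "d0 \<noteq> d" "d1 \<noteq> d" by auto
    obtain gb where gb: "tight p Lv Lf gb x0 c0 d0 a0" "Lf = near p x0 \<union> {c0, a0, gb, d0, d}"
      using M.two_unsolvable_uy(3)[unfolded m, OF unsolvable[OF s0] unsolvable[OF vd[OF dS]] ne(1)] by blast
    have "gb = g" using tight_g_unique[OF gb(1) g(2)] .
    then have "d1 \<in> near p x0 \<union> {c0, a0, g, d0, d}" using g'(3) gb(2) by auto
    then show False using nd[OF d1(1)] K'(3)[OF d1(1)] d1 ne g'(2) gg by auto
  qed
  then have S: "S = {d0, d1}" using QS0 d1 by auto
  show thesis
  proof (rule that(2)[of a0 c0 x0 g])
    show "Lu = {x0} \<union> \<Union>(near 2 ` Q)" using C(2) p2 Q by auto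
    show "Lv = {x0} \<union> \<Union>(near 2 ` S)" using D(2) p2 S by auto
    show "Le = near 2 x0 \<union> {a0, c0, g} \<union> Q" using g(4) Q p2 by auto
    show "Lf = near 2 x0 \<union> {a0, c0, g} \<union> S" using g'(3) gg S p2 by auto
    show "X - {x0} \<subseteq> near 2 a0 \<union> near 2 c0" using K(4) p2 by blast
    show "card Q = 2" "card S = 2" using Q S b1 d1 by auto
    show "card Lu = 7" using B(13) p2 by simp
    show "(near 2 x0 \<union> {a0, c0, g}) \<inter> Q = {}"
      using nb K(3) Q G(15) g(3) p2 by auto
    show "(near 2 x0 \<union> {a0, c0, g}) \<inter> S = {}"
      using nd K'(3) S H(15) g'(2) gg p2 by auto
    show "Q \<inter> {a0, c0} = {}" "S \<inter> {a0, c0} = {}" using K(3) K'(3) by auto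
  qed (use K(1,2) B s0 p2 nb nd G(13,14,16) in \<open>auto simp: valid_state_def\<close>)
next
  case False
  have sub: "X \<subseteq> near p a \<union> near p c" if "a \<in> P" "c \<in> R" "a \<noteq> c" for a c
  proof
    fix x assume x: "x \<in> X"
    obtain b where b: "b \<in> Q" "b \<noteq> a" using card_ge_2_ex_other[OF cards(2)] by metis
    obtain d where d: "d \<in> S" "d \<noteq> c" using card_ge_2_ex_other[OF cards(4)] by metis
    have "\<not> valid_state p X P Q R S x a b c d" using False by blast
    then show "x \<in> near p a \<union> near p c" using that x b d by (auto simp: valid_state_def near_commute[of _ p x])
  qed
  have eq: "X = near 2 a \<union> near 2 c" "card X = 6" "near 2 a \<inter> near 2 c = {}" if "a \<in> P" "c \<in> R" "a \<noteq> c" for a c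
  proof -
    have c: "card (near 2 a \<union> near 2 c) + card (near 2 a \<inter> near 2 c) = 6"
      using card_Un_Int[of "near 2 a" "near 2 c"] by (simp add: card_near)
    have "card X \<le> card (near 2 a \<union> near 2 c)" using sub[OF that] p2 by (intro card_mono) auto
    then have "card (near 2 a \<union> near 2 c) = 6" "card X = 6" "card (near 2 a \<inter> near 2 c) = 0" using c X by linarith+
    then show "X = near 2 a \<union> near 2 c" "card X = 6" "near 2 a \<inter> near 2 c = {}"
      using card_subset_eq[of "near 2 a \<union> near 2 c" X] sub[OF that] p2 by auto
  qed
  obtain a where a: "a \<in> P" using cards(1) by fastforce
  obtain c where c: "c \<in> R" "c \<noteq> a" using card_ge_2_ex_other[OF cards(3)] by metis
  note E = eq[OF a c(1) c(2)[symmetric]]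
  have "a' \<in> {a, c}" if "a' \<in> P" for a'
  proof (rule ccontr)
    \<comment> \<open>The part of \<open>X\<close> not near \<open>c\<close> would be both
      \<open>near 2 a\<close> and \<open>near 2 a'\<close>.\<close>
    assume n: "a' \<notin> {a, c}"
    then have "a' \<noteq> c" by simp
    note E' = eq[OF that c(1) this]
    have "near 2 a' \<subseteq> near 2 a" using E(1) E'(1,3) by blast
    then show False using near_eqD[of 2 a' a] n by simp
  qed
  then have P: "P \<subseteq> {a, c}" by blast
  have "c' \<in> {a, c}" if "c' \<in> R" for c'
  proof (rule ccontr)
    assume n: "c' \<notin> {a, c}"
    then have "a \<noteq> c'" by auto
    note E' = eq[OF a that this]
    have "near 2 c' \<subseteq> near 2 c" using E(1) E'(1,3) by blast
    then show False using near_eqD[of 2 c' c] n by simp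
  qed
  then have R: "R \<subseteq> {a, c}" by blast
  have "P = {a, c}" "R = {a, c}"
    using card_seteq[OF _ P] card_seteq[OF _ R] cards c by auto
  then show thesis using that(1)[of a c] E c by auto
qed

text \<open>
  Two suns share the vertex \<open>y\<close>. The second one uses the colour \<open>a'\<close> on \<open>x'y\<close> and tolerates every colour
  except \<open>b'\<close> on \<open>u'y\<close>, whose available colours are \<open>Q2\<close>; it is called \<open>\<beta>\<close> in the conclusion.
\<close>

lemma (in sun_lists) solvable_p3:
  assumes p3: "p = 3" and X: "finite X" "9 \<le> card X"
    and cards: "4 \<le> card P" "4 \<le> card Q" "4 \<le> card Q2" "2 \<le> card R" "2 \<le> card S"
    and s0: "x0 \<in> X" "a0 \<in> P" "c0 \<in> R" "d0 \<in> S" "a0 \<noteq> a'" "a0 \<noteq> c0" "c0 \<noteq> d0" "a0 \<notin> near p x0" "c0 \<notin> near p x0"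
  shows "\<exists>x a b c d \<beta>. valid_state p X P Q R S x a b c d \<and> solvable p Lu Lv Le Lf x a b c d \<and>
    \<beta> \<in> Q2 \<and> a \<noteq> a' \<and> b \<noteq> a' \<and> \<beta> \<notin> {a, b, a', b'}"
proof (rule ccontr)
  assume no: "\<not> ?thesis"
  interpret M: sun_lists p Lv Lu Lf Le by (rule mirror)
  have m: "M.unsolvable x c d a b \<longleftrightarrow> unsolvable x a b c d" for x a b c d by (simp add: solvable_mirror)
  define q where "q x a c d \<longleftrightarrow> x \<in> X \<and> a \<in> P \<and> c \<in> R \<and> d \<in> S \<and> a \<noteq> a' \<and> a \<noteq> c \<and> c \<noteq> d \<and> a \<notin> near p x \<and> c \<notin> near p x"
    for x a c d
  have q0: "q x0 a0 c0 d0" using s0 by (simp add: q_def)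
  have U: "unsolvable x a b c d" if "q x a c d" "b \<in> Q" "b \<noteq> a" "b \<noteq> a'" "\<beta> \<in> Q2" "\<beta> \<notin> {a, b, a', b'}" for x a b c d \<beta>
    using no that unfolding q_def valid_state_def by metis
  have c1: "b = \<beta>" if "unsolvable x a b c d" "unsolvable x a \<beta> c d" for x a b \<beta> c d
    using two_unsolvable_uy(1)[OF that] p3 by auto
  have fin: "finite P" "finite Q" "finite Q2" "finite R" "finite S"
    using cards by (auto intro: card_ge_0_finite)
  \<comment> \<open>Two unsolvable colours for \<open>uy\<close> are impossible as p = 3. Any
    surplus in \<open>Q\<close> or in \<open>Q2\<close> would allow a second one, so the lower
    bounds 4 - 2 and 4 - 3 are attained.\<close>
  have A: "\<exists>r b. Q2 - {a, a', b'} = {r} \<and> b \<noteq> r \<and> Q - {a, a'} = {r, b} \<and> unsolvable x a b c d"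
    if qq: "q x a c d" for x a c d
  proof -
    have "card {a, a', b'} \<le> 3" by (rule card3_le)
    then have "1 \<le> card (Q2 - {a, a', b'})" using cards by (intro card_Diff_ge[of _ 3]) auto
    then have "Q2 - {a, a', b'} \<noteq> {}" by (metis card.empty not_one_le_zero)
    then obtain r where r: "r \<in> Q2 - {a, a', b'}" by blast
    have "card {a, a'} \<le> 2" by (simp add: card_insert_if)
    then have Q': "2 \<le> card (Q - {a, a'})" using cards by (intro card_Diff_ge[of _ 2]) auto
    then obtain b where b: "b \<in> Q - {a, a'}" "b \<noteq> r" using card_ge_2_ex_other by metis
    have ub: "unsolvable x a b c d" using U[OF qq, of b r] r b by auto
    have r': "r' = r" if r'': "r' \<in> Q2 - {a, a', b'}" for r'
    proof (rule ccontr)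
      assume "r' \<noteq> r"
      obtain b2 where b2: "b2 \<in> Q - {a, a'}" "b2 \<noteq> b" using card_ge_2_ex_other[OF Q'] by metis
      have "unsolvable x a b2 c d" using U[OF qq, of b2 r] U[OF qq, of b2 r'] r r'' b2 \<open>r' \<noteq> r\<close> by auto
      then show False using c1[OF ub] b2 by simp
    qed
    have "b2 \<in> {r, b}" if b2: "b2 \<in> Q - {a, a'}" for b2
    proof (rule ccontr)
      assume n: "b2 \<notin> {r, b}"
      have "unsolvable x a b2 c d" using U[OF qq, of b2 r] r b2 n by auto
      then show False using c1[OF ub] n by simp
    qed
    then have "Q - {a, a'} \<subseteq> {r, b}" by blast
    then have "Q - {a, a'} = {r, b}" using card_seteq[of "{r, b}" "Q - {a, a'}"] Q' b by auto
    then show ?thesis using r r' b ub by blast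
  qed
  from A[OF q0] obtain r b0 where r: "Q2 - {a0, a', b'} = {r}" "b0 \<noteq> r" "Q - {a0, a'} = {r, b0}" by blast
  have "Q2 \<subseteq> {a0, a', b', r}" using r by blast
  moreover have "card {a0, a', b', r} \<le> 4" by (simp add: card_insert_if)
  ultimately have Q2: "Q2 = {a0, a', b', r}" "card {a0, a', b', r} = 4"
    using card_seteq[of "{a0, a', b', r}" Q2] cards card_mono[of "{a0, a', b', r}" Q2] by auto
  have "Q \<subseteq> {a0, a', r, b0}" using r by blast
  moreover have "card {a0, a', r, b0} \<le> 4" by (simp add: card_insert_if)
  ultimately have Q: "Q = {a0, a', r, b0}" "card {a0, a', r, b0} = 4"
    using card_seteq[of "{a0, a', r, b0}" Q] cards card_mono[of "{a0, a', r, b0}" Q] by auto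
  have dist: "a0 \<noteq> a'" "a0 \<noteq> b'" "a0 \<noteq> r" "a' \<noteq> b'" "a' \<noteq> r" "b' \<noteq> r" "a0 \<noteq> b0" "a' \<noteq> b0"
    using Q2(2) Q(2) by (auto simp: card_insert_if split: if_splits)
  \<comment> \<open>The colour forced on \<open>uy\<close> is the same \<open>b0\<close> in every
    state, so states may from here on be compared without mentioning it.\<close>
  have ub: "unsolvable x a b0 c d" if qq: "q x a c d" for x a c d
  proof -
    obtain r' b where r': "Q2 - {a, a', b'} = {r'}" "b \<noteq> r'" "Q - {a, a'} = {r', b}" "unsolvable x a b c d"
      using A[OF qq] by blast
    have "b = b0"
    proof (cases "a = a0")
      case True
      then have "r' = r" using r r' by auto
      then show ?thesis using r r' True by (auto simp: doubleton_eq_iff)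
    next
      case False
      then have "a0 \<in> {r'}" using r'(1) Q2(1) dist by blast
      then have "r' = a0" by simp
      moreover have "r \<notin> {r'}" using dist \<open>r' = a0\<close> by simp
      then have "r = a" using r'(1) Q2(1) dist by blast
      ultimately have "b0 \<in> {a0, b}" using r'(3) Q(1) dist r(2) by blast
      then show ?thesis using dist by simp
    qed
    then show ?thesis using r' by simp
  qed
  have d1: "d = e" if "q x a c d" "q x a c e" for x a c d e
    using M.two_unsolvable_uy(1)[unfolded m, OF ub[OF that(1)] ub[OF that(2)]] p3 by auto
  have x1: "x = y" if "q x a c d" "q y a c d" for x y a c d
    using unsolvable_x_unique[OF ub[OF that(1)] ub[OF that(2)]] p3 by simp
  note B = unsolvable_basic[OF ub[OF q0]]
  obtain g1 where g1: "g1 \<in> R" "g1 \<noteq> c0" using card_ge_2_ex_other[OF cards(4)] by metis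
  obtain d1' where d1': "d1' \<in> S" "d1' \<noteq> d0" using card_ge_2_ex_other[OF cards(5)] by metis
  have "d1' = c0"
  proof (rule ccontr)
    assume "d1' \<noteq> c0"
    then have "q x0 a0 c0 d1'" using q0 d1' by (auto simp: q_def)
    from d1[OF q0 this] d1' show False by simp
  qed
  then have cS: "c0 \<in> S" using d1' by simp
  have "g1 \<noteq> d0"
  proof
    assume "g1 = d0"
    then have "q x0 a0 g1 c0" using q0 cS g1 B by (auto simp: q_def)
    from M.unsolvable_xy_not_uy[unfolded m, OF ub[OF q0] ub[OF this]] g1 \<open>g1 = d0\<close> show False by simp
  qed
  \<comment> \<open>With \<open>g1\<close> on \<open>xz\<close> both \<open>c0\<close> and
    \<open>d0\<close> would be allowed on \<open>vz\<close>, and two unsolvable states would differ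
    there only. So no such state exists at all.\<close>
  have cov: "x \<in> near p a \<union> near p g1" if "x \<in> X" "a \<in> P" "a \<noteq> a'" "a \<noteq> g1" for x a
  proof (rule ccontr)
    assume "\<not> ?thesis"
    then have "q x a g1 c0" "q x a g1 d0" using that g1 cS q0 \<open>g1 \<noteq> d0\<close> by (auto simp: q_def near_commute)
    from d1[OF this] show False using q0 by (simp add: q_def)
  qed
  \<comment> \<open>\<open>Y\<close> has at least 9 - 5 elements, and every colour of
    \<open>P - {a', g1}\<close> is bad for it, so by \<open>bad_card\<close> there are at most two
    such colours. This forces \<open>g1 \<in> P\<close> and \<open>card Y = 4\<close>.\<close>
  define Y where "Y = X - near p g1"
  have cn: "card (near p z) = 5" for z using p3 by (simp add: card_near)
  have Y4: "4 \<le> card Y" unfolding Y_def using X cn by (intro card_Diff_ge[of _ 5]) auto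
  then have Yf: "finite Y" "Y \<noteq> {}" by (auto intro: card_ge_0_finite)
  have sub: "P - {a', g1} \<subseteq> bad p Y" using cov by (auto simp: bad_def Y_def)
  have "card (P - {a', g1}) \<le> card (bad p Y)" using bad_card[OF Yf, of p] by (intro card_mono sub) auto
  then have b2: "card (P - {a', g1}) \<le> 6 - card Y" using bad_card[OF Yf, of p] p3 by linarith
  have "card {a', g1} \<le> 2" by (simp add: card_insert_if)
  then have P2: "2 \<le> card (P - {a', g1})" using cards by (intro card_Diff_ge[of _ 2]) auto
  have g1P: "g1 \<in> P \<and> g1 \<noteq> a'"
  proof (rule ccontr)
    assume "\<not> ?thesis"
    then have "P - {a', g1} = P - {a'}" by auto
    moreover have "3 \<le> card (P - {a'})" using cards by (intro card_Diff_ge[of _ 1]) auto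
    ultimately show False using b2 Y4 by auto
  qed
  have cY: "card Y = 4" using b2 P2 Y4 by linarith
  obtain s where s: "s \<in> P - {a', g1}" "s \<noteq> c0" using card_ge_2_ex_other[OF P2] by metis
  have Ys: "Y \<subseteq> near p s" using sub s by (auto simp: bad_def)
  \<comment> \<open>Two such colours would give unsolvable states that differ only at
    \<open>x\<close>.\<close>
  have at_most: "card (X - near p a - near p c0) \<le> 1" if "a \<in> P" "a \<noteq> a'" "a \<noteq> c0" for a
  proof -
    have "x = y" if "x \<in> X - near p a - near p c0" "y \<in> X - near p a - near p c0" for x y
    proof -
      have "q x a c0 d0" "q y a c0 d0" using that \<open>a \<in> P\<close> \<open>a \<noteq> a'\<close> \<open>a \<noteq> c0\<close> q0 by (auto simp: q_def near_commute)
      then show ?thesis by (rule x1)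
    qed
    then show ?thesis using X by (auto simp: card_le_Suc0_iff_eq)
  qed
  have "card (Y - near p c0) \<le> 1" using at_most[of g1] g1P g1 by (simp add: Y_def)
  then have Y3: "3 \<le> card (Y \<inter> near p c0)" using card_Int_Diff[OF Yf(1), of "near p c0"] cY by linarith
  \<comment> \<open>The five colours near \<open>g1\<close> are now counted:
    \<open>near p c0\<close> already contains three elements of \<open>Y\<close> and takes at most
    2, \<open>near p s\<close> contains all four and takes at most 1, and at most 1 is outside both
    by \<open>at_most\<close>; these are only 4.\<close>
  have split: "card A + card B \<le> 5" if "A \<subseteq> near p z" "B \<subseteq> near p z" "A \<inter> B = {}" for A B z
  proof -
    have "card A + card B = card (A \<union> B)" using that by (intro card_Un_disjoint[symmetric]) (auto intro: finite_subset[OF _ finite_near])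
    also have "\<dots> \<le> card (near p z)" using that by (intro card_mono) auto
    finally show ?thesis by (simp add: cn)
  qed
  have "Y \<inter> near p g1 = {}" by (auto simp: Y_def)
  then have "near p g1 \<inter> near p c0 \<inter> (Y \<inter> near p c0) = {}" "near p g1 \<inter> near p s \<inter> Y = {}" by blast+
  then have "card (near p g1 \<inter> near p c0) \<le> 2" "card (near p g1 \<inter> near p s) \<le> 1"
    using split[of "near p g1 \<inter> near p c0" c0 "Y \<inter> near p c0"] Y3 split[of "near p g1 \<inter> near p s" s Y] Ys cY
    by simp_all
  moreover have "card (near p g1 - near p s - near p c0) \<le> 1"
  proof -
    have "card (X - Y) = card X - card Y" using X by (intro card_Diff_subset) (auto simp: Y_def)
    then have "card (near p g1) \<le> card (X - Y)" using X cn cY by simp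
    then have "X - Y = near p g1" by (intro card_seteq) (auto simp: Y_def)
    then have "near p g1 - near p s - near p c0 \<subseteq> X - near p s - near p c0" by blast
    then have "card (near p g1 - near p s - near p c0) \<le> card (X - near p s - near p c0)"
      using X by (intro card_mono) auto
    then show ?thesis using at_most[of s] s by auto
  qed
  moreover have "near p g1 \<subseteq> (near p g1 \<inter> near p c0) \<union> (near p g1 \<inter> near p s) \<union> (near p g1 - near p s - near p c0)" by blast
  then have "card (near p g1) \<le> card ((near p g1 \<inter> near p c0) \<union> (near p g1 \<inter> near p s) \<union> (near p g1 - near p s - near p c0))"
    by (intro card_mono) auto
  then have "card (near p g1) \<le> card (near p g1 \<inter> near p c0) + card (near p g1 \<inter> near p s) + card (near p g1 - near p s - near p c0)"
    by (meson add_le_mono1 card_Un_le order_trans)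
  ultimately show False using cn[of g1] by linarith
qed

section \<open>Extending labellings\<close>

text \<open>Total functions \<open>f\<close> and \<open>h\<close> serve for every edge set, so a
  labelling restricts to a subgraph without change.\<close>

definition lab :: "nat \<Rightarrow> 'a set set \<Rightarrow> ('a \<Rightarrow> int) \<Rightarrow> ('a set \<Rightarrow> int) \<Rightarrow> bool" where
  "lab p E f h \<longleftrightarrow> (\<forall>u v. adj E u v \<longrightarrow> f u \<noteq> f v) \<and> (\<forall>w. inj_on h (inc E w)) \<and>
     (\<forall>e\<in>E. \<forall>u\<in>e. f u \<notin> near p (h e))"

definition two_sets :: "'a set set \<Rightarrow> bool" where
  "two_sets E \<longleftrightarrow> (\<forall>e\<in>E. \<exists>u v. e = {u, v} \<and> u \<noteq> v)"

lemma lab_mono: "lab p E f h \<Longrightarrow> E' \<subseteq> E \<Longrightarrow> lab p E' f h"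
  unfolding lab_def adj_def inc_def by (blast intro: inj_on_subset)

lemma two_sets_mono: "two_sets E \<Longrightarrow> E' \<subseteq> E \<Longrightarrow> two_sets E'"
  unfolding two_sets_def by blast

lemma two_sets_not_adj_self:
  assumes "two_sets E" shows "\<not> adj E x x"
proof
  assume "adj E x x"
  then have "{x} \<in> E" by (simp add: adj_def)
  then obtain u v where "{x} = {u, v}" "u \<noteq> v" using assms unfolding two_sets_def by blast
  then show False by auto
qed

lemma inc_eq_image:
  assumes "two_sets E" shows "inc E v = (\<lambda>w. {v, w}) ` nbr E v"
proof
  show "inc E v \<subseteq> (\<lambda>w. {v, w}) ` nbr E v"
  proof
    fix e assume "e \<in> inc E v"
    then have e: "e \<in> E" "v \<in> e" by (auto simp: inc_def)
    then obtain a b where "e = {a, b}" using assms unfolding two_sets_def by blast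
    then obtain w where "e = {v, w}" using e(2) by blast
    then show "e \<in> (\<lambda>w. {v, w}) ` nbr E v" using e by (auto simp: nbr_def adj_def)
  qed
qed (auto simp: inc_def nbr_def adj_def)

lemma card_inc: "two_sets E \<Longrightarrow> card (inc E v) = card (nbr E v)"
  by (simp add: inc_eq_image card_image inj_on_def doubleton_eq_iff)

text \<open>The recoloured edges \<open>M\<close> are exactly those that meet the recoloured
  vertices \<open>W\<close>, so new conflicts can arise only at elements of \<open>W\<close> and
  \<open>M\<close> and at the ends of edges in \<open>M\<close>.\<close>

lemma lab_extend:
  assumes lab: "lab p (E - M) f h"
    and touch: "\<And>e. e \<in> E \<Longrightarrow> e \<inter> W \<noteq> {} \<longleftrightarrow> e \<in> M"
    and f': "\<And>w. w \<notin> W \<Longrightarrow> f' w = f w" and h': "\<And>e. e \<notin> M \<Longrightarrow> h' e = h e"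
    and 1: "\<And>w t. w \<in> W \<Longrightarrow> adj E w t \<Longrightarrow> f' w \<noteq> f' t"
    and 2: "\<And>w. w \<in> \<Union>M \<Longrightarrow> inj_on h' (inc E w)"
    and 3: "\<And>e s. e \<in> M \<Longrightarrow> e \<in> E \<Longrightarrow> s \<in> e \<Longrightarrow> f' s \<notin> near p (h' e)"
  shows "lab p E f' h'"
  unfolding lab_def
proof (intro conjI allI ballI impI)
  fix u v assume a: "adj E u v"
  show "f' u \<noteq> f' v"
  proof (cases "u \<in> W \<or> v \<in> W")
    case True
    then show ?thesis using 1[of u v] 1[of v u] a adj_commute[of E u v] by auto
  next
    case False
    then have "{u, v} \<notin> M" using touch[of "{u, v}"] a by (auto simp: adj_def)
    then have "adj (E - M) u v" using a by (simp add: adj_def)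
    then show ?thesis using lab f' False unfolding lab_def by metis
  qed
next
  fix w
  show "inj_on h' (inc E w)"
  proof (cases "w \<in> \<Union>M")
    case False
    then have "inc E w = inc (E - M) w" and "\<And>e. e \<in> inc E w \<Longrightarrow> h' e = h e" using h' by (auto simp: inc_def)
    moreover have "inj_on h (inc (E - M) w)" using lab by (simp add: lab_def)
    ultimately show ?thesis by (metis inj_on_cong)
  qed (rule 2)
next
  fix e u assume e: "e \<in> E" "u \<in> e"
  show "f' u \<notin> near p (h' e)"
  proof (cases "e \<in> M")
    case False
    then have "u \<notin> W" using touch[OF e(1)] e by blast
    then show ?thesis using False e lab f' h' unfolding lab_def by auto
  qed (use 3 e in blast)
qed

lemma inj_on_new2:
  assumes "inj_on h R" "\<And>e. e \<in> R \<Longrightarrow> h' e = h e" "h' a \<notin> h ` R" "h' b \<notin> h ` R" "h' a \<noteq> h' b"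
  shows "inj_on h' (insert a (insert b R))"
proof -
  have "inj_on h' R" using assms(1,2) by (metis inj_on_cong)
  moreover have "h' ` R = h ` R" using assms(2) by simp
  ultimately show ?thesis using assms(3-5) unfolding inj_on_insert by blast
qed

lemma inj_on_new:
  assumes "inj_on h R" "\<And>e. e \<in> R \<Longrightarrow> h' e = h e" "h' a \<notin> h ` R"
  shows "inj_on h' (insert a R)"
proof -
  have "inj_on h' R" using assms(1,2) by (metis inj_on_cong)
  moreover have "h' ` R = h ` R" using assms(2) by simp
  ultimately show ?thesis using assms(3) unfolding inj_on_insert by blast
qed

text \<open>Every element of the type gets a list of full size, so that one family of lists
  accompanies all subgraphs in the induction.\<close>

locale listing =
  fixes p D :: nat and LV :: "'a \<Rightarrow> int set" and LE :: "'a set \<Rightarrow> int set"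
  assumes p: "p \<ge> 1" and D: "D \<ge> p + 3"
    and LV: "\<And>v. card (LV v) = D + 2 * p - 1" and LE: "\<And>e. card (LE e) = D + 2 * p - 1"
begin

definition on_lists :: "('a \<Rightarrow> int) \<Rightarrow> ('a set \<Rightarrow> int) \<Rightarrow> bool" where
  "on_lists f h \<longleftrightarrow> (\<forall>v. f v \<in> LV v) \<and> (\<forall>e. h e \<in> LE e)"

definition labelable :: "'a set set \<Rightarrow> bool" where
  "labelable E \<longleftrightarrow> (\<exists>f h. lab p E f h \<and> on_lists f h)"

definition graph :: "'a set set \<Rightarrow> bool" where
  "graph E \<longleftrightarrow> finite E \<and> two_sets E \<and> (\<forall>v. card (inc E v) \<le> D)"

lemma finLV [simp]: "finite (LV v)" and finLE [simp]: "finite (LE e)"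
  using LV[of v] LE[of e] p D by (auto intro: card_ge_0_finite)

lemma finite_inc: "graph E \<Longrightarrow> finite (inc E v)"
  by (simp add: graph_def inc_def)

lemma graph_mono: "graph E \<Longrightarrow> E' \<subseteq> E \<Longrightarrow> graph E'"
proof -
  assume g: "graph E" and s: "E' \<subseteq> E"
  have "card (inc E' v) \<le> D" for v
  proof -
    have "card (inc E' v) \<le> card (inc E v)" using g s by (intro card_mono finite_inc) (auto simp: inc_def)
    then show ?thesis using g unfolding graph_def by (metis le_trans)
  qed
  then show "graph E'" using g s two_sets_mono finite_subset unfolding graph_def by metis
qed

text \<open>Of D + 2p - 1 colours at most 2p - 1 are near \<open>a\<close> and at most
  \<open>n\<close> lie in \<open>F\<close>.\<close>

lemma avail_card:
  assumes "card L = D + 2 * p - 1" "finite F" "card F \<le> n"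
  shows "D - n \<le> card (L - near p a - F)"
proof -
  have c: "card (near p a \<union> F) \<le> (2 * p - 1) + n"
    using card_Un_le[of "near p a" F] assms(3) by (simp add: card_near)
  have "L - near p a - F = L - (near p a \<union> F)" by auto
  moreover have "D - n \<le> card (L - (near p a \<union> F))"
  proof (cases "n \<le> D")
    case True
    then show ?thesis using c assms p by (intro card_Diff_ge[OF _ c]) auto
  qed simp
  ultimately show ?thesis by simp
qed

text \<open>The edge is coloured before \<open>u\<close>: it keeps at least D - (D - 1) colours, and
  then \<open>u\<close> keeps at least D - 1.\<close>

lemma pendant_labelable:
  assumes g: "graph E" and n: "nbr E u = {v}" and IH: "labelable (E - {{u, v}})"
  shows "labelable E"
proof -
  have t: "two_sets E" using g by (simp add: graph_def)
  let ?e = "{u, v}"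
  have uv: "u \<noteq> v" using two_sets_not_adj_self[OF t, of u] n by (auto simp: nbr_def)
  have e: "?e \<in> E" using n by (auto simp: nbr_def adj_def)
  have iu: "inc E u = {?e}" using inc_eq_image[OF t, of u] n by simp
  obtain f h where fh: "lab p (E - {?e}) f h" "on_lists f h" using IH by (auto simp: labelable_def)
  have fi: "finite (inc E v - {?e})" using finite_inc[OF g] by simp
  have "card (inc E v - {?e}) = card (inc E v) - 1" using e by (simp add: inc_def)
  then have "card (inc E v - {?e}) \<le> D - 1" using g unfolding graph_def by (metis diff_le_mono)
  then have "card (h ` (inc E v - {?e})) \<le> D - 1" using card_image_le[OF fi, of h] by linarith
  then have "D - (D - 1) \<le> card (LE ?e - near p (f v) - h ` (inc E v - {?e}))"
    using fi by (intro avail_card LE) auto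
  then have "LE ?e - near p (f v) - h ` (inc E v - {?e}) \<noteq> {}" using D by fastforce
  then obtain a where a: "a \<in> LE ?e" "a \<notin> near p (f v)" "a \<notin> h ` (inc E v - {?e})" by blast
  have "D - 1 \<le> card (LV u - near p a - {f v})" by (intro avail_card LV) auto
  then have "LV u - near p a - {f v} \<noteq> {}" using D by fastforce
  then obtain b where b: "b \<in> LV u" "b \<notin> near p a" "b \<noteq> f v" by blast
  have "lab p E (f(u := b)) (h(?e := a))"
  proof (rule lab_extend[OF fh(1), of "{u}"])
    show "e \<inter> {u} \<noteq> {} \<longleftrightarrow> e \<in> {?e}" if "e \<in> E" for e using iu that by (auto simp: inc_def)
    show "(f(u := b)) w \<noteq> (f(u := b)) t" if "w \<in> {u}" "adj E w t" for w t
    proof -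
      have "t = v" using that n by (auto simp: nbr_def)
      then show ?thesis using that b uv by auto
    qed
    show "inj_on (h(?e := a)) (inc E w)" if "w \<in> \<Union>{?e}" for w
    proof -
      have "w = u \<or> w = v" using that by auto
      then show ?thesis
      proof
        assume "w = v"
        have ins: "inc E v = insert ?e (inc E v - {?e})" using e by (auto simp: inc_def)
        have "inj_on h (inc (E - {?e}) v)" using fh by (simp add: lab_def)
        moreover have "inc (E - {?e}) v = inc E v - {?e}" by (auto simp: inc_def)
        ultimately show ?thesis using a(3) unfolding \<open>w = v\<close> by (subst ins, intro inj_on_new[of h]) auto
      qed (simp add: iu)
    qed
    show "(f(u := b)) s \<notin> near p ((h(?e := a)) e)" if "e \<in> {?e}" "e \<in> E" "s \<in> e" for e s
      using that a b uv by (auto simp: near_commute)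
  qed auto
  moreover have "on_lists (f(u := b)) (h(?e := a))" using fh(2) a b by (simp add: on_lists_def)
  ultimately show ?thesis by (auto simp: labelable_def)
qed

text \<open>The vertex \<open>u\<close> is uncoloured along with the edge. The edge keeps D - 3
  \<ge> p colours and \<open>u\<close> keeps D - 2 \<ge> p + 1, so \<open>far_pair\<close>
  applies.\<close>

lemma light_labelable:
  assumes g: "graph E" and uv: "adj E u v" and nu: "card (nbr E u) = 2" and nv: "card (nbr E v) \<le> 3"
    and IH: "labelable (E - {{u, v}})"
  shows "labelable E"
proof -
  have t: "two_sets E" using g by (simp add: graph_def)
  let ?e = "{u, v}"
  have e: "?e \<in> E" using uv by (simp add: adj_def)
  have une: "u \<noteq> v" using two_sets_not_adj_self[OF t, of u] uv by auto
  have "v \<in> nbr E u" using uv by (simp add: nbr_def)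
  then obtain w where n: "nbr E u = {v, w}" "w \<noteq> v" using nu unfolding card_2_iff by (metis insert_commute insertE singletonD)
  have uw: "u \<noteq> w" using two_sets_not_adj_self[OF t, of u] n by (auto simp: nbr_def)
  let ?d = "{u, w}"
  have iu: "inc E u = {?e, ?d}" using inc_eq_image[OF t, of u] n by simp
  have de: "?d \<noteq> ?e" "?d \<in> E" using n iu by (auto simp: doubleton_eq_iff inc_def)
  obtain f h where fh: "lab p (E - {?e}) f h" "on_lists f h" using IH by (auto simp: labelable_def)
  let ?F = "insert (h ?d) (h ` (inc E v - {?e}))"
  have fi: "finite (inc E v - {?e})" using finite_inc[OF g] by simp
  have "card (inc E v - {?e}) = card (inc E v) - 1" using e by (simp add: inc_def)
  then have "card (inc E v - {?e}) \<le> 2" using nv card_inc[OF t, of v] by simp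
  then have "card (h ` (inc E v - {?e})) \<le> 2" using card_image_le[OF fi, of h] by linarith
  then have "card ?F \<le> 3" using card_insert_le_m1[of 3 "h ` (inc E v - {?e})" "h ?d"] by simp
  then have "D - 3 \<le> card (LE ?e - near p (f v) - ?F)" using fi by (intro avail_card LE) auto
  moreover have "D - 2 \<le> card (LV u - near p (h ?d) - {f v, f w})"
    by (intro avail_card LV) (auto simp: card_insert_if)
  ultimately obtain b a where ab: "b \<in> LV u - near p (h ?d) - {f v, f w}" "a \<in> LE ?e - near p (f v) - ?F" "b \<notin> near p a"
    using far_pair[of "LV u - near p (h ?d) - {f v, f w}" p "LE ?e - near p (f v) - ?F"] D p by force
  have "lab p (E - {?e, ?d}) f h" using fh(1) by (rule lab_mono) auto
  then have "lab p E (f(u := b)) (h(?e := a))"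
  proof (rule lab_extend[where W = "{u}"])
    show "e \<inter> {u} \<noteq> {} \<longleftrightarrow> e \<in> {?e, ?d}" if "e \<in> E" for e using iu that by (auto simp: inc_def)
    show "(f(u := b)) s \<noteq> (f(u := b)) t" if "s \<in> {u}" "adj E s t" for s t
    proof -
      have "t = v \<or> t = w" using that n by (auto simp: nbr_def)
      then show ?thesis using that ab une uw by auto
    qed
    show "inj_on (h(?e := a)) (inc E s)" if "s \<in> \<Union>{?e, ?d}" for s
    proof -
      have i: "inj_on h (inc E s - {?e})"
      proof -
        have "inj_on h (inc (E - {?e}) s)" using fh by (simp add: lab_def)
        moreover have "inc (E - {?e}) s = inc E s - {?e}" by (auto simp: inc_def)
        ultimately show ?thesis by simp
      qed
      have ai: "a \<notin> h ` (inc E s - {?e})" if "s = u \<or> s = v"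
        using that ab iu de by auto
      show ?thesis
      proof (cases "s = u \<or> s = v")
        case True
        have "inj_on (h(?e := a)) (insert ?e (inc E s - {?e}))"
          by (rule inj_on_new[OF i]) (use ai[OF True] in auto)
        moreover have "insert ?e (inc E s - {?e}) = inc E s" using True e by (auto simp: inc_def)
        ultimately show ?thesis by simp
      next
        case False
        then have "inc E s - {?e} = inc E s" by (auto simp: inc_def)
        moreover have "?e \<notin> inc E s" using False by (auto simp: inc_def)
        ultimately show ?thesis using i by (metis inj_on_cong fun_upd_other)
      qed
    qed
    show "(f(u := b)) s \<notin> near p ((h(?e := a)) e)" if "e \<in> {?e, ?d}" "e \<in> E" "s \<in> e" for e s
    proof -
      have "f w \<notin> near p (h ?d)" using fh(1) de by (auto simp: lab_def)
      then show ?thesis using that ab une uw de by (auto simp: near_commute)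
    qed
  qed auto
  moreover have "on_lists (f(u := b)) (h(?e := a))" using fh(2) ab by (simp add: on_lists_def)
  ultimately show ?thesis by (auto simp: labelable_def)
qed

section \<open>Suns in a labelled graph\<close>

definition sun_edges :: "'a \<Rightarrow> 'a \<Rightarrow> 'a \<Rightarrow> 'a \<Rightarrow> 'a \<Rightarrow> 'a set set" where
  "sun_edges x u v y z = {{x, u}, {x, v}, {x, y}, {u, y}, {x, z}, {v, z}}"

definition rest :: "'a set set \<Rightarrow> 'a \<Rightarrow> 'a \<Rightarrow> 'a \<Rightarrow> 'a set set" where
  "rest E y x u = inc E y - {{x, y}, {u, y}}"

text \<open>The colours for a sun edge \<open>e\<close> at \<open>y\<close> that fit the colour of
  \<open>y\<close> and the edges at \<open>y\<close> outside the sun; conflicts within the sun are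
  left to \<open>valid_state\<close>.\<close>

definition avail :: "'a set set \<Rightarrow> ('a \<Rightarrow> int) \<Rightarrow> ('a set \<Rightarrow> int) \<Rightarrow> 'a \<Rightarrow> 'a \<Rightarrow> 'a \<Rightarrow> 'a set \<Rightarrow> int set" where
  "avail E f h y x u e = LE e - near p (f y) - h ` rest E y x u"

abbreviation sun_valid where
  "sun_valid E f h x u v y z \<equiv> valid_state p (LV x - {f y, f z}) (avail E f h y x u {x, y}) (avail E f h y x u {u, y})
     (avail E f h z x v {x, z}) (avail E f h z x v {v, z})"

abbreviation sun_solvable where
  "sun_solvable f x u v y z \<equiv> solvable p (LV u - {f y}) (LV v - {f z}) (LE {x, u}) (LE {x, v})"

lemma sun_inc:
  assumes g: "graph E" and s: "sun E x u v y z"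
  shows "inc E x = {{x, u}, {x, v}, {x, y}, {x, z}}" "inc E u = {{x, u}, {u, y}}" "inc E v = {{x, v}, {v, z}}"
    "{x, y} \<in> inc E y" "{u, y} \<in> inc E y" "{x, z} \<in> inc E z" "{v, z} \<in> inc E z" "sun_edges x u v y z \<subseteq> E"
proof -
  have t: "two_sets E" using g by (simp add: graph_def)
  show i: "inc E x = {{x, u}, {x, v}, {x, y}, {x, z}}" "inc E u = {{x, u}, {u, y}}" "inc E v = {{x, v}, {v, z}}"
    using inc_eq_image[OF t] s by (auto simp: sun_def insert_commute)
  have "inc E x \<union> inc E u \<union> inc E v \<subseteq> E" by (auto simp: inc_def)
  then show M: "sun_edges x u v y z \<subseteq> E" unfolding i sun_edges_def by blast
  show "{x, y} \<in> inc E y" "{u, y} \<in> inc E y" "{x, z} \<in> inc E z" "{v, z} \<in> inc E z"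
    using M by (auto simp: inc_def sun_edges_def)
qed

lemma rest_sub:
  assumes s: "sun E x u v y z" and g: "graph E"
  shows "rest E y x u \<inter> sun_edges x u v y z = {}" "rest E z x v \<inter> sun_edges x u v y z = {}"
    "inc E y = insert {x, y} (insert {u, y} (rest E y x u))" "inc E z = insert {x, z} (insert {v, z} (rest E z x v))"
  using s sun_inc[OF g s] by (auto simp: rest_def sun_edges_def inc_def sun_def doubleton_eq_iff)

text \<open>The conclusion also records what stays fixed and the new colours at \<open>y\<close>,
  because with two suns at \<open>y\<close> the extension is carried out twice.\<close>

lemma sun_extend:
  assumes g: "graph E" and s: "sun E x u v y z" and lb: "lab p (E - sun_edges x u v y z) f h" and li: "on_lists f h"
    and vs: "sun_valid E f h x u v y z xx a b c d" and so: "sun_solvable f x u v y z xx a b c d"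
  shows "\<exists>f' h'. lab p E f' h' \<and> on_lists f' h' \<and> (\<forall>w. w \<notin> {x, u, v} \<longrightarrow> f' w = f w) \<and>
    (\<forall>e. e \<notin> sun_edges x u v y z \<longrightarrow> h' e = h e) \<and> h' {x, y} = a \<and> h' {u, y} = b"
proof -
  let ?M = "sun_edges x u v y z"
  have dist: "distinct [x, u, v, y, z]" using s by (simp add: sun_def)
  from so obtain e0 g0 uu vv where e0: "e0 \<in> LE {x, u}" "e0 \<notin> near p xx" "e0 \<notin> {a, b, c}"
    and g0: "g0 \<in> LE {x, v}" "g0 \<notin> near p xx" "g0 \<notin> {c, d, a}" and eg: "e0 \<noteq> g0"
    and uu: "uu \<in> LV u" "uu \<noteq> f y" "uu \<noteq> xx" "uu \<notin> near p b" "uu \<notin> near p e0"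
    and vv: "vv \<in> LV v" "vv \<noteq> f z" "vv \<noteq> xx" "vv \<notin> near p d" "vv \<notin> near p g0"
    unfolding solvable_def sun_e_def sun_u_def by blast
  have V: "xx \<in> LV x" "xx \<noteq> f y" "xx \<noteq> f z" "a \<noteq> b" "a \<noteq> c" "c \<noteq> d" "a \<notin> near p xx" "c \<notin> near p xx"
    "a \<in> LE {x, y}" "a \<notin> near p (f y)" "a \<notin> h ` rest E y x u" "b \<in> LE {u, y}" "b \<notin> near p (f y)" "b \<notin> h ` rest E y x u"
    "c \<in> LE {x, z}" "c \<notin> near p (f z)" "c \<notin> h ` rest E z x v" "d \<in> LE {v, z}" "d \<notin> near p (f z)" "d \<notin> h ` rest E z x v"
    using vs by (simp_all add: valid_state_def avail_def)
  define f' where "f' = f(x := xx, u := uu, v := vv)"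
  define h' where "h' = h({x, u} := e0, {x, v} := g0, {x, y} := a, {u, y} := b, {x, z} := c, {v, z} := d)"
  have fv: "f' x = xx" "f' u = uu" "f' v = vv" "f' y = f y" "f' z = f z" and fo: "\<And>w. w \<notin> {x, u, v} \<Longrightarrow> f' w = f w"
    using dist by (auto simp: f'_def)
  have hv: "h' {x, u} = e0" "h' {x, v} = g0" "h' {x, y} = a" "h' {u, y} = b" "h' {x, z} = c" "h' {v, z} = d"
    using dist by (auto simp: h'_def doubleton_eq_iff)
  have ho: "h' e = h e" if "e \<notin> ?M" for e using that by (auto simp: h'_def sun_edges_def)
  note I = sun_inc[OF g s] and R = rest_sub[OF s g]
  have inj: "inj_on h (rest E y x u)" "inj_on h (rest E z x v)"
  proof -
    have "rest E y x u \<subseteq> inc (E - ?M) y" "rest E z x v \<subseteq> inc (E - ?M) z" using R(1,2) by (auto simp: rest_def inc_def)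
    moreover have "inj_on h (inc (E - ?M) w)" for w using lb by (simp add: lab_def)
    ultimately show "inj_on h (rest E y x u)" "inj_on h (rest E z x v)" by (meson inj_on_subset)+
  qed
  have "lab p E f' h'"
  proof (rule lab_extend[OF lb, of "{x, u, v}"])
    show "e \<inter> {x, u, v} \<noteq> {} \<longleftrightarrow> e \<in> ?M" if e: "e \<in> E" for e
    proof -
      have "e \<inter> {x, u, v} \<noteq> {} \<longleftrightarrow> e \<in> inc E x \<union> inc E u \<union> inc E v" using e by (auto simp: inc_def)
      also have "inc E x \<union> inc E u \<union> inc E v = ?M" unfolding I(1-3) sun_edges_def by (simp add: insert_commute)
      finally show ?thesis .
    qed
    show "f' w \<noteq> f' t" if w: "w \<in> {x, u, v}" and a: "adj E w t" for w t
    proof -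
      have t: "t \<in> nbr E w" using a by (simp add: nbr_def)
      have N: "nbr E x = {u, v, y, z}" "nbr E u = {x, y}" "nbr E v = {x, z}" using s by (simp_all add: sun_def)
      from w consider "w = x" | "w = u" | "w = v" by blast
      then show ?thesis
        by cases (use t N V(2,3) uu(2,3) vv(2,3) in \<open>auto simp: fv\<close>)
    qed
    show "inj_on h' (inc E w)" if "w \<in> \<Union>?M" for w
    proof -
      have "w \<in> {x, u, v, y, z}" using that by (auto simp: sun_edges_def)
      moreover have "inj_on h' (inc E x)" unfolding I(1) using V(5) e0(3) g0(3) eg by (auto simp: hv)
      moreover have "inj_on h' (inc E u)" unfolding I(2) using e0(3) by (auto simp: hv)
      moreover have "inj_on h' (inc E v)" unfolding I(3) using g0(3) by (auto simp: hv)
      moreover have "inj_on h' (inc E y)" unfolding R(3)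
        by (rule inj_on_new2[OF inj(1)]) (use R(1) ho V(4,11,14) in \<open>auto simp: hv\<close>)
      moreover have "inj_on h' (inc E z)" unfolding R(4)
        by (rule inj_on_new2[OF inj(2)]) (use R(2) ho V(6,17,20) in \<open>auto simp: hv\<close>)
      ultimately show ?thesis by auto
    qed
    show "f' t \<notin> near p (h' e)" if "e \<in> ?M" "t \<in> e" for e t
    proof -
      have "xx \<notin> near p e0" "xx \<notin> near p g0" "xx \<notin> near p a" "f y \<notin> near p a" "f y \<notin> near p b" "xx \<notin> near p c"
        "f z \<notin> near p c" "f z \<notin> near p d"
        using V(7,8,10,13,16,19) e0(2) g0(2) by (simp_all add: near_commute)
      note nn = this uu(4,5) vv(4,5)
      from that(1) consider "e = {x, u}" | "e = {x, v}" | "e = {x, y}" | "e = {u, y}" | "e = {x, z}" | "e = {v, z}"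
        unfolding sun_edges_def by blast
      then show ?thesis by cases (use that(2) nn in \<open>auto simp: hv fv\<close>)
    qed
  qed (use fo ho in auto)
  moreover have "on_lists f' h'" using li V(1,9,12,15,18) e0(1) g0(1) uu(1) vv(1) by (simp add: on_lists_def f'_def h'_def)
  ultimately show ?thesis using fo ho hv by blast
qed

lemma sun_avail_card:
  assumes g: "graph E" and s: "sun E x u v y z"
  shows "D + 2 \<le> card (avail E f h y x u e) + card (inc E y)" "D + 2 \<le> card (avail E f h z x v e) + card (inc E z)"
    "2 \<le> card (avail E f h y x u e)" "2 \<le> card (avail E f h z x v e)"
    "finite (avail E f h y x u e)" "finite (avail E f h z x v e)"
proof -
  have fi: "finite (rest E y x u)" "finite (rest E z x v)" using finite_inc[OF g] by (auto simp: rest_def)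
  have ne: "{x, y} \<noteq> {u, y}" "{x, z} \<noteq> {v, z}" using s by (auto simp: sun_def doubleton_eq_iff)
  have "card (inc E y) = card (rest E y x u) + 2" "card (inc E z) = card (rest E z x v) + 2"
    unfolding rest_sub(3,4)[OF s g] using fi ne by (auto simp: card_insert_if rest_def)
  moreover have "card (h ` rest E y x u) \<le> card (rest E y x u)" "card (h ` rest E z x v) \<le> card (rest E z x v)"
    using fi by (auto intro: card_image_le)
  moreover have "D - card (rest E y x u) \<le> card (avail E f h y x u e)" "D - card (rest E z x v) \<le> card (avail E f h z x v e)"
    unfolding avail_def using fi calculation by (auto intro!: avail_card LE)
  moreover have "card (inc E y) \<le> D" "card (inc E z) \<le> D" using g by (auto simp: graph_def)
  ultimately show "D + 2 \<le> card (avail E f h y x u e) + card (inc E y)" "D + 2 \<le> card (avail E f h z x v e) + card (inc E z)"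
    "2 \<le> card (avail E f h y x u e)" "2 \<le> card (avail E f h z x v e)"
    by linarith+
qed (simp_all add: avail_def)

lemma card_minus1: "card L = D + 2 * p - 1 \<Longrightarrow> finite L \<Longrightarrow> D + 2 * p - 2 \<le> card (L - {a})"
  by (rule card_Diff_ge[of _ 1]) (use D in auto)

lemma card_minus2: "card L = D + 2 * p - 1 \<Longrightarrow> finite L \<Longrightarrow> D + 2 * p - 3 \<le> card (L - {a, b})"
  by (rule card_Diff_ge[of _ 2]) (use D in \<open>auto simp: card_insert_if\<close>)

text \<open>Here D \<ge> p + 3 enters: D + 2p - 2 \<ge> 3p + 1 colours for \<open>u\<close> and
  \<open>v\<close> after excluding \<open>y\<close> or \<open>z\<close>, and D + 2p - 1 \<ge> 3p + 2
  for the edges.\<close>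

lemma sun_lists_avail: "sun_lists p (LV u - {a}) (LV v - {b}) (LE e) (LE e')"
  using p D LE card_minus1[OF LV finLV, of u a] card_minus1[OF LV finLV, of v b] by unfold_locales auto

text \<open>A labelling without \<open>xu\<close> and \<open>xv\<close> already colours
  \<open>x\<close> and the four outer edges of the sun, and thereby supplies a first valid
  state.\<close>

lemma sun_start:
  assumes g: "graph E" and s: "sun E x u v y z" and lb: "lab p E' f h" and li: "on_lists f h"
    and E': "inc E y \<subseteq> E'" "inc E z \<subseteq> E'"
  shows "sun_valid E f h x u v y z (f x) (h {x, y}) (h {u, y}) (h {x, z}) (h {v, z})"
proof -
  have dist: "distinct [x, u, v, y, z]" using s by (simp add: sun_def)
  note I = sun_inc[OF g s] and R = rest_sub[OF s g]
  have m: "{x, y} \<in> E'" "{u, y} \<in> E'" "{x, z} \<in> E'" "{v, z} \<in> E'"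
    using I(4-7) E' by blast+
  have r: "rest E y x u \<subseteq> inc E' y" "rest E z x v \<subseteq> inc E' z"
    using E' by (auto simp: rest_def inc_def)
  have inj: "inj_on h (inc E' w)" for w using lb by (simp add: lab_def)
  have out: "h e \<notin> h ` A" if "A \<subseteq> inc E' w" "e \<in> inc E' w" "e \<notin> A" for A e w
    using inj[of w] that by (meson inj_on_image_mem_iff)
  have ry: "{x, y} \<notin> rest E y x u" "{u, y} \<notin> rest E y x u" "{x, z} \<notin> rest E z x v" "{v, z} \<notin> rest E z x v"
    by (auto simp: rest_def)
  have "h {x, y} \<notin> h ` rest E y x u" "h {u, y} \<notin> h ` rest E y x u"
    "h {x, z} \<notin> h ` rest E z x v" "h {v, z} \<notin> h ` rest E z x v"
    by (intro out[OF r(1)] out[OF r(2)] ry; use m in \<open>simp add: inc_def\<close>)+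
  moreover have "h {x, y} \<noteq> h {u, y}" "h {x, y} \<noteq> h {x, z}" "h {x, z} \<noteq> h {v, z}"
    using inj_onD[OF inj[of y], of "{x, y}" "{u, y}"] inj_onD[OF inj[of x], of "{x, y}" "{x, z}"] inj_onD[OF inj[of z], of "{x, z}" "{v, z}"] m dist
    by (auto simp: inc_def doubleton_eq_iff)
  moreover have "f x \<noteq> f y" "f x \<noteq> f z" using lb m by (auto simp: lab_def adj_def)
  moreover have n: "\<And>e w. e \<in> E' \<Longrightarrow> w \<in> e \<Longrightarrow> f w \<notin> near p (h e)" using lb by (auto simp: lab_def)
  moreover have "h e \<notin> near p (f w)" if "e \<in> E'" "w \<in> e" for e w using n[OF that] near_commute by blast
  ultimately show ?thesis using li m by (auto simp: valid_state_def avail_def on_lists_def)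
qed

lemma sun_easy:
  assumes g: "graph E" and s: "sun E x u v y z" and IH: "labelable (E - {{x, u}, {x, v}})"
    and c: "D \<ge> p + 4 \<or> p = 1 \<or> card (inc E y) < D"
  shows "labelable E"
proof -
  obtain f h where fh: "lab p (E - {{x, u}, {x, v}}) f h" "on_lists f h" using IH by (auto simp: labelable_def)
  have lM: "lab p (E - sun_edges x u v y z) f h" using fh(1) by (rule lab_mono) (auto simp: sun_edges_def)
  have "inc E y \<subseteq> E - {{x, u}, {x, v}}" "inc E z \<subseteq> E - {{x, u}, {x, v}}" using s by (auto simp: inc_def sun_def)
  note s0 = sun_start[OF g s fh this]
  interpret sun_lists p "LV u - {f y}" "LV v - {f z}" "LE {x, u}" "LE {x, v}" by (rule sun_lists_avail)
  have X: "3 * p \<le> card (LV x - {f y, f z})" using card_minus2[OF LV finLV, of x "f y" "f z"] D by linarith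
  note C = sun_avail_card[OF g s, of f h]
  have "\<exists>xx a b c d. sun_valid E f h x u v y z xx a b c d \<and> sun_solvable f x u v y z xx a b c d"
  proof (rule ccontr)
    assume no: "\<not> ?thesis"
    then have unsolvable: "unsolvable xx a b c d" if "sun_valid E f h x u v y z xx a b c d" for xx a b c d using that by blast
    note B = unsolvable_basic[OF unsolvable[OF s0]]
    \<comment> \<open>An unsolvable state forces list size 3p + 2 = D + 2p - 1, that is D = p +
      3.\<close>
    have "\<not> D \<ge> p + 4" using B(10) LE[of "{x, u}"] p by auto
    then consider "p = 1" | "p \<noteq> 2" "card (inc E y) < D" | "p = 2" "card (inc E y) < D" using c by blast
    then show False
    proof cases
      case 1
      have "3 \<le> card (LV x - {f y, f z})" using X 1 by simp
      from solvable_p1[OF 1 this C(3,3,4,4) s0] no show False by blast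
    next
      case 2
      \<comment> \<open>Degree less than D at \<open>y\<close> leaves a third colour for
        \<open>uy\<close>, hence one different from the present colours of \<open>xy\<close> and
        \<open>uy\<close>.\<close>
      have "3 \<le> card (avail E f h y x u {u, y})" using C(1)[of "{u, y}"] 2 by linarith
      then have "2 \<le> card (avail E f h y x u {u, y} - {h {x, y}})" by (intro card_Diff_ge[of _ 1]) auto
      then obtain b where b: "b \<in> avail E f h y x u {u, y} - {h {x, y}}" "b \<noteq> h {u, y}" using card_ge_2_ex_other by metis
      then have "sun_valid E f h x u v y z (f x) (h {x, y}) b (h {x, z}) (h {v, z})" using s0 by (auto simp: valid_state_def)
      from two_unsolvable_uy(1)[OF unsolvable[OF s0] unsolvable[OF this]] b 2 show False by auto
    next
      case 3
      have "6 \<le> card (LV x - {f y, f z})" using X 3 by simp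
      \<comment> \<open>For p = 2 unsolvability would leave exactly two colours for
        \<open>xy\<close>, but a small degree of \<open>y\<close> provides three.\<close>
      from stuck_p2_from_state(1)[OF 3(1) this C(3,3,4,4) s0] unsolvable
      have "avail E f h y x u {x, y} = {h {x, y}, h {x, z}}" by blast
      then have "card (avail E f h y x u {x, y}) \<le> 2" by (simp add: card_insert_if)
      then show False using C(1)[of "{x, y}"] 3 by linarith
    qed
  qed
  then show ?thesis using sun_extend[OF g s lM fh(2)] unfolding labelable_def by blast
qed

lemma inc_minus: "inc (E - M) v = inc E v - M"
  by (auto simp: inc_def)

lemma mem_of_card_Diff: "card (A - {a}) = 2 \<Longrightarrow> 3 \<le> card A \<Longrightarrow> a \<in> A"
  by (cases "a \<in> A") auto

text \<open>With the sun uncoloured, \<open>y\<close> has only the edges \<open>yz\<close>,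
  \<open>yw\<close> and \<open>yt\<close>. Given colours for \<open>y\<close>, \<open>yz\<close> and
  \<open>yw\<close>, the triangle is completed by colouring \<open>tw\<close> first and then
  \<open>t\<close> and \<open>yt\<close> together.\<close>

lemma recolour_y:
  assumes g: "graph E" and s: "sun E x u v y z" and dist: "distinct [x, u, v, y, z, t, w]"
    and ny: "nbr E y = {z, x, u, t, w}" and nt: "nbr E t = {y, w}"
    and lb: "lab p (E - sun_edges x u v y z) f h" and li: "on_lists f h"
    and zeta: "\<zeta> \<in> LE {y, z}" "\<zeta> \<notin> near p (f z)" "\<zeta> \<notin> h ` (inc E z - {{y, z}, {x, z}, {v, z}})"
    and om: "\<omega> \<in> LE {y, w}" "\<omega> \<notin> near p (f w)" "\<omega> \<notin> h ` (inc E w - {{y, w}, {t, w}})" "\<zeta> \<noteq> \<omega>"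
    and cy: "cy \<in> LV y" "cy \<noteq> f z" "cy \<noteq> f w" "cy \<notin> near p \<zeta>" "cy \<notin> near p \<omega>"
  shows "\<exists>f1 h1. lab p (E - sun_edges x u v y z) f1 h1 \<and> on_lists f1 h1 \<and> f1 y = cy \<and> h1 {y, z} = \<zeta> \<and>
    (\<forall>r. r \<notin> {y, t} \<longrightarrow> f1 r = f r) \<and> (\<forall>e. e \<notin> {{y, z}, {y, w}, {y, t}, {t, w}} \<longrightarrow> h1 e = h e)"
proof -
  let ?E = "E - sun_edges x u v y z" and ?N = "{{y, z}, {y, w}, {y, t}, {t, w}}"
  let ?Z = "inc E z - {{y, z}, {x, z}, {v, z}}" and ?W = "inc E w - {{y, w}, {t, w}}"
  have two: "two_sets E" using g by (simp add: graph_def)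
  have nM: "{y, z} \<notin> sun_edges x u v y z" "{y, w} \<notin> sun_edges x u v y z" "{y, t} \<notin> sun_edges x u v y z" "{t, w} \<notin> sun_edges x u v y z"
    using dist by (auto simp: sun_edges_def doubleton_eq_iff)
  have iy: "inc ?E y = {{y, z}, {y, t}, {y, w}}"
  proof -
    have "inc E y = {{y, z}, {y, x}, {y, u}, {y, t}, {y, w}}" using inc_eq_image[OF two, of y] ny by simp
    moreover have "{y, x} \<in> sun_edges x u v y z" "{y, u} \<in> sun_edges x u v y z" by (simp_all add: sun_edges_def insert_commute)
    ultimately show ?thesis using nM by (simp add: inc_minus insert_Diff_if)
  qed
  have it: "inc ?E t = {{y, t}, {t, w}}"
  proof -
    have "inc E t = {{y, t}, {t, w}}" using inc_eq_image[OF two, of t] nt by (simp add: insert_commute)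
    then show ?thesis using nM by (simp add: inc_minus insert_Diff_if)
  qed
  have "inc ?E y \<subseteq> ?E" "inc ?E t \<subseteq> ?E" by (auto simp: inc_def)
  then have NE: "?N \<subseteq> ?E" unfolding iy it by simp
  have iz: "inc ?E z = insert {y, z} ?Z"
  proof -
    have "e \<in> sun_edges x u v y z \<longleftrightarrow> e \<in> {{x, z}, {v, z}}" if "z \<in> e" for e
      using that dist by (auto simp: sun_edges_def)
    then have "inc ?E z = inc E z - {{x, z}, {v, z}}" unfolding inc_minus by (auto simp: inc_def)
    moreover have "{y, z} \<in> inc ?E z" using NE by (auto simp: inc_def)
    ultimately show ?thesis by auto
  qed
  have iw: "inc ?E w = insert {y, w} (insert {t, w} ?W)"
  proof -
    have "e \<notin> sun_edges x u v y z" if "w \<in> e" for e using that dist by (auto simp: sun_edges_def)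
    then have "inc ?E w = inc E w" unfolding inc_minus by (auto simp: inc_def)
    moreover have "{y, w} \<in> inc ?E w" "{t, w} \<in> inc ?E w" using NE by (auto simp: inc_def)
    ultimately show ?thesis by auto
  qed
  have ZN: "?Z \<inter> ?N = {}" "?W \<inter> ?N = {}" using dist by (auto simp: inc_def doubleton_eq_iff)
  have injE: "inj_on h (inc ?E q)" for q using lb by (simp add: lab_def)
  have "?Z \<subseteq> inc ?E z" "?W \<subseteq> inc ?E w" unfolding iz iw by blast+
  then have injh: "inj_on h ?Z" "inj_on h ?W" by (auto intro: inj_on_subset[OF injE])
  have "card (inc ?E w) \<le> D" using graph_mono[OF g, of ?E] by (auto simp: graph_def)
  moreover have fW: "finite ?W" using finite_inc[OF g] by simp
  moreover have "card (inc ?E w) = card ?W + 2" unfolding iw using fW dist by (simp add: card_insert_if doubleton_eq_iff)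
  ultimately have "card ?W \<le> D - 2" by linarith
  then have "card (h ` ?W) \<le> D - 2" using card_image_le[OF fW, of h] by linarith
  \<comment> \<open>Two colours are left for \<open>tw\<close>, one of which differs from that of
    \<open>yw\<close>.\<close>
  then have "D - (D - 2) \<le> card (LE {t, w} - near p (f w) - h ` ?W)" using fW by (intro avail_card LE) auto
  then have "2 \<le> card (LE {t, w} - near p (f w) - h ` ?W)" using D by linarith
  then obtain \<theta> where th: "\<theta> \<in> LE {t, w} - near p (f w) - h ` ?W" "\<theta> \<noteq> \<omega>" using card_ge_2_ex_other by metis
  have "D - 3 \<le> card (LE {y, t} - near p cy - {\<zeta>, \<omega>, \<theta>})" by (intro avail_card LE card3_le) auto
  then have c1: "p \<le> card (LE {y, t} - near p cy - {\<zeta>, \<omega>, \<theta>})" using D by linarith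
  have "D - 2 \<le> card (LV t - near p \<theta> - {cy, f w})" by (intro avail_card LV) (auto simp: card_insert_if)
  then have c2: "p + 1 \<le> card (LV t - near p \<theta> - {cy, f w})" using D by linarith
  obtain tt \<tau> where tt: "tt \<in> LV t - near p \<theta> - {cy, f w}" and ta: "\<tau> \<in> LE {y, t} - near p cy - {\<zeta>, \<omega>, \<theta>}"
    and ttt: "tt \<notin> near p \<tau>"
    by (rule far_pair[OF _ c2 _ c1 p]) auto
  define f' where "f' = f(y := cy, t := tt)"
  define h' where "h' = h({y, z} := \<zeta>, {y, w} := \<omega>, {y, t} := \<tau>, {t, w} := \<theta>)"
  have fv: "f' y = cy" "f' t = tt" "f' z = f z" "f' w = f w" and fo: "\<And>r. r \<notin> {y, t} \<Longrightarrow> f' r = f r"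
    using dist by (auto simp: f'_def)
  have hv: "h' {y, z} = \<zeta>" "h' {y, w} = \<omega>" "h' {y, t} = \<tau>" "h' {t, w} = \<theta>"
    using dist by (auto simp: h'_def doubleton_eq_iff)
  have ho: "h' e = h e" if "e \<notin> ?N" for e using that by (auto simp: h'_def)
  have hZ: "h' e = h e" if "e \<in> ?Z" for e by (rule ho[OF ZN(1)[unfolded disjoint_iff, rule_format, OF that]])
  have hW: "h' e = h e" if "e \<in> ?W" for e by (rule ho[OF ZN(2)[unfolded disjoint_iff, rule_format, OF that]])
  have "lab p (?E - ?N) f h" using lb by (rule lab_mono) auto
  then have "lab p ?E f' h'"
  proof (rule lab_extend[where W = "{y, t}"])
    show "e \<inter> {y, t} \<noteq> {} \<longleftrightarrow> e \<in> ?N" if e: "e \<in> ?E" for e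
    proof -
      have "e \<inter> {y, t} \<noteq> {} \<longleftrightarrow> e \<in> inc ?E y \<union> inc ?E t" using e by (auto simp: inc_def)
      also have "inc ?E y \<union> inc ?E t = ?N" unfolding iy it by (simp add: insert_commute)
      finally show ?thesis .
    qed
    show "f' q \<noteq> f' r" if q: "q \<in> {y, t}" and a: "adj ?E q r" for q r
    proof -
      have r: "{q, r} \<in> inc ?E q" using a by (simp add: adj_def inc_def)
      from q consider "q = y" | "q = t" by blast
      then show ?thesis
      proof cases
        case 1
        then have "r = z \<or> r = t \<or> r = w" using r iy by (auto simp: doubleton_eq_iff)
        then show ?thesis using 1 cy(2,3) tt by (auto simp: fv)
      next
        case 2
        then have "r = y \<or> r = w" using r it by (auto simp: doubleton_eq_iff)
        then show ?thesis using 2 tt by (auto simp: fv)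
      qed
    qed
    show "inj_on h' (inc ?E q)" if "q \<in> \<Union>?N" for q
    proof -
      have "q \<in> {y, t, z, w}" using that by auto
      moreover have "inj_on h' (inc ?E y)" unfolding iy using om(4) ta by (auto simp: hv)
      moreover have "inj_on h' (inc ?E t)" unfolding it using ta by (auto simp: hv)
      moreover have "inj_on h' (inc ?E z)" unfolding iz
        by (rule inj_on_new[OF injh(1) hZ]) (simp_all only: hv zeta(3) not_False_eq_True)
      moreover have "\<theta> \<notin> h ` ?W" "\<omega> \<noteq> \<theta>" using th by blast+
      then have "inj_on h' (inc ?E w)" unfolding iw
        by (intro inj_on_new2[OF injh(2) hW]) (simp_all only: hv om(3) not_False_eq_True)
      ultimately show ?thesis by blast
    qed
    show "f' r \<notin> near p (h' e)" if "e \<in> ?N" "r \<in> e" for e r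
    proof -
      have nn: "f z \<notin> near p \<zeta>" "f w \<notin> near p \<omega>" "f w \<notin> near p \<theta>" "cy \<notin> near p \<tau>"
        using zeta(2) om(2) th ta by (simp_all add: near_commute)
      from that(1) consider "e = {y, z}" | "e = {y, w}" | "e = {y, t}" | "e = {t, w}" by blast
      then show ?thesis by cases (use that(2) nn cy(4,5) tt ttt in \<open>auto simp: hv fv\<close>)
    qed
  qed (use fo ho in auto)
  moreover have "on_lists f' h'" using li cy(1) zeta(1) om(1) th ta tt by (simp add: on_lists_def f'_def h'_def)
  ultimately show ?thesis using fo ho fv hv by blast
qed

text \<open>
  A labelling of the rest that does not extend has essentially the same colour at \<open>y\<close> as the given one.
  As \<open>y\<close>, \<open>yz\<close> and \<open>yw\<close> can be recoloured in many ways, one of them extends.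
\<close>

lemma sun5_labelable:
  assumes p2: "p = 2" and D5: "D = 5" and g: "graph E" and s: "sun E x u v y z" and dist: "distinct [x, u, v, y, z, t, w]"
    and ny: "nbr E y = {z, x, u, t, w}" and nt: "nbr E t = {y, w}" and IH: "labelable (E - {{x, u}, {x, v}})"
  shows "labelable E"
proof (rule ccontr)
  assume no: "\<not> labelable E"
  let ?M = "sun_edges x u v y z"
  obtain f h where fh: "lab p (E - {{x, u}, {x, v}}) f h" "on_lists f h" using IH by (auto simp: labelable_def)
  have lM: "lab p (E - ?M) f h" using fh(1) by (rule lab_mono) (auto simp: sun_edges_def)
  have "inc E y \<subseteq> E - {{x, u}, {x, v}}" "inc E z \<subseteq> E - {{x, u}, {x, v}}" using s by (auto simp: inc_def sun_def)
  note s0 = sun_start[OF g s fh this]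
  \<comment> \<open>\<open>Zr\<close> consists of the edges at \<open>z\<close> that no recolouring
    around \<open>y\<close> or in the sun touches. \<open>Rp\<close> and \<open>Sp\<close> are the
    colours for \<open>xz\<close> and \<open>vz\<close> before the colour of \<open>yz\<close> is
    excluded.\<close>
  define Zr where "Zr = inc E z - {{y, z}, {x, z}, {v, z}}"
  define Rp where "Rp = LE {x, z} - near p (f z) - h ` Zr"
  define Sp where "Sp = LE {v, z} - near p (f z) - h ` Zr"
  have two: "two_sets E" using g by (simp add: graph_def)
  have np: "near p = near 2" by (simp only: p2)
  have incD: "card (inc E q) \<le> 5" for q
  proof -
    have "card (inc E q) \<le> D" using g by (simp add: graph_def)
    then show ?thesis using D5 by linarith
  qed
  have k8: "card (LV q) = 8" for q using LV[of q] p2 D5 by linarith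
  have yz: "{y, z} \<in> E" using ny by (auto simp: nbr_def adj_def)
  have yw: "{y, w} \<in> E" using ny by (auto simp: nbr_def adj_def)
  have tw: "{t, w} \<in> E" using nt by (auto simp: nbr_def adj_def)
  have yz_ne: "{y, z} \<notin> {{x, z}, {v, z}}" "{y, z} \<notin> ?M" using dist by (auto simp: sun_edges_def doubleton_eq_iff)
  have rz: "rest E z x v = insert {y, z} Zr" using yz yz_ne by (auto simp: rest_def Zr_def inc_def)
  have fZr: "finite Zr" using finite_inc[OF g] by (simp add: Zr_def)
  have cZr: "card Zr \<le> 2"
  proof -
    have "inc E z = insert {x, z} (insert {v, z} (insert {y, z} Zr))" using rest_sub(4)[OF s g] rz by simp
    moreover have "card (inc E z) \<le> 5" by (rule incD)
    moreover have "card (insert {x, z} (insert {v, z} (insert {y, z} Zr))) = card Zr + 3"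
      using fZr dist by (simp add: Zr_def card_insert_if doubleton_eq_iff)
    ultimately show ?thesis by simp
  qed
  have cZ: "3 \<le> card (LE e - near p (f z) - h ` Zr)" for e
  proof -
    have "card (h ` Zr) \<le> 2" using card_image_le[OF fZr, of h] cZr by linarith
    then have "D - 2 \<le> card (LE e - near p (f z) - h ` Zr)" using fZr by (intro avail_card LE) auto
    then show ?thesis using D5 by linarith
  qed
  have Rp3: "3 \<le> card Rp" and Sp3: "3 \<le> card Sp" unfolding Rp_def Sp_def by (rule cZ)+
  have stuck: "\<not> (\<exists>xx a b c d. sun_valid E f1 h1 x u v y z xx a b c d \<and> sun_solvable f1 x u v y z xx a b c d)"
    if "lab p (E - ?M) f1 h1" "on_lists f1 h1" for f1 h1
    using sun_extend[OF g s that] no unfolding labelable_def by blast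
  have X6: "6 \<le> card (LV x - {a, b})" and X6f: "finite (LV x - {a, b})" for a b
  proof -
    show "6 \<le> card (LV x - {a, b})" using card_minus2[OF LV finLV, of x a b] D5 p2 by linarith
  qed simp
  have avR: "avail E f1 h1 z x v {x, z} = Rp - {\<zeta>}" "avail E f1 h1 z x v {v, z} = Sp - {\<zeta>}"
    if f1: "f1 z = f z" and h1: "h1 {y, z} = \<zeta>" "\<And>e. e \<in> Zr \<Longrightarrow> h1 e = h e" for f1 h1 \<zeta>
  proof -
    have "h1 ` Zr = h ` Zr" using h1(2) by simp
    then show "avail E f1 h1 z x v {x, z} = Rp - {\<zeta>}" "avail E f1 h1 z x v {v, z} = Sp - {\<zeta>}"
      using f1 h1(1) unfolding avail_def rz Rp_def Sp_def by auto
  qed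
  define \<zeta>0 where "\<zeta>0 = h {y, z}"
  note av0 = avR[of f h \<zeta>0, OF refl \<zeta>0_def[symmetric] refl]
  have yzr: "{y, z} \<in> rest E y x u" using yz dist by (auto simp: rest_def inc_def doubleton_eq_iff)
  have fyz: "f y \<notin> near p \<zeta>0" "f y \<noteq> f z" using lM yz yz_ne unfolding lab_def \<zeta>0_def adj_def by auto
  interpret S0: sun_lists p "LV u - {f y}" "LV v - {f z}" "LE {x, u}" "LE {x, v}" by (rule sun_lists_avail)
  have all0: "\<forall>xx a b c d. sun_valid E f h x u v y z xx a b c d \<longrightarrow> \<not> sun_solvable f x u v y z xx a b c d"
    using stuck[OF lM fh(2)] by blast
  note C0 = sun_avail_card[OF g s, of f h]
  obtain a c x0 g0 where ac: "a \<noteq> c" and P0: "avail E f h y x u {x, y} = {a, c}" and R0: "Rp - {\<zeta>0} = {a, c}"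
    and x0: "x0 \<in> LV x" "x0 \<noteq> f z" "x0 \<noteq> f y" "x0 \<notin> near 2 a" "x0 \<notin> near 2 c"
    and X0: "LV x - {f y, f z} - {x0} \<subseteq> near 2 a \<union> near 2 c"
    and S0: "card (Sp - {\<zeta>0}) = 2" "(Sp - {\<zeta>0}) \<inter> {a, c} = {}"
    and Lu0: "LV u - {f y} = {x0} \<union> \<Union>(near 2 ` avail E f h y x u {u, y})" "card (LV u - {f y}) = 7"
    and Lv0: "LV v - {f z} = {x0} \<union> \<Union>(near 2 ` (Sp - {\<zeta>0}))" "x0 \<notin> \<Union>(near 2 ` (Sp - {\<zeta>0}))"
    and Le0: "LE {x, u} = near 2 x0 \<union> {a, c, g0} \<union> avail E f h y x u {u, y}" "(near 2 x0 \<union> {a, c, g0}) \<inter> avail E f h y x u {u, y} = {}"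
    and Lf0: "LE {x, v} = near 2 x0 \<union> {a, c, g0} \<union> (Sp - {\<zeta>0})" "(near 2 x0 \<union> {a, c, g0}) \<inter> (Sp - {\<zeta>0}) = {}"
      "g0 \<notin> near 2 x0 \<union> {a, c}"
  proof -
    show thesis
    \<comment> \<open>The first outcome of \<open>stuck_p2\<close> is impossible for the given
      labelling, because \<open>s0\<close> is a valid state.\<close>
    proof (rule S0.stuck_p2[OF p2 X6f X6 C0(3,3,4,4) all0], goal_cases)
      case (1 a c)
      have "f x \<in> LV x - {f y, f z}" using s0 by (simp add: valid_state_def)
      then have "f x \<in> near 2 a \<union> near 2 c" by (simp only: 1(5))
      moreover have "h {x, y} \<in> {a, c}" "h {x, z} \<in> {a, c}" "h {x, y} \<noteq> h {x, z}"
        using s0 unfolding valid_state_def 1(2,3) by blast+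
      moreover have "f x \<notin> near 2 (h {x, y})" "f x \<notin> near 2 (h {x, z})"
        using s0 by (simp_all add: valid_state_def near_commute np)
      ultimately show ?case by auto
    next
      case (2 a c x0 g0)
      note T = 2[unfolded av0]
      show ?case
      proof (rule that[of a c x0 g0])
        show "x0 \<in> LV x" "x0 \<noteq> f z" "x0 \<noteq> f y" using T(4) by auto
        show "x0 \<notin> near 2 a" "x0 \<notin> near 2 c" using T(5,6) by (simp_all add: near_commute)
      qed (fact T)+
    qed
  qed
  have Rp: "Rp = {\<zeta>0, a, c}"
  proof -
    have "\<zeta>0 \<in> Rp" by (rule mem_of_card_Diff[OF _ Rp3]) (simp add: R0 ac)
    then show ?thesis using R0 by blast
  qed
  have SpI: "\<zeta>0 \<in> Sp" by (rule mem_of_card_Diff[OF S0(1) Sp3])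
  have afy: "a \<notin> near p (f y)" "c \<notin> near p (f y)" "a \<noteq> \<zeta>0" "c \<noteq> \<zeta>0"
  proof -
    have "a \<in> avail E f h y x u {x, y}" "c \<in> avail E f h y x u {x, y}" using P0 by auto
    then show "a \<notin> near p (f y)" "c \<notin> near p (f y)" "a \<noteq> \<zeta>0" "c \<noteq> \<zeta>0"
      using yzr unfolding avail_def \<zeta>0_def by auto
  qed
  have fy2: "f y \<notin> near 2 a" "f y \<notin> near 2 c" "f y \<notin> near 2 \<zeta>0"
    using afy fyz by (simp_all add: near_commute np)
  have fyu: "f y \<in> LV u"
  proof (rule ccontr)
    assume "f y \<notin> LV u"
    then have "LV u - {f y} = LV u" by simp
    then show False using Lu0(2) k8[of u] by simp
  qed
  have claim: "(f y \<in> LV x \<longrightarrow> f1 y = f y) \<and> (f y \<notin> LV x \<longrightarrow> \<zeta> = \<zeta>0 \<and> f1 y \<in> {f y, x0})"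
    if l1: "lab p (E - ?M) f1 h1" "on_lists f1 h1" and f1: "f1 z = f z"
      and h1: "h1 {y, z} = \<zeta>" "\<And>e. e \<in> Zr \<Longrightarrow> h1 e = h e" for f1 h1 \<zeta>
  proof -
    interpret S1: sun_lists p "LV u - {f1 y}" "LV v - {f1 z}" "LE {x, u}" "LE {x, v}" by (rule sun_lists_avail)
    have all1: "\<forall>xx a b c d. sun_valid E f1 h1 x u v y z xx a b c d \<longrightarrow> \<not> sun_solvable f1 x u v y z xx a b c d"
      using stuck[OF l1] by blast
    note av1 = avR[of f1 h1 \<zeta>, OF f1 h1(1) h1(2)]
    note C1 = sun_avail_card[OF g s, of f1 h1]
    have cyz: "f1 y \<notin> near 2 \<zeta>" using l1(1) yz yz_ne h1(1) unfolding lab_def np by auto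
    show ?thesis
    proof (rule S1.stuck_p2[OF p2 X6f X6 C1(3,3,4,4) all1], goal_cases)
      case (1 a' c')
      have R1: "Rp - {\<zeta>} = {a', c'}" using 1(3) av1 by simp
      have X1: "LV x - {f1 y, f z} = near 2 a' \<union> near 2 c'" "near 2 a' \<inter> near 2 c' = {}" using 1(5,6) f1 by auto
      have zR: "\<zeta> \<in> Rp" by (rule mem_of_card_Diff[OF _ Rp3]) (simp add: R1 1(1))
      \<comment> \<open>In this outcome exactly six of the eight colours of \<open>x\<close> remain
        after excluding \<open>y\<close> and \<open>z\<close>, so the colour of \<open>y\<close> is
        one of the eight.\<close>
      have cyx: "f1 y \<in> LV x"
      proof (rule ccontr)
        assume "f1 y \<notin> LV x"
        then have "LV x - {f1 y, f z} = LV x - {f z}" by auto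
        then have "card (LV x - {f z}) = 6" using 1(4) f1 by simp
        then show False using card_minus1[OF LV finLV, of x "f z"] D5 p2 by linarith
      qed
      have cyfz: "f1 y \<noteq> f z" using l1(1) yz yz_ne f1 unfolding lab_def adj_def by (metis DiffI)
      show ?case
      proof (cases "\<zeta> = \<zeta>0")
        case True
        then have "{a', c'} = {a, c}" using R1 R0 by simp
        then have X1': "LV x - {f1 y, f z} = near 2 a \<union> near 2 c" using X1(1) by (auto simp: doubleton_eq_iff)
        have "x0 = f1 y" using X1' x0 by blast
        moreover have "f y \<in> LV x \<longrightarrow> f y = f1 y" using X1' fy2 fyz(2) by blast
        ultimately show ?thesis using True by auto
      next
        case False
        \<comment> \<open>The new colour of \<open>yz\<close> is \<open>a\<close> or
          \<open>c\<close>; call it \<open>q\<close> and the other one \<open>r\<close>. The six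
          colours left for \<open>x\<close> are then those near the old colour of \<open>yz\<close>
          or near \<open>r\<close>.\<close>
        then obtain q r where qr: "\<zeta> = q" "{q, r} = {a, c}" "q \<noteq> r" using zR Rp ac by (metis insert_commute insertE singletonD)
        have "Rp - {\<zeta>} = {\<zeta>0, r}" using Rp qr afy by (auto simp: doubleton_eq_iff)
        then have "{a', c'} = {\<zeta>0, r}" using R1 by simp
        then have X1': "LV x - {f1 y, f z} = near 2 \<zeta>0 \<union> near 2 r" "near 2 \<zeta>0 \<inter> near 2 r = {}"
          using X1 by (auto simp: doubleton_eq_iff)
        have X0': "LV x - {f y, f z} - {x0} \<subseteq> near 2 q \<union> near 2 r" using X0 qr(2) by (auto simp: doubleton_eq_iff)
        have r: "f y \<notin> near 2 r" "q \<noteq> \<zeta>0" using fy2 qr afy by (auto simp: doubleton_eq_iff)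
        have cq: "f1 y \<notin> near 2 q" "f1 y \<notin> near 2 r" using cyz qr(1) X1'(1) by auto
        show ?thesis
        proof (cases "f y \<in> LV x")
          case True
          have "f1 y = f y"
          proof (rule ccontr)
            assume "f1 y \<noteq> f y"
            then have "f y \<in> LV x - {f1 y, f z}" using True fyz(2) by simp
            then show False using fy2(3) r(1) unfolding X1'(1) by simp
          qed
          then show ?thesis using True by simp
        next
          case nin: False
          have "f1 y \<in> LV x - {f y, f z}" using cyx cyfz nin by auto
          then have "f1 y \<in> near 2 q \<union> near 2 r" if "f1 y \<noteq> x0" using subsetD[OF X0', of "f1 y"] that by simp
          then have "f1 y = x0" using cq by auto
          then have "LV x - {f y, f z} - {x0} = LV x - {f1 y, f z}" using nin by auto
          then have "near 2 \<zeta>0 \<union> near 2 r \<subseteq> near 2 q \<union> near 2 r" using X0' X1'(1) by simp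
          then have "near 2 \<zeta>0 \<subseteq> near 2 q" using X1'(2) by blast
          then have False using near_eqD[of 2 \<zeta>0 q] r by simp
          then show ?thesis ..
        qed
      qed
    next
      case (2 a' c' x1 g1)
      have R1: "Rp - {\<zeta>} = {a', c'}" using 2(3) av1 by simp
      have S1: "card (Sp - {\<zeta>}) = 2" using 2(9) av1 by simp
      have zR: "\<zeta> \<in> Rp" by (rule mem_of_card_Diff[OF _ Rp3]) (simp add: R1 2(1))
      have zS: "\<zeta> \<in> Sp" by (rule mem_of_card_Diff[OF S1 Sp3])
      \<comment> \<open>The colour of \<open>yz\<close> lies in both \<open>Rp\<close> and
        \<open>Sp\<close>, which share only \<open>\<zeta>0\<close>.\<close>
      have eq: "\<zeta> = \<zeta>0"
      proof (rule ccontr)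
        assume "\<zeta> \<noteq> \<zeta>0"
        then have "\<zeta> \<in> (Sp - {\<zeta>0}) \<inter> {a, c}" using zR zS Rp by auto
        then show False using S0(2) by simp
      qed
      have ac': "{a', c'} = {a, c}" using R1 R0 eq by simp
      then have i: "insert a' (insert c' A) = insert a (insert c A)" for A by (auto simp: doubleton_eq_iff)
      have L: "LV v - {f z} = {x1} \<union> \<Union>(near 2 ` (Sp - {\<zeta>0}))" "x1 \<notin> \<Union>(near 2 ` (Sp - {\<zeta>0}))"
        using 2(14,15) av1 f1 eq by simp_all
      \<comment> \<open>The unchanged lists now determine everything in turn: \<open>LV v\<close>
        gives \<open>x0\<close>, \<open>LE {x, v}\<close> gives \<open>g0\<close>,
        \<open>LE {x, u}\<close> gives the colours for \<open>uy\<close>, and \<open>LV u\<close>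
        finally gives the colour of \<open>y\<close>.\<close>
      have "x1 \<in> {x0} \<union> \<Union>(near 2 ` (Sp - {\<zeta>0}))" unfolding Lv0(1)[symmetric] unfolding L(1) by simp
      then have x1: "x1 = x0" using L(2) by simp
      let ?Q = "avail E f h y x u {u, y}" and ?Q1 = "avail E f1 h1 y x u {u, y}"
      have Lf1: "LE {x, v} = near 2 x0 \<union> {a, c, g1} \<union> (Sp - {\<zeta>0})" "(near 2 x0 \<union> {a, c, g1}) \<inter> (Sp - {\<zeta>0}) = {}" "g1 \<notin> near 2 x0 \<union> {a, c}"
        using 2(18,19,20) av1 eq x1 i by simp_all
      have "g1 \<in> LE {x, v}" using Lf1(1) by blast
      then have "g1 \<in> near 2 x0 \<union> {a, c, g0} \<union> (Sp - {\<zeta>0})" using Lf0(1) by simp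
      then have g1: "g1 = g0" using Lf1(2,3) by blast
      have Le1: "LE {x, u} = near 2 x0 \<union> {a, c, g0} \<union> ?Q1" "(near 2 x0 \<union> {a, c, g0}) \<inter> ?Q1 = {}"
        using 2(16,17) x1 g1 i by simp_all
      have "?Q = LE {x, u} - (near 2 x0 \<union> {a, c, g0})" using Le0 by blast
      also have "\<dots> = ?Q1" using Le1 by blast
      finally have Q: "?Q1 = ?Q" by simp
      have Lu1: "LV u - {f1 y} = LV u - {f y}" unfolding 2(12) Lu0(1) Q x1 ..
      have "f1 y = f y"
      proof (rule ccontr)
        assume "f1 y \<noteq> f y"
        then have "f y \<in> LV u - {f1 y}" using fyu by simp
        then show False unfolding Lu1 by simp
      qed
      then show ?case using eq by simp
    qed
  qed
  \<comment> \<open>Candidates for recolouring: \<open>Z\<close> for \<open>yz\<close>,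
    \<open>Pw\<close> for \<open>yw\<close> and \<open>Y\<close> for \<open>y\<close>, with at least
    3, 2 and 6 colours.\<close>
  define Z where "Z = LE {y, z} - near p (f z) - h ` Zr"
  define Wr where "Wr = inc E w - {{y, w}, {t, w}}"
  define Pw where "Pw = LE {y, w} - near p (f w) - h ` Wr"
  define Y where "Y = LV y - {f z, f w}"
  have Z3: "3 \<le> card Z" unfolding Z_def by (rule cZ)
  have Y6: "6 \<le> card Y" unfolding Y_def using card_minus2[OF LV finLV, of y "f z" "f w"] D5 p2 by linarith
  have P2: "2 \<le> card Pw"
  proof -
    have fW: "finite Wr" using finite_inc[OF g] by (simp add: Wr_def)
    have "inc E w = insert {y, w} (insert {t, w} Wr)" using yw tw by (auto simp: Wr_def inc_def)
    moreover have "card (inc E w) \<le> 5" by (rule incD)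
    moreover have "card (insert {y, w} (insert {t, w} Wr)) = card Wr + 2" using fW dist by (simp add: Wr_def card_insert_if doubleton_eq_iff)
    ultimately have "card Wr \<le> 3" by simp
    then have "card (h ` Wr) \<le> 3" using card_image_le[OF fW, of h] by linarith
    then have "D - 3 \<le> card Pw" unfolding Pw_def using fW by (intro avail_card LE) auto
    then show ?thesis using D5 by linarith
  qed
  have tup: "(f y \<in> LV x \<longrightarrow> r = f y) \<and> (f y \<notin> LV x \<longrightarrow> \<zeta> = \<zeta>0 \<and> r \<in> {f y, x0})"
    if tu: "\<zeta> \<in> Z" "\<omega> \<in> Pw" "\<zeta> \<noteq> \<omega>" "r \<in> Y" "r \<notin> near 2 \<zeta>" "r \<notin> near 2 \<omega>" for \<zeta> \<omega> r
  proof -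
    have zt: "\<zeta> \<in> LE {y, z}" "\<zeta> \<notin> near p (f z)" "\<zeta> \<notin> h ` (inc E z - {{y, z}, {x, z}, {v, z}})"
      using that(1) by (simp_all add: Z_def Zr_def)
    have om: "\<omega> \<in> LE {y, w}" "\<omega> \<notin> near p (f w)" "\<omega> \<notin> h ` (inc E w - {{y, w}, {t, w}})"
      using that(2) by (simp_all add: Pw_def Wr_def)
    have rr: "r \<in> LV y" "r \<noteq> f z" "r \<noteq> f w" "r \<notin> near p \<zeta>" "r \<notin> near p \<omega>" using that by (simp_all add: Y_def np)
    obtain f1 h1 where l1: "lab p (E - ?M) f1 h1" "on_lists f1 h1" "f1 y = r" "h1 {y, z} = \<zeta>"
      "\<And>q. q \<notin> {y, t} \<Longrightarrow> f1 q = f q" "\<And>e. e \<notin> {{y, z}, {y, w}, {y, t}, {t, w}} \<Longrightarrow> h1 e = h e"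
      using recolour_y[OF g s dist ny nt lM fh(2) zt om tu(3) rr] by blast
    have fz: "f1 z = f z" by (rule l1(5)) (use dist in auto)
    have hz: "h1 e = h e" if "e \<in> Zr" for e
    proof (rule l1(6))
      show "e \<notin> {{y, z}, {y, w}, {y, t}, {t, w}}" using that dist by (auto simp: Zr_def inc_def)
    qed
    show ?thesis using claim[of f1 h1 \<zeta>, OF l1(1,2) fz l1(4) hz] l1(3) by simp
  qed
  obtain \<omega>0 where o0: "\<omega>0 \<in> Pw" using P2 by fastforce
  obtain \<omega>1 where o1: "\<omega>1 \<in> Pw" "\<omega>1 \<noteq> \<omega>0" using card_ge_2_ex_other[OF P2] by metis
  show False
  proof (cases "f y \<in> LV x")
    \<comment> \<open>Here any recolouring that changes \<open>y\<close> escapes, and the five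
      colours of \<open>Y - {f y}\<close> leave room for one.\<close>
    case True
    have "card {\<omega>0, \<omega>1} \<le> 2" by (simp add: card_insert_if)
    then have "1 \<le> card (Z - {\<omega>0, \<omega>1})" using Z3 by (intro card_Diff_ge[of _ 2]) auto
    then have "Z - {\<omega>0, \<omega>1} \<noteq> {}" by (metis card.empty not_one_le_zero)
    then obtain z1 where z1: "z1 \<in> Z" "z1 \<notin> {\<omega>0, \<omega>1}" by blast
    have "2 \<le> card Z" using Z3 by simp
    then obtain z2 where z2: "z2 \<in> Z" "z2 \<noteq> z1" using card_ge_2_ex_other by metis
    have ne: "{z1, z2} \<noteq> {\<omega>0, \<omega>1}" using z1 by blast
    have "5 \<le> card (Y - {f y})" using Y6 by (intro card_Diff_ge[of _ 1]) auto
    then obtain \<zeta> \<omega> r where "\<zeta> \<in> {z1, z2}" "\<omega> \<in> {\<omega>0, \<omega>1}" "\<zeta> \<noteq> \<omega>" "r \<in> Y - {f y}" "r \<notin> near 2 \<zeta>" "r \<notin> near 2 \<omega>"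
      using uncovered_by_some_pair[OF z2(2)[symmetric] o1(2)[symmetric] ne] by metis
    then show False using tup[of \<zeta> \<omega> r] True z1 z2 o0 o1 by auto
  next
    \<comment> \<open>Here any change of \<open>yz\<close> escapes, so none is possible and
      \<open>Y\<close> is covered by the two disjoint sets near \<open>\<omega>0\<close> and
      \<open>\<omega>1\<close>. Keeping \<open>yz\<close> and choosing either colour for
      \<open>yw\<close> confines all of \<open>Y\<close> but \<open>f y\<close> and
      \<open>x0\<close> to the three colours near \<open>\<zeta>0\<close>.\<close>
    case False
    have "2 \<le> card (Z - {\<zeta>0})" using Z3 by (intro card_Diff_ge[of _ 1]) auto
    then obtain z1 where z1: "z1 \<in> Z - {\<zeta>0}" using card_ge_2_ex_other by metis
    obtain z2 where z2: "z2 \<in> Z - {\<zeta>0}" "z2 \<noteq> z1" using card_ge_2_ex_other[OF \<open>2 \<le> card (Z - {\<zeta>0})\<close>] by metis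
    have cov: "r \<in> near 2 \<zeta> \<union> near 2 \<omega>" if "\<zeta> \<in> {z1, z2}" "\<omega> \<in> {\<omega>0, \<omega>1}" "\<zeta> \<noteq> \<omega>" "r \<in> Y" for \<zeta> \<omega> r
      using tup[of \<zeta> \<omega> r] that False z1 z2 o0 o1 by auto
    have eq: "{z1, z2} = {\<omega>0, \<omega>1}"
    proof (rule ccontr)
      assume ne: "{z1, z2} \<noteq> {\<omega>0, \<omega>1}"
      have "5 \<le> card Y" using Y6 by simp
      then obtain \<zeta> \<omega> r where "\<zeta> \<in> {z1, z2}" "\<omega> \<in> {\<omega>0, \<omega>1}" "\<zeta> \<noteq> \<omega>" "r \<in> Y" "r \<notin> near 2 \<zeta>" "r \<notin> near 2 \<omega>"
        using uncovered_by_some_pair[OF z2(2)[symmetric] o1(2)[symmetric] ne] by metis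
      then show False using cov by blast
    qed
    have oz: "\<omega>0 \<noteq> \<zeta>0" "\<omega>1 \<noteq> \<zeta>0" using eq z1 z2 by (auto simp: doubleton_eq_iff)
    have "\<omega>0 \<in> {z1, z2}" using eq by simp
    then have sub: "Y \<subseteq> near 2 \<omega>0 \<union> near 2 \<omega>1" using cov[of \<omega>0 \<omega>1] o1(2) by blast
    have "card Y \<le> card (near 2 \<omega>0 \<union> near 2 \<omega>1)" using sub by (intro card_mono) auto
    moreover have "card (near 2 \<omega>0 \<union> near 2 \<omega>1) + card (near 2 \<omega>0 \<inter> near 2 \<omega>1) = 6"
      using card_Un_Int[of "near 2 \<omega>0" "near 2 \<omega>1"] by (simp add: card_near)
    ultimately have "card (near 2 \<omega>0 \<inter> near 2 \<omega>1) = 0" using Y6 by linarith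
    then have disj: "near 2 \<omega>0 \<inter> near 2 \<omega>1 = {}" by simp
    have "\<zeta>0 \<in> Z"
    proof -
      have "inj_on h (inc (E - ?M) z)" using lM by (simp add: lab_def)
      moreover have "insert {y, z} Zr \<subseteq> inc (E - ?M) z"
        using yz yz_ne rest_sub(2)[OF s g] unfolding rz by (auto simp: inc_def Zr_def)
      ultimately have "inj_on h (insert {y, z} Zr)" by (rule inj_on_subset)
      then have "\<zeta>0 \<notin> h ` Zr" unfolding \<zeta>0_def inj_on_insert by (auto simp: Zr_def)
      moreover have "f z \<notin> near p \<zeta>0" using lM yz yz_ne unfolding lab_def \<zeta>0_def by auto
      moreover have "\<zeta>0 \<in> LE {y, z}" using fh(2) by (simp add: on_lists_def \<zeta>0_def)
      ultimately show ?thesis by (simp add: Z_def near_commute)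
    qed
    have "Y - {f y, x0} \<subseteq> near 2 \<zeta>0"
    proof
      fix r assume r: "r \<in> Y - {f y, x0}"
      have "r \<in> near 2 \<zeta>0 \<union> near 2 \<omega>0" "r \<in> near 2 \<zeta>0 \<union> near 2 \<omega>1"
        using tup[OF \<open>\<zeta>0 \<in> Z\<close> o0 oz(1)[symmetric], of r] tup[OF \<open>\<zeta>0 \<in> Z\<close> o1(1) oz(2)[symmetric], of r] r False by auto
      then show "r \<in> near 2 \<zeta>0" using disj by blast
    qed
    then have "card (Y - {f y, x0}) \<le> 3" using card_mono[OF finite_near, of "Y - {f y, x0}" 2 \<zeta>0] by (simp add: card_near)
    moreover have "4 \<le> card (Y - {f y, x0})" using Y6 by (intro card_Diff_ge[of _ 2]) (auto simp: card_insert_if)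
    ultimately show False by simp
  qed
qed

text \<open>Both suns lose their two inner edges. The second sun keeps its colours on all outer
  edges except \<open>u'y\<close>, where it can accept all colours but at most one;
  \<open>solvable_p3\<close> then settles the first sun and reserves a colour for
  \<open>u'y\<close>.\<close>

lemma sun6_labelable:
  assumes p3: "p = 3" and D6: "D = 6" and g: "graph E" and s: "sun E x u v y z" and s': "sun E x' u' v' y w"
    and dist: "distinct [x, u, v, y, z, x', u', v', w]" and ny: "nbr E y = {z, x, u, w, x', u'}"
    and IH: "labelable (E - {{x, u}, {x, v}, {x', u'}, {x', v'}})"
  shows "labelable E"
proof -
  let ?M = "sun_edges x u v y z" and ?M' = "sun_edges x' u' v' y w"
  let ?E = "E - ?M"
  obtain f h where fh: "lab p (E - {{x, u}, {x, v}, {x', u'}, {x', v'}}) f h" "on_lists f h" using IH by (auto simp: labelable_def)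
  have two: "two_sets E" using g by (simp add: graph_def)
  have gE: "graph ?E" using graph_mono[OF g] by auto
  have MM: "?M \<inter> ?M' = {}" using dist by (auto simp: sun_edges_def doubleton_eq_iff)
  have vM: "e \<in> ?M \<Longrightarrow> e \<subseteq> {x, u, v, y, z}" "e \<in> ?M' \<Longrightarrow> e \<subseteq> {x', u', v', y, w}" for e by (auto simp: sun_edges_def)
  have nbrE: "nbr ?E q = {r \<in> nbr E q. {q, r} \<notin> ?M}" for q by (auto simp: nbr_def adj_def)
  have sE: "sun ?E x' u' v' y w"
  proof -
    have "nbr ?E q = nbr E q" if "q \<in> {x', u', v'}" for q
    proof -
      have "{q, r} \<notin> ?M" for r using vM(1)[of "{q, r}"] that dist by auto
      then show ?thesis unfolding nbrE by auto
    qed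
    then show ?thesis using s' by (simp add: sun_def)
  qed
  have iy: "inc E y = {{y, z}, {x, y}, {u, y}, {y, w}, {x', y}, {u', y}}"
    using inc_eq_image[OF two, of y] ny by (simp add: insert_commute)
  have nM: "{y, z} \<notin> ?M" "{y, w} \<notin> ?M" "{x', y} \<notin> ?M" "{u', y} \<notin> ?M" "{x, y} \<in> ?M" "{u, y} \<in> ?M"
    "{y, z} \<notin> ?M'" "{y, w} \<notin> ?M'"
    using dist by (auto simp: sun_edges_def doubleton_eq_iff)
  have ne: "{y, z} \<notin> {{x, y}, {u, y}, {x', y}, {u', y}}" "{y, w} \<notin> {{x, y}, {u, y}, {x', y}, {u', y}}"
    "{x', y} \<notin> {{x, y}, {u, y}}" "{u', y} \<notin> {{x, y}, {u, y}}"
    using dist by (auto simp: doubleton_eq_iff)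
  have ry: "rest E y x u = {{y, z}, {y, w}, {x', y}, {u', y}}"
    using ne by (simp add: rest_def iy insert_Diff_if)
  have ry': "rest ?E y x' u' = {{y, z}, {y, w}}"
    using nM ne by (simp add: rest_def inc_minus iy insert_Diff_if)
  have start: "sun_valid ?E f h x' u' v' y w (f x') (h {x', y}) (h {u', y}) (h {x', w}) (h {v', w})"
  proof (rule sun_start[OF gE sE fh])
    show "inc ?E y \<subseteq> E - {{x, u}, {x, v}, {x', u'}, {x', v'}}" "inc ?E w \<subseteq> E - {{x, u}, {x, v}, {x', u'}, {x', v'}}"
      using dist by (auto simp: inc_def)
  qed
  have lab1: "lab p (?E - ?M') f h" using fh(1) by (rule lab_mono) (auto simp: sun_edges_def)
  have start0: "sun_valid E f h x u v y z (f x) (h {x, y}) (h {u, y}) (h {x, z}) (h {v, z})"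
  proof (rule sun_start[OF g s fh])
    show "inc E y \<subseteq> E - {{x, u}, {x, v}, {x', u'}, {x', v'}}" "inc E z \<subseteq> E - {{x, u}, {x, v}, {x', u'}, {x', v'}}"
      using dist by (auto simp: inc_def)
  qed
  define \<alpha>' where "\<alpha>' = h {x', y}"
  interpret S': sun_lists p "LV u' - {f y}" "LV v' - {f w}" "LE {x', u'}" "LE {x', v'}" by (rule sun_lists_avail)
  have "\<exists>b'. \<forall>\<beta>. \<beta> \<noteq> b' \<longrightarrow> sun_solvable f x' u' v' y w (f x') \<alpha>' \<beta> (h {x', w}) (h {v', w})"
  proof (rule ccontr)
    assume n: "\<not> ?thesis"
    then obtain b1 where "\<not> sun_solvable f x' u' v' y w (f x') \<alpha>' b1 (h {x', w}) (h {v', w})" by blast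
    moreover obtain b2 where "b2 \<noteq> b1" "\<not> sun_solvable f x' u' v' y w (f x') \<alpha>' b2 (h {x', w}) (h {v', w})" using n by blast
    ultimately show False using S'.two_unsolvable_uy(1)[of "f x'" \<alpha>' b1 "h {x', w}" "h {v', w}" b2] p3 by simp
  qed
  then obtain b' where b': "\<And>\<beta>. \<beta> \<noteq> b' \<Longrightarrow> sun_solvable f x' u' v' y w (f x') \<alpha>' \<beta> (h {x', w}) (h {v', w})" by blast
  let ?F = "{h {y, z}, h {y, w}}"
  define A where "A e = LE e - near p (f y) - ?F" for e
  \<comment> \<open>Outside the two suns \<open>y\<close> has only the edges \<open>yz\<close> and
    \<open>yw\<close>, so D - 2 = 4 colours are left.\<close>
  have A4: "4 \<le> card (A e)" for e
  proof -
    have "D - 2 \<le> card (A e)" unfolding A_def by (intro avail_card LE) (auto simp: card_insert_if)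
    then show ?thesis using D6 by linarith
  qed
  have X9: "9 \<le> card (LV x - {f y, f z})" using card_minus2[OF LV finLV, of x "f y" "f z"] D6 p3 by linarith
  have X9f: "finite (LV x - {f y, f z})" by simp
  interpret S: sun_lists p "LV u - {f y}" "LV v - {f z}" "LE {x, u}" "LE {x, v}" by (rule sun_lists_avail)
  note C = sun_avail_card(4)[OF g s, of f h]
  have V0: "f x \<in> LV x - {f y, f z}" "h {x, y} \<in> A {x, y}" "h {x, z} \<in> avail E f h z x v {x, z}" "h {v, z} \<in> avail E f h z x v {v, z}"
    "h {x, y} \<noteq> \<alpha>'" "h {x, y} \<noteq> h {x, z}" "h {x, z} \<noteq> h {v, z}" "h {x, y} \<notin> near p (f x)" "h {x, z} \<notin> near p (f x)"
    using start0 unfolding valid_state_def avail_def ry A_def \<alpha>'_def by auto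
  \<comment> \<open>The first sun is planned now but coloured last: the second one is labelled with
    \<open>\<alpha>'\<close> and \<open>\<beta>\<close>, which the plan avoids.\<close>
  from S.solvable_p3[OF p3 X9f X9 A4 A4 A4 C C V0]
  obtain xx a b c d \<beta> where sol: "valid_state p (LV x - {f y, f z}) (A {x, y}) (A {u, y}) (avail E f h z x v {x, z}) (avail E f h z x v {v, z}) xx a b c d"
      "sun_solvable f x u v y z xx a b c d"
    and be: "\<beta> \<in> A {u', y}" "a \<noteq> \<alpha>'" "b \<noteq> \<alpha>'" "\<beta> \<notin> {a, b, \<alpha>', b'}" by metis
  have "\<beta> \<in> avail ?E f h y x' u' {u', y}" using be(1) by (simp add: avail_def ry' A_def)
  then have "sun_valid ?E f h x' u' v' y w (f x') \<alpha>' \<beta> (h {x', w}) (h {v', w})"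
    using start be(4) unfolding \<alpha>'_def valid_state_def by auto
  moreover have "sun_solvable f x' u' v' y w (f x') \<alpha>' \<beta> (h {x', w}) (h {v', w})" using b' be(4) by simp
  ultimately obtain f1 h1 where l1: "lab p ?E f1 h1" "on_lists f1 h1" "\<And>q. q \<notin> {x', u', v'} \<Longrightarrow> f1 q = f q"
    "\<And>e. e \<notin> ?M' \<Longrightarrow> h1 e = h e" "h1 {x', y} = \<alpha>'" "h1 {u', y} = \<beta>"
    using sun_extend[OF gE sE lab1 fh(2)] by metis
  have fyz: "f1 y = f y" "f1 z = f z" using l1(3) dist by auto
  have "h1 ` rest E y x u = {h {y, z}, h {y, w}, \<alpha>', \<beta>}" unfolding ry using l1(4-6) nM(7,8) by simp
  then have avy: "avail E f1 h1 y x u e = A e - {\<alpha>', \<beta>}" for e unfolding avail_def A_def fyz by auto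
  have avz: "avail E f1 h1 z x v e = avail E f h z x v e" for e
  proof -
    have "h1 e = h e" if "e \<in> rest E z x v" for e
    proof (rule l1(4))
      show "e \<notin> ?M'" using that vM(2)[of e] dist by (auto simp: rest_def inc_def)
    qed
    then have "h1 ` rest E z x v = h ` rest E z x v" by simp
    then show ?thesis by (simp add: avail_def fyz)
  qed
  have "sun_valid E f1 h1 x u v y z xx a b c d"
    using sol(1) be unfolding avy avz fyz valid_state_def by auto
  moreover have "sun_solvable f1 x u v y z xx a b c d" using sol(2) by (simp add: fyz)
  ultimately show ?thesis using sun_extend[OF g s l1(1,2)] unfolding labelable_def by blast
qed

theorem outerplanar_labelable:
  assumes "graph E" "no_theta E" "no_cross E"
  shows "labelable E"
  using assms
proof (induction "card E" arbitrary: E rule: less_induct)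
  case less
  note g = less.prems(1)
  have fE: "finite E" and two: "two_sets E" using g by (auto simp: graph_def)
  have IH: "labelable (E - M)" if "M \<inter> E \<noteq> {}" for M
  proof (rule less.hyps)
    show "card (E - M) < card E" using that fE by (intro psubset_card_mono) auto
    show "graph (E - M)" by (rule graph_mono[OF g Diff_subset])
    show "no_theta (E - M)" by (rule no_theta_mono[OF less.prems(2) Diff_subset])
    show "no_cross (E - M)" by (rule no_cross_mono[OF less.prems(3) Diff_subset])
  qed
  show ?case
  proof (cases "E = {}")
    case True
    have "LV v \<noteq> {}" "LE e \<noteq> {}" for v e using LV[of v] LE[of e] p D by auto
    then have "on_lists (\<lambda>v. SOME a. a \<in> LV v) (\<lambda>e. SOME a. a \<in> LE e)" by (simp add: on_lists_def some_in_eq)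
    moreover have "lab p E f h" for f h using True by (simp add: lab_def adj_def inc_def)
    ultimately show ?thesis unfolding labelable_def by blast
  next
    case False
    have "finite e" if "e \<in> E" for e using that two unfolding two_sets_def by (metis finite.emptyI finite.insertI)
    then have fin: "finite (\<Union>E)" using fE by blast
    have two': "\<exists>u v. e = {u, v} \<and> u \<noteq> v" if "e \<in> E" for e using that two unfolding two_sets_def by blast
    have cD: "card (nbr E y) \<le> D" for y
      using g unfolding graph_def card_inc[OF two] by blast
    have sunIH: "labelable (E - {{x, u}, {x, v}})" if "sun E x u v y z" for x u v y z
      using IH[of "{{x, u}, {x, v}}"] sun_inc(8)[OF g that] by (auto simp: sun_edges_def)
    show ?thesis
    proof (rule outerplanar_configuration[OF fin False two' less.prems(2,3)])
      fix u v assume n: "nbr E u = {v}"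
      then have "{u, v} \<in> E" by (auto simp: nbr_def adj_def)
      then show ?thesis using pendant_labelable[OF g n] IH[of "{{u, v}}"] by simp
    next
      fix u v assume n: "adj E u v" "card (nbr E u) = 2" "card (nbr E v) \<le> 3"
      then have "{u, v} \<in> E" by (simp add: adj_def)
      then show ?thesis using light_labelable[OF g n] IH[of "{{u, v}}"] by simp
    next
      fix x u v y z assume s: "sun E x u v y z" "card (nbr E y) \<le> 4"
      show ?thesis
      proof (rule sun_easy[OF g s(1) sunIH[OF s(1)]])
        \<comment> \<open>For p \<ge> 2 the degree 4 is below p + 3.\<close>
        show "D \<ge> p + 4 \<or> p = 1 \<or> card (inc E y) < D"
          using s(2) p D card_inc[OF two, of y] by linarith
      qed
    next
      fix x u v y z t w assume s: "sun E x u v y z" "distinct [x, u, v, y, z, t, w]" "nbr E y = {z, x, u, t, w}" "nbr E t = {y, w}"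
      have "card (inc E y) = 5" using s(2,3) card_inc[OF two, of y] by (auto simp: card_insert_if)
      show ?thesis
      proof (cases "p = 2 \<and> D = 5")
        case True
        then show ?thesis using sun5_labelable[OF _ _ g s sunIH[OF s(1)]] by simp
      next
        case False
        show ?thesis
        proof (rule sun_easy[OF g s(1) sunIH[OF s(1)]])
          \<comment> \<open>For p \<ge> 3 the degree 5 is below p + 3; for p = 2 and D \<noteq> 5
            one has D \<ge> p + 4.\<close>
          show "D \<ge> p + 4 \<or> p = 1 \<or> card (inc E y) < D"
            using \<open>card (inc E y) = 5\<close> False p D by linarith
        qed
      qed
    next
      fix x u v y z x' u' v' w assume s: "sun E x u v y z" "sun E x' u' v' y w" "distinct [x, u, v, y, z, x', u', v', w]"
        "nbr E y = {z, x, u, w, x', u'}"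
      have c6: "card (inc E y) = 6" using s(3,4) card_inc[OF two, of y] by (auto simp: card_insert_if)
      show ?thesis
      proof (cases "p = 3 \<and> D = 6")
        case True
        have "labelable (E - {{x, u}, {x, v}, {x', u'}, {x', v'}})"
          using IH[of "{{x, u}, {x, v}, {x', u'}, {x', v'}}"] sun_inc(8)[OF g s(1)] by (auto simp: sun_edges_def)
        then show ?thesis using sun6_labelable[OF _ _ g s] True by simp
      next
        case False
        show ?thesis
        proof (rule sun_easy[OF g s(1) sunIH[OF s(1)]])
          \<comment> \<open>For p \<ge> 4 the degree 6 is below p + 3. For p = 2 the degree of
            \<open>y\<close> itself gives D \<ge> 6 = p + 4, and for p = 3 the value D = 6 has been
            treated.\<close>
          show "D \<ge> p + 4 \<or> p = 1 \<or> card (inc E y) < D"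
            using c6 False p D cD[of y] card_inc[OF two, of y] by linarith
        qed
      qed
    qed
  qed
qed

end

theorem theorem4p1:
  fixes p :: nat and V :: "'a set" and E :: "'a set set"
  assumes "p \<ge> 1"
    and "simple_graph V E" and "connected_graph V E"
    and "outerplanar V E"
    and "max_degree V E \<ge> p + 3"
  shows "p1_total_choosability p V E \<le> max_degree V E + 2 * p - 1"
  unfolding p1_total_choosability_def
proof (intro Least_le allI impI)
  fix L :: "'a + 'a set \<Rightarrow> nat set"
  let ?k = "max_degree V E + 2 * p - 1"
  assume L: "\<forall>x\<in>total_elems V E. finite (L x) \<and> card (L x) = ?k"
  have finV: "finite V" and ed: "\<And>e. e \<in> E \<Longrightarrow> \<exists>u v. e = {u, v} \<and> u \<noteq> v \<and> u \<in> V \<and> v \<in> V"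
    using assms(2) by (auto simp: simple_graph_def)
  have EV: "e \<subseteq> V" if "e \<in> E" for e using ed[OF that] by auto
  have finE: "finite E" using EV finV by (intro finite_subset[of E "Pow V"]) auto
  \<comment> \<open>The lists are moved to the integers, and elements outside the graph get a
    default list of the same size, as \<open>listing\<close> asks for lists everywhere.\<close>
  define LV where "LV v = (if v \<in> V then int ` L (Inl v) else {0..<int ?k})" for v
  define LE where "LE e = (if e \<in> E then int ` L (Inr e) else {0..<int ?k})" for e
  have "card (LV v) = ?k" for v
  proof (cases "v \<in> V")
    case True
    then have "card (L (Inl v)) = ?k" using L by (auto simp: total_elems_def)
    then show ?thesis using True by (simp add: LV_def card_image)
  qed (simp add: LV_def)
  moreover have "card (LE e) = ?k" for e
  proof (cases "e \<in> E")
    case True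
    then have "card (L (Inr e)) = ?k" using L by (auto simp: total_elems_def)
    then show ?thesis using True by (simp add: LE_def card_image)
  qed (simp add: LE_def)
  ultimately interpret listing p "max_degree V E" LV LE using assms(1,5) by unfold_locales
  have "graph E"
  proof -
    have "card (inc E v) \<le> max_degree V E" for v
    proof (cases "v \<in> V")
      case True
      then show ?thesis using finV unfolding max_degree_def degree_def inc_def by (intro Max_ge) auto
    next
      case False
      then have "inc E v = {}" using EV by (auto simp: inc_def)
      then show ?thesis by simp
    qed
    moreover have "two_sets E" using ed unfolding two_sets_def by blast
    ultimately show ?thesis using finE by (simp add: graph_def)
  qed
  moreover have "no_theta E" "no_cross E" using outerplanar_no_theta_no_cross[OF assms(2,4)] by auto
  ultimately have "labelable E" by (rule outerplanar_labelable)
  then obtain f h where fh: "lab p E f h" "on_lists f h" unfolding labelable_def by blast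
  \<comment> \<open>All lists contain nonnegative integers only, so \<open>nat\<close> loses
    nothing.\<close>
  define c where "c = case_sum (\<lambda>v. nat (f v)) (\<lambda>e. nat (h e))"
  have f: "int (nat (f v)) = f v" "v \<in> V \<Longrightarrow> nat (f v) \<in> L (Inl v)" for v
  proof -
    have m: "f v \<in> LV v" using fh(2) by (simp add: on_lists_def)
    then show "int (nat (f v)) = f v" by (auto simp: LV_def split: if_splits)
    show "nat (f v) \<in> L (Inl v)" if "v \<in> V" using m that by (auto simp: LV_def)
  qed
  have h: "int (nat (h e)) = h e" "e \<in> E \<Longrightarrow> nat (h e) \<in> L (Inr e)" for e
  proof -
    have m: "h e \<in> LE e" using fh(2) by (simp add: on_lists_def)
    then show "int (nat (h e)) = h e" by (auto simp: LE_def split: if_splits)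
    show "nat (h e) \<in> L (Inr e)" if "e \<in> E" using m that by (auto simp: LE_def)
  qed
  have ci: "int (c (Inl u)) = f u" "int (c (Inr e)) = h e" for u e
    unfolding c_def sum.case by (rule f(1), rule h(1))
  have "p1_total_labelling p V E c"
    unfolding p1_total_labelling_def
  proof (intro conjI allI ballI impI)
    fix u v assume "{u, v} \<in> E"
    then have "f u \<noteq> f v" using fh(1) by (auto simp: lab_def adj_def)
    then show "c (Inl u) \<noteq> c (Inl v)" using ci by metis
  next
    fix e e' assume e: "e \<in> E" "e' \<in> E" "e \<noteq> e' \<and> e \<inter> e' \<noteq> {}"
    then obtain w where "w \<in> e" "w \<in> e'" by blast
    moreover have "inj_on h (inc E w)" using fh(1) by (simp add: lab_def)
    ultimately have "h e \<noteq> h e'" using e by (auto simp: inc_def inj_on_def)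
    then show "c (Inr e) \<noteq> c (Inr e')" using ci by metis
  next
    fix u e assume "u \<in> V" "e \<in> E" "u \<in> e"
    then have "f u \<notin> near p (h e)" using fh(1) by (auto simp: lab_def)
    then show "int p \<le> \<bar>int (c (Inl u)) - int (c (Inr e))\<bar>"
      by (auto simp: ci near_def)
  qed
  moreover have "\<forall>x\<in>total_elems V E. c x \<in> L x" using f(2) h(2) by (auto simp: total_elems_def c_def)
  ultimately show "L_p1_total_labelable p V E L" unfolding L_p1_total_labelable_def by blast
qed

end
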